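(* For any $v(\zeta,q,p)=(v_1,\dots,v_d)$ in Schwartz class on $\mathbb{R}^{3d}$ and any $\psi\in\mathcal{S}(\mathbb{R}^d;\mathbb{C})$, $$\int_{\mathbb{R}^{3d}}\mathrm{e}^{\mathrm{i}\tilde\Phi(t,\xi,\zeta,q,p)/\varepsilon}\,(\xi-P)_j\,v_j\,\psi(\zeta)\,d\zeta\,dq\,dp=\int_{\mathbb{R}^{3d}}\mathrm{e}^{\mathrm{i}\tilde\Phi(t,\xi,\zeta,q,p)/\varepsilon}\,\bigl(-\mathrm{i}\varepsilon\,\partial_{z_k}(v_j\,Z^{-1}_{jk})\bigr)\,\psi(\zeta)\,d\zeta\,dq\,dp,$$ with summation over repeated indices $j,k\in\{1,\dots,d\}$; i.e. $(\xi-P)_jv_j$ and $-\mathrm{i}\varepsilon\,\partial_{z_k}(v_jZ^{-1}_{jk})$ are equivalent under the dual phase function $\tilde\Phi$.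
   Context: $\varepsilon>0$. $H(Q,P)=T(P)+V(Q)$ is a real Hamiltonian on $\mathbb{R}^{2d}$, assumed smooth enough. $(Q,P)=(Q,P)(t,q,p)$ is its Hamiltonian flow: $\dot Q=\partial_PH(Q,P)$, $\dot P=-\partial_QH(Q,P)$, $(Q,P)|_{t=0}=(q,p)$. The dual action $\tilde S(t,q,p)$ solves $\frac{d}{dt}\tilde S=Q\cdot\partial_QH(Q,P)-H(Q,P)$, $\tilde S(0,q,p)=0$. The dual phase function is $$\tilde\Phi(t,\xi,\zeta,q,p)=\tilde S-(\xi-P)\cdot Q+\tfrac{\mathrm{i}}2|\xi-P|^2+(\zeta-p)\cdot q+\tfrac{\mathrm{i}}2|\zeta-p|^2,$$ with $\tilde S,Q,P$ evaluated at $(t,q,p)$. Define $\partial_{z_k}=\partial_{q_k}-\mathrm{i}\partial_{p_k}$ and the matrix $Z_{jk}=\partial_{z_j}(Q_k+\mathrm{i}P_k)$, which is invertible for all $(q,p)$ with $|\det Z|\ge2^{d/2}$; $Z^{-1}_{jk}$ is the $(j,k)$ entry of $Z^{-1}$. The Fourier integral operator with symbol $u$ is $[\mathcal{I}^\varepsilon_{\tilde\Phi}(u)\psi](\xi)=(2\pi\varepsilon)^{-3d/2}\int_{\mathbb{R}^{3d}}\mathrm{e}^{\mathrm{i}\tilde\Phi/\varepsilon}\,u\,\psi(\zeta)\,d\zeta\,dq\,dp$, and two symbols $f,g$ are called equivalent under $\tilde\Phi$ if $\mathcal{I}^\varepsilon_{\tilde\Phi}(f)\psi=\mathcal{I}^\varepsilon_{\tilde\Phi}(g)\psi$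 for every $\psi\in\mathcal{S}(\mathbb{R}^d;\mathbb{C})$.
   Formalization: The identity is stated whenever the right-hand integral converges absolutely (it can diverge for smooth H without growth conditions); convergence and the equivalence of the symbols are asserted when the second and third derivatives of T and V are bounded. H is taken to be C^3. *)

theory Defs
  imports "HOL-Analysis.Analysis"
begin

definition partial :: "'a::real_normed_vector \<Rightarrow> ('a \<Rightarrow> 'b::real_normed_vector) \<Rightarrow> 'a \<Rightarrow> 'b" where
  "partial b f x = vector_derivative (\<lambda>s. f (x + s *\<^sub>R b)) (at 0)"

primrec partials :: "'a::real_normed_vector list \<Rightarrow> ('a \<Rightarrow> 'b::real_normed_vector) \<Rightarrow> 'a \<Rightarrow> 'b" where
  "partials [] f = f"
| "partials (b # bs) f = partial b (partials bs f)"

text \<open>\<open>Ck k f\<close>: \<open>f\<close> is of class \<open>C\<^sup>k\<close> on the whole space. Total differentiability is implied by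
  continuity of the partial derivatives, but has to be required at each step because
  \<^const>\<open>vector_derivative\<close> is a total function with arbitrary values where no derivative exists.\<close>

primrec Ck :: "nat \<Rightarrow> ('a::euclidean_space \<Rightarrow> 'b::real_normed_vector) \<Rightarrow> bool" where
  "Ck 0 f \<longleftrightarrow> continuous_on UNIV f"
| "Ck (Suc k) f \<longleftrightarrow> (\<forall>x. f differentiable (at x)) \<and> (\<forall>b\<in>Basis. Ck k (partial b f))"

definition schwartz :: "('a::euclidean_space \<Rightarrow> 'b::real_normed_vector) \<Rightarrow> bool" where
  "schwartz f \<longleftrightarrow> (\<forall>k. Ck k f) \<and>
     (\<forall>bs N. set bs \<subseteq> Basis \<longrightarrow> bounded (range (\<lambda>x. norm x ^ N *\<^sub>R partials bs f x)))"

text \<open>The usual growth condition on Hamiltonians in semiclassical analysis, up to third order. It bounds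
  the first and second derivatives of the flow, and so makes derivatives of \<open>Z\<^sup>-\<^sup>1\<close> integrable against
  Schwartz functions. Smoothness of the Hamiltonian alone does not guarantee this.\<close>

definition subquadratic :: "('a::euclidean_space \<Rightarrow> real) \<Rightarrow> bool" where
  "subquadratic f \<longleftrightarrow>
     (\<forall>bs. set bs \<subseteq> Basis \<and> length bs \<in> {2, 3} \<longrightarrow> bounded (range (partials bs f)))"

definition grad :: "(real ^ 'n \<Rightarrow> real) \<Rightarrow> real ^ 'n \<Rightarrow> real ^ 'n" where
  "grad f x = (\<chi> i. partial (axis i 1) f x)"

definition separable_hamiltonian ::
  "(real ^ 'n \<Rightarrow> real) \<Rightarrow> (real ^ 'n \<Rightarrow> real) \<Rightarrow> real ^ 'n \<Rightarrow> real ^ 'n \<Rightarrow> real" where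
  "separable_hamiltonian T V x y = T y + V x"

definition hamiltonian_flow ::
  "(real ^ 'n \<Rightarrow> real ^ 'n \<Rightarrow> real) \<Rightarrow>
   (real \<Rightarrow> real ^ 'n \<Rightarrow> real ^ 'n \<Rightarrow> real ^ 'n) \<Rightarrow>
   (real \<Rightarrow> real ^ 'n \<Rightarrow> real ^ 'n \<Rightarrow> real ^ 'n) \<Rightarrow> bool" where
  "hamiltonian_flow H Q P \<longleftrightarrow> (\<forall>q p. Q 0 q p = q \<and> P 0 q p = p \<and>
     (\<forall>t. ((\<lambda>s. Q s q p) has_vector_derivative
             grad (\<lambda>y. H (Q t q p) y) (P t q p)) (at t) \<and>
          ((\<lambda>s. P s q p) has_vector_derivative
             - grad (\<lambda>x. H x (P t q p)) (Q t q p)) (at t)))"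

definition dual_action ::
  "(real ^ 'n \<Rightarrow> real ^ 'n \<Rightarrow> real) \<Rightarrow>
   (real \<Rightarrow> real ^ 'n \<Rightarrow> real ^ 'n \<Rightarrow> real ^ 'n) \<Rightarrow>
   (real \<Rightarrow> real ^ 'n \<Rightarrow> real ^ 'n \<Rightarrow> real ^ 'n) \<Rightarrow>
   (real \<Rightarrow> real ^ 'n \<Rightarrow> real ^ 'n \<Rightarrow> real) \<Rightarrow> bool" where
  "dual_action H Q P S \<longleftrightarrow> (\<forall>q p. S 0 q p = 0 \<and>
     (\<forall>t. ((\<lambda>s. S s q p) has_real_derivative
             Q t q p \<bullet> grad (\<lambda>x. H x (P t q p)) (Q t q p) - H (Q t q p) (P t q p)) (at t)))"

definition dual_phase ::
  "(real \<Rightarrow> real ^ 'n \<Rightarrow> real ^ 'n \<Rightarrow> real) \<Rightarrow>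
   (real \<Rightarrow> real ^ 'n \<Rightarrow> real ^ 'n \<Rightarrow> real ^ 'n) \<Rightarrow>
   (real \<Rightarrow> real ^ 'n \<Rightarrow> real ^ 'n \<Rightarrow> real ^ 'n) \<Rightarrow>
   real \<Rightarrow> real ^ 'n \<Rightarrow> real ^ 'n \<Rightarrow> real ^ 'n \<Rightarrow> real ^ 'n \<Rightarrow> complex" where
  "dual_phase S Q P t \<xi> \<zeta> q p =
     of_real (S t q p) - of_real ((\<xi> - P t q p) \<bullet> Q t q p)
     + \<i> / 2 * of_real ((norm (\<xi> - P t q p))\<^sup>2)
     + of_real ((\<zeta> - p) \<bullet> q) + \<i> / 2 * of_real ((norm (\<zeta> - p))\<^sup>2)"

definition dz :: "'n \<Rightarrow> ((real ^ 'n) \<times> (real ^ 'n) \<Rightarrow> complex) \<Rightarrow> (real ^ 'n) \<times> (real ^ 'n) \<Rightarrow> complex" where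
  "dz k F x = partial (axis k 1, 0) F x - \<i> * partial (0, axis k 1) F x"

definition Zmat ::
  "(real \<Rightarrow> real ^ 'n \<Rightarrow> real ^ 'n \<Rightarrow> real ^ 'n) \<Rightarrow>
   (real \<Rightarrow> real ^ 'n \<Rightarrow> real ^ 'n \<Rightarrow> real ^ 'n) \<Rightarrow>
   real \<Rightarrow> real ^ 'n \<Rightarrow> real ^ 'n \<Rightarrow> complex ^ 'n ^ 'n" where
  "Zmat Q P t q p =
     (\<chi> j k. dz j (\<lambda>(q', p'). of_real (Q t q' p' $ k) + \<i> * of_real (P t q' p' $ k)) (q, p))"

definition fio_integrand ::
  "real \<Rightarrow> (real ^ 'n \<Rightarrow> real ^ 'n \<Rightarrow> real ^ 'n \<Rightarrow> real ^ 'n \<Rightarrow> complex) \<Rightarrow>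
   (real ^ 'n \<Rightarrow> real ^ 'n \<Rightarrow> real ^ 'n \<Rightarrow> real ^ 'n \<Rightarrow> complex) \<Rightarrow>
   (real ^ 'n \<Rightarrow> complex) \<Rightarrow> real ^ 'n \<Rightarrow> (real ^ 'n) \<times> (real ^ 'n) \<times> (real ^ 'n) \<Rightarrow> complex" where
  "fio_integrand \<epsilon> \<Phi> u \<psi> \<xi> =
     (\<lambda>(\<zeta>, q, p). exp (\<i> * \<Phi> \<xi> \<zeta> q p / of_real \<epsilon>) * u \<xi> \<zeta> q p * \<psi> \<zeta>)"

definition fio ::
  "real \<Rightarrow> (real ^ 'n \<Rightarrow> real ^ 'n \<Rightarrow> real ^ 'n \<Rightarrow> real ^ 'n \<Rightarrow> complex) \<Rightarrow>
   (real ^ 'n \<Rightarrow> real ^ 'n \<Rightarrow> real ^ 'n \<Rightarrow> real ^ 'n \<Rightarrow> complex) \<Rightarrow>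
   (real ^ 'n \<Rightarrow> complex) \<Rightarrow> real ^ 'n \<Rightarrow> complex" where
  "fio \<epsilon> \<Phi> u \<psi> \<xi> =
     of_real ((2 * pi * \<epsilon>) powr (- (3 * real CARD('n) / 2))) *
     integral\<^sup>L lborel (fio_integrand \<epsilon> \<Phi> u \<psi> \<xi>)"

definition symbols_equivalent ::
  "real \<Rightarrow> (real ^ 'n \<Rightarrow> real ^ 'n \<Rightarrow> real ^ 'n \<Rightarrow> real ^ 'n \<Rightarrow> complex) \<Rightarrow>
   (real ^ 'n \<Rightarrow> real ^ 'n \<Rightarrow> real ^ 'n \<Rightarrow> real ^ 'n \<Rightarrow> complex) \<Rightarrow>
   (real ^ 'n \<Rightarrow> real ^ 'n \<Rightarrow> real ^ 'n \<Rightarrow> real ^ 'n \<Rightarrow> complex) \<Rightarrow> bool" where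
  "symbols_equivalent \<epsilon> \<Phi> f g \<longleftrightarrow> (\<forall>\<psi>. schwartz \<psi> \<longrightarrow> fio \<epsilon> \<Phi> f \<psi> = fio \<epsilon> \<Phi> g \<psi>)"

end

theory Submission
  imports Defs "HOL-Probability.Sinc_Integral"
begin

text \<open>Along the flow, the action equation gives \<open>\<partial>S = q \<bullet> \<partial>p - Q \<bullet> \<partial>P\<close> in every direction of
  phase space, so the derivative of the phase in the direction \<open>z\<^sub>k\<close> collapses to
  \<open>- (\<Sum>m. Z\<^sub>k\<^sub>m (\<xi> - P)\<^sub>m)\<close>. Multiplying by \<open>Z\<^sup>-\<^sup>1\<close> expresses \<open>(\<xi> - P)\<^sub>j\<close> times the exponential
  through derivatives of the exponential, and the two integrands differ by the divergence of
  the exponential times \<open>v\<^sub>j Z\<^sup>-\<^sup>1\<^sub>j\<^sub>k \<psi>\<close>. This vector field is integrable without any growth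
  condition: since the flow is symplectic, \<open>|w Z|\<^sup>2 \<ge> 2 |w|\<^sup>2\<close> for every row vector \<open>w\<close>, so the
  entries of \<open>Z\<^sup>-\<^sup>1\<close> are bounded by 1. An integrable divergence of an integrable field has
  integral zero. Growth conditions enter only through the derivatives of \<open>Z\<^sup>-\<^sup>1\<close>, which require
  two derivatives of the flow in its initial data; these are obtained from Gronwall's inequality.\<close>

section \<open>Dependence of solutions on initial data\<close>

text \<open>The flow is known only through its differential equation in time, so its regularity in
  \<open>(q, p)\<close> has to be extracted from that of \<open>T\<close> and \<open>V\<close>: a
  Hamiltonian of class C^3 has a vector field of class C^2, which yields the two derivatives in the
  initial data that \<open>Z\<close> and its derivatives consume. Everything is differentiated along
  lines, as in \<open>partial\<close> and \<open>dz\<close>; no total derivative of the flow is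
  formed. The obstacle in the integration by parts is that derivatives of the flow may be unbounded,
  so the derivative of the exponential in a single direction need not be integrable. Only the
  contraction with \<open>Z^-1\<close> over all directions turns it into
  \<open>(\<xi> - P)_j\<close>, which is harmless because the exponential has modulus at most
  \<open>exp (- |\<xi> - P|^2 / (2 * \<epsilon>))\<close>. Hence the divergence is never split into
  its summands. Integrability in \<open>(\<zeta>, q, p)\<close> comes from the decay of
  \<open>v\<close>; the other factors act as bounded multipliers.\<close>

lemma has_derivative_comp_fst:
  assumes "\<And>x. (g has_derivative g' x) (at x)"
  shows "((\<lambda>z. g (fst z)) has_derivative (\<lambda>h. g' (fst z) (fst h))) (at z)"
  using has_derivative_compose[OF has_derivative_fst[OF has_derivative_ident] assms] by blast

lemma has_derivative_comp_snd:
  assumes "\<And>x. (g has_derivative g' x) (at x)"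
  shows "((\<lambda>z. g (snd z)) has_derivative (\<lambda>h. g' (snd z) (snd h))) (at z)"
  using has_derivative_compose[OF has_derivative_snd[OF has_derivative_ident] assms] by blast

lemma continuous_on_comp_fst: "continuous_on UNIV g \<Longrightarrow> continuous_on UNIV (\<lambda>z. g (fst z))"
  by (rule continuous_on_compose2[OF _ continuous_on_fst[OF continuous_on_id]]) auto

lemma continuous_on_comp_snd: "continuous_on UNIV g \<Longrightarrow> continuous_on UNIV (\<lambda>z. g (snd z))"
  by (rule continuous_on_compose2[OF _ continuous_on_snd[OF continuous_on_id]]) auto

lemma has_derivative_imp_continuous_on:
  "(\<And>x. (g has_derivative g' x) (at x)) \<Longrightarrow> continuous_on UNIV g"
  by (meson continuous_at_imp_continuous_on has_derivative_continuous)

lemma has_vector_derivative_fst_snd: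
  assumes "(g has_vector_derivative g') net"
  shows "((\<lambda>x. fst (g x)) has_vector_derivative fst g') net"
    and "((\<lambda>x. snd (g x)) has_vector_derivative snd g') net"
  using bounded_linear.has_vector_derivative[OF bounded_linear_fst assms]
    bounded_linear.has_vector_derivative[OF bounded_linear_snd assms] by auto

lemma rescale_time:
  assumes "\<And>t. (g has_vector_derivative g' t) (at t)"
  shows "((\<lambda>\<tau>. g (\<tau> * t)) has_vector_derivative t *\<^sub>R g' (\<tau> * t)) (at \<tau> within X)"
proof -
  have "((\<lambda>\<tau>. \<tau> * t) has_vector_derivative t) (at \<tau>)"
    by (auto intro!: derivative_eq_intros simp flip: has_real_derivative_iff_has_vector_derivative)
  from vector_diff_chain_at[OF this assms] show ?thesis
    by (simp add: o_def has_vector_derivative_at_within)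
qed

lemma inner_has_vector_derivative:
  "(f has_vector_derivative f') (at x within s) \<Longrightarrow> (g has_vector_derivative g') (at x within s) \<Longrightarrow>
    ((\<lambda>x. f x \<bullet> g x) has_vector_derivative f x \<bullet> g' + f' \<bullet> g x) (at x within s)"
  by (rule bounded_bilinear.has_vector_derivative[OF bounded_bilinear_inner])

text \<open>The square of the norm is used because it is differentiable even at zeros of
  \<open>D\<close>. Since \<open>2 * norm D * \<eta> \<le> (norm D)^2 + \<eta>^2\<close>, the sum
  \<open>(norm D)^2 + \<eta>^2\<close> grows at rate at most \<open>2 * L + 1\<close>, so its
  product with \<open>exp (- (2 * L + 1) * s)\<close> does not increase.\<close>

lemma gronwall_norm:
  fixes D :: "real \<Rightarrow> 'b::real_inner"
  assumes D: "\<And>s. s \<in> {0..T} \<Longrightarrow> (D has_vector_derivative D' s) (at s within {0..T})"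
    and le: "\<And>s. s \<in> {0..T} \<Longrightarrow> norm (D' s) \<le> L * norm (D s) + \<eta>"
    and "0 \<le> L" and t: "t \<in> {0..T}"
  shows "(norm (D t))\<^sup>2 + \<eta>\<^sup>2 \<le> ((norm (D 0))\<^sup>2 + \<eta>\<^sup>2) * exp ((2 * L + 1) * t)"
proof -
  define g where "g s = ((D s \<bullet> D s) + \<eta>\<^sup>2) * exp (- (2 * L + 1) * s)" for s
  define g' where "g' s = (2 * (D s \<bullet> D' s) - (2 * L + 1) * ((D s \<bullet> D s) + \<eta>\<^sup>2)) * exp (- (2 * L + 1) * s)" for s
  have g: "(g has_derivative (\<lambda>h. h * g' s)) (at s within {0..t})" if "s \<in> {0..t}" for s
  proof -
    have "(D has_derivative (\<lambda>h. h *\<^sub>R D' s)) (at s within {0..T})"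
      using D[of s] that t by (auto simp: has_vector_derivative_def)
    then have "(D has_derivative (\<lambda>h. h *\<^sub>R D' s)) (at s within {0..t})"
      by (rule has_derivative_subset) (use t in auto)
    then show ?thesis
      unfolding g_def[abs_def] g'_def
      by (auto intro!: derivative_eq_intros simp: fun_eq_iff algebra_simps inner_commute)
  qed
  have g'_le: "g' s \<le> 0" if "s \<in> {0..t}" for s
  proof -
    have "D s \<bullet> D' s \<le> norm (D s) * norm (D' s)"
      by (rule norm_cauchy_schwarz)
    also have "\<dots> \<le> norm (D s) * (L * norm (D s) + \<eta>)"
      using le[of s] that t by (intro mult_left_mono) auto
    finally have "2 * (D s \<bullet> D' s) \<le> 2 * L * (norm (D s))\<^sup>2 + 2 * (norm (D s) * \<eta>)"
      by (simp add: algebra_simps power2_eq_square)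
    moreover have "2 * (norm (D s) * \<eta>) \<le> (norm (D s))\<^sup>2 + \<eta>\<^sup>2"
      using sum_squares_bound[of "norm (D s)" \<eta>] by simp
    moreover have "0 \<le> L * \<eta>\<^sup>2"
      using \<open>0 \<le> L\<close> by simp
    ultimately have "2 * (D s \<bullet> D' s) - (2 * L + 1) * ((norm (D s))\<^sup>2 + \<eta>\<^sup>2) \<le> 0"
      by (simp add: algebra_simps)
    then show ?thesis
      by (simp add: g'_def power2_norm_eq_inner mult_nonpos_nonneg)
  qed
  obtain s where "s \<in> {0..t}" "g t - g 0 = (t - 0) * g' s"
    using mvt_very_simple[of 0 t g "\<lambda>s h. h * g' s"] g t by auto
  then have "g t \<le> g 0"
    using g'_le[of s] mult_nonneg_nonpos[of t "g' s"] by auto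
  then have "((norm (D t))\<^sup>2 + \<eta>\<^sup>2) * exp (- (2 * L + 1) * t) * exp ((2 * L + 1) * t)
      \<le> ((norm (D 0))\<^sup>2 + \<eta>\<^sup>2) * exp ((2 * L + 1) * t)"
    by (intro mult_right_mono) (auto simp: g_def power2_norm_eq_inner)
  then show ?thesis
    by (simp add: mult.assoc algebra_simps flip: exp_add)
qed

section \<open>Bounds and moduli of continuity of derivatives on balls\<close>

text \<open>In finite dimension, continuity for each fixed \<open>h\<close> is already continuity in
  the operator norm; compactness of balls then gives bounds and moduli that are uniform in
  \<open>h\<close>.\<close>

lemma continuous_derivative_blinfun:
  fixes f :: "'b::euclidean_space \<Rightarrow> 'c::real_normed_vector"
  assumes "\<And>x. (f has_derivative f' x) (at x)" and "\<And>h. continuous_on UNIV (\<lambda>x. f' x h)"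
  obtains F where "\<And>x. f' x = blinfun_apply (F x)" and "continuous_on UNIV F"
proof
  show *: "f' x = blinfun_apply (Blinfun (f' x))" for x
    using assms(1)[of x] by (simp add: bounded_linear_Blinfun_apply has_derivative_bounded_linear)
  show "continuous_on UNIV (\<lambda>x. Blinfun (f' x))"
    using assms(2) by (intro continuous_on_blinfun_componentwise) (simp flip: *)
qed

lemma derivative_bounded_cball:
  fixes f :: "'b::euclidean_space \<Rightarrow> 'c::real_normed_vector"
  assumes "\<And>x. (f has_derivative f' x) (at x)" and "\<And>h. continuous_on UNIV (\<lambda>x. f' x h)"
  obtains L where "L > 0" and "\<And>x h. norm x \<le> R \<Longrightarrow> norm (f' x h) \<le> L * norm h"
proof -
  obtain F where F: "\<And>x. f' x = blinfun_apply (F x)" and cont: "continuous_on UNIV F"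
    using continuous_derivative_blinfun[of f f'] assms by blast
  have "bounded (F ` cball 0 R)"
    using cont by (intro compact_imp_bounded compact_continuous_image)
      (auto intro: continuous_on_subset)
  then obtain L where "L > 0" "\<And>x. norm x \<le> R \<Longrightarrow> norm (F x) \<le> L"
    by (auto simp: bounded_pos)
  then show ?thesis
    by (intro that[of L]) (auto simp: F intro!: order_trans[OF norm_blinfun] mult_right_mono)
qed

lemma derivative_modulus_cball:
  fixes f :: "'b::euclidean_space \<Rightarrow> 'c::real_normed_vector"
  assumes "\<And>x. (f has_derivative f' x) (at x)" and "\<And>h. continuous_on UNIV (\<lambda>x. f' x h)"
    and "e > 0"
  obtains d where "d > 0"
    and "\<And>x y h. norm x \<le> R \<Longrightarrow> norm y \<le> R \<Longrightarrow> norm (y - x) < d \<Longrightarrow> norm (f' y h - f' x h) \<le> e * norm h"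
proof -
  obtain F where F: "\<And>x. f' x = blinfun_apply (F x)" and cont: "continuous_on UNIV F"
    using continuous_derivative_blinfun[of f f'] assms by blast
  have "uniformly_continuous_on (cball 0 R) F"
    using cont by (intro compact_uniformly_continuous) (auto intro: continuous_on_subset)
  then obtain d where "d > 0"
    and d: "\<And>x y :: 'b. norm x \<le> R \<Longrightarrow> norm y \<le> R \<Longrightarrow> norm (y - x) < d \<Longrightarrow> norm (F y - F x) < e"
    using \<open>e > 0\<close> unfolding uniformly_continuous_on_def by (auto simp: dist_norm)
  show ?thesis
  proof (rule that[OF \<open>d > 0\<close>])
    fix x y h :: 'b assume "norm x \<le> R" "norm y \<le> R" "norm (y - x) < d"
    then have "norm (F y - F x) \<le> e"
      using d by (force intro: less_imp_le)
    then have "norm (blinfun_apply (F y - F x) h) \<le> e * norm h"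
      by (intro order_trans[OF norm_blinfun] mult_right_mono) auto
    then show "norm (f' y h - f' x h) \<le> e * norm h"
      by (simp add: F blinfun.diff_left)
  qed
qed

lemma lipschitz_cball:
  fixes f :: "'b::euclidean_space \<Rightarrow> 'c::real_normed_vector"
  assumes "\<And>x. (f has_derivative f' x) (at x)"
    and "\<And>x h. norm x \<le> R \<Longrightarrow> norm (f' x h) \<le> L * norm h"
    and "norm x \<le> R" "norm y \<le> R"
  shows "norm (f y - f x) \<le> L * norm (y - x)"
proof (rule differentiable_bound[of "cball 0 R" f f'])
  show "onorm (f' z) \<le> L" if "z \<in> cball 0 R" for z
    using assms(2) that by (intro onorm_le) simp
qed (use assms in \<open>simp_all add: has_derivative_at_withinI\<close>)

text \<open>The modulus is available only at points of the large ball closer than \<open>d\<close>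
  to \<open>x\<close>. The intersection of the two balls is convex and therefore contains the whole
  segment from \<open>x\<close> to \<open>y\<close>.\<close>

lemma linearization_cball:
  fixes f :: "'b::euclidean_space \<Rightarrow> 'c::real_normed_vector"
  assumes f: "\<And>x. (f has_derivative f' x) (at x)"
    and modulus: "\<And>x y h. norm x \<le> R \<Longrightarrow> norm y \<le> R \<Longrightarrow> norm (y - x) < d \<Longrightarrow> norm (f' y h - f' x h) \<le> e * norm h"
    and x: "norm x \<le> R" and y: "norm y \<le> R" and d: "norm (y - x) < d"
  shows "norm (f y - f x - f' x (y - x)) \<le> e * norm (y - x)"
proof -
  have "d > 0"
    using d norm_ge_zero le_less_trans by blast
  have "norm (f y - f x - f' x (y - x)) \<le> norm (y - x) * e"
  proof (rule differentiable_bound_linearization[of x y "cball 0 R \<inter> ball x d"])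
    show "x + t *\<^sub>R (y - x) \<in> cball 0 R \<inter> ball x d" if "t \<in> {0..1}" for t
    proof -
      have "convex (cball 0 R \<inter> ball x d)"
        by (intro convex_Int convex_cball convex_ball)
      moreover have "x \<in> cball 0 R \<inter> ball x d" "y \<in> cball 0 R \<inter> ball x d"
        using x y d \<open>d > 0\<close> by (auto simp: dist_norm norm_minus_commute)
      moreover have "x + t *\<^sub>R (y - x) = (1 - t) *\<^sub>R x + t *\<^sub>R y"
        by (simp add: algebra_simps)
      ultimately show ?thesis
        using that by (metis convexD_alt atLeastAtMost_iff)
    qed
    show "(f has_derivative f' z) (at z within cball 0 R \<inter> ball x d)" for z
      using f by (rule has_derivative_at_withinI)
    show "onorm (f' z - f' x) \<le> e" if "z \<in> cball 0 R \<inter> ball x d" for z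
    proof (rule onorm_le)
      show "norm ((f' z - f' x) h) \<le> e * norm h" for h
        using modulus[of x z h] x that by (simp add: dist_norm norm_minus_commute)
    qed
    show "x \<in> cball 0 R \<inter> ball x d"
      using x \<open>d > 0\<close> by simp
  qed
  then show ?thesis
    by (simp add: mult.commute)
qed

section \<open>Stability and differentiation of solutions of autonomous equations\<close>

text \<open>A fixed compact time interval makes all estimates uniform in time; other times, negative
  ones included, are reached by scaling the right-hand side.\<close>

definition solves :: "('b::real_normed_vector \<Rightarrow> 'b) \<Rightarrow> (real \<Rightarrow> 'b) \<Rightarrow> bool" where
  "solves f x \<longleftrightarrow> (\<forall>t\<in>{0..1}. (x has_vector_derivative f (x t)) (at t within {0..1}))"

lemma solves_continuous_on: "solves f x \<Longrightarrow> continuous_on {0..1} x"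
  unfolding solves_def continuous_on_eq_continuous_within
  using has_vector_derivative_continuous by blast

text \<open>Only local Lipschitz constants exist, so the estimate bootstraps: while \<open>y\<close>
  stays within distance 1 of \<open>x\<close>, it lies in the ball of radius \<open>B + 1\<close>,
  where Gronwall's inequality applies; and for \<open>K * norm (y 0 - x 0) < 1\<close> the resulting
  estimate keeps \<open>y\<close> from ever reaching distance 1.\<close>

lemma solution_stability:
  fixes f :: "'b::euclidean_space \<Rightarrow> 'b"
  assumes f: "\<And>x. (f has_derivative f' x) (at x)" "\<And>h. continuous_on UNIV (\<lambda>x. f' x h)"
    and x: "solves f x"
  obtains R K where "K > 0"
    and "\<And>t y. solves f y \<Longrightarrow> K * norm (y 0 - x 0) < 1 \<Longrightarrow> t \<in> {0..1} \<Longrightarrow>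
      norm (y t) \<le> R \<and> norm (y t - x t) \<le> K * norm (y 0 - x 0)"
proof -
  have "bounded (x ` {0..1})"
    using solves_continuous_on[OF x] by (intro compact_imp_bounded compact_continuous_image) auto
  then have "\<exists>B. \<forall>t\<in>{0..1}. norm (x t) \<le> B"
    by (simp add: bounded_iff)
  then obtain B where B: "\<And>t. t \<in> {0..1} \<Longrightarrow> norm (x t) \<le> B"
    by blast
  obtain L where "L > 0" and L: "\<And>z h. norm z \<le> B + 1 \<Longrightarrow> norm (f' z h) \<le> L * norm h"
    using derivative_bounded_cball[of f f' "B + 1"] f by blast
  define K where "K = exp (2 * L + 1)"
  have "K \<ge> 1"
    using \<open>L > 0\<close> by (simp add: K_def)
  have grow: "norm (y t - x t) \<le> K * norm (y 0 - x 0)"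
    if y: "solves f y" and t: "t \<in> {0..1}" and near: "\<And>s. s \<in> {0..<t} \<Longrightarrow> norm (y s - x s) \<le> 1" for y t
  proof (cases "t = 0")
    case False
    have cont: "continuous_on {0..t} (\<lambda>s. norm (y s - x s))"
      using t by (intro continuous_intros continuous_on_subset[OF solves_continuous_on[OF x]]
          continuous_on_subset[OF solves_continuous_on[OF y]]) auto
    \<comment> \<open>The hypothesis covers only times before \<open>t\<close>; continuity extends
      it to \<open>t\<close> itself.\<close>
    have near': "norm (y s - x s) \<le> 1" if "s \<in> {0..t}" for s
    proof (rule continuous_le_on_closure[of "{0..<t}" "\<lambda>s. norm (y s - x s)"])
      show "continuous_on (closure {0..<t}) (\<lambda>s. norm (y s - x s))"
        using cont t False by simp
    qed (use that t near False in auto)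
    have "(norm (y t - x t))\<^sup>2 + 0\<^sup>2 \<le> ((norm (y 0 - x 0))\<^sup>2 + 0\<^sup>2) * exp ((2 * L + 1) * t)"
    proof (rule gronwall_norm[where T = t and D = "\<lambda>s. y s - x s" and D' = "\<lambda>s. f (y s) - f (x s)"])
      fix s assume s: "s \<in> {0..t}"
      show "((\<lambda>s. y s - x s) has_vector_derivative f (y s) - f (x s)) (at s within {0..t})"
      proof (intro has_vector_derivative_diff)
        show "(x has_vector_derivative f (x s)) (at s within {0..t})"
          by (rule has_vector_derivative_within_subset[of _ _ _ "{0..1}"])
            (use x s t in \<open>auto simp: solves_def\<close>)
        show "(y has_vector_derivative f (y s)) (at s within {0..t})"
          by (rule has_vector_derivative_within_subset[of _ _ _ "{0..1}"])
            (use y s t in \<open>auto simp: solves_def\<close>)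
      qed
      have "norm (x s) \<le> B + 1"
        using B[of s] s t by auto
      moreover have "norm (y s) \<le> B + 1"
        using B[of s] near'[of s] s t norm_triangle_ineq[of "x s" "y s - x s"] by auto
      ultimately show "norm (f (y s) - f (x s)) \<le> L * norm (y s - x s) + 0"
        using lipschitz_cball[of f f' "B + 1" L "x s" "y s"] f(1) L by auto
    qed (use t \<open>L > 0\<close> in auto)
    also have "\<dots> \<le> (norm (y 0 - x 0))\<^sup>2 * K"
      using t \<open>L > 0\<close> by (auto simp: K_def intro!: mult_left_mono mult_left_le)
    \<comment> \<open>\<open>K \<le> K^2\<close> makes the bound a perfect square.\<close>
    also have "\<dots> \<le> (norm (y 0 - x 0))\<^sup>2 * K\<^sup>2"
      using \<open>K \<ge> 1\<close> by (intro mult_left_mono) (auto simp: power2_eq_square)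
    finally have "(norm (y t - x t))\<^sup>2 \<le> (K * norm (y 0 - x 0))\<^sup>2"
      by (simp add: power_mult_distrib mult.commute)
    then show ?thesis
      by (rule power2_le_imp_le) (use \<open>K \<ge> 1\<close> in auto)
  qed (use \<open>K \<ge> 1\<close> mult_right_mono[of 1 K "norm (y 0 - x 0)"] in auto)
  have near: "norm (y t - x t) < 1" if y: "solves f y" and small: "K * norm (y 0 - x 0) < 1" and t: "t \<in> {0..1}" for y t
  proof (rule ccontr)
    assume far: "\<not> norm (y t - x t) < 1"
    \<comment> \<open>The minimum of this closed set of bad times is the first exit time, at which
      \<open>grow\<close> contradicts \<open>small\<close>.\<close>
    define A where "A = {0..1} \<inter> (\<lambda>s. norm (y s - x s)) -` {1..}"
    have "closed A"
      unfolding A_def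
      by (intro continuous_closed_preimage continuous_on_norm continuous_on_diff
          solves_continuous_on[OF x] solves_continuous_on[OF y]) auto
    moreover have "bounded A"
      by (rule bounded_subset[of "{0..1}"]) (auto simp: A_def)
    ultimately have "compact A"
      by (simp add: compact_eq_bounded_closed)
    moreover have "A \<noteq> {}"
      using far t by (auto simp: A_def)
    ultimately obtain s where s: "s \<in> A" and min: "\<And>r. r \<in> A \<Longrightarrow> s \<le> r"
      using compact_attains_inf by metis
    have "norm (y s - x s) \<le> K * norm (y 0 - x 0)"
    proof (rule grow[OF y])
      show "s \<in> {0..1}"
        using s by (simp add: A_def)
      show "norm (y r - x r) \<le> 1" if "r \<in> {0..<s}" for r
        using min[of r] s that by (cases "norm (y r - x r) \<le> 1") (auto simp: A_def)
    qed
    then show False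
      using s small by (auto simp: A_def)
  qed
  have "norm (y t) \<le> B + 1 \<and> norm (y t - x t) \<le> K * norm (y 0 - x 0)"
    if y: "solves f y" and small: "K * norm (y 0 - x 0) < 1" and t: "t \<in> {0..1}" for t y
  proof
    show "norm (y t) \<le> B + 1"
      using B[OF t] near[OF y small t] norm_triangle_ineq[of "x t" "y t - x t"] by simp
    show "norm (y t - x t) \<le> K * norm (y 0 - x 0)"
    proof (rule grow[OF y t])
      show "norm (y s - x s) \<le> 1" if "s \<in> {0..<t}" for s
        using near[OF y small, of s] that t by simp
    qed
  qed
  then show ?thesis
    using that[of K "B + 1"] \<open>K \<ge> 1\<close> by auto
qed

text \<open>Passes the equation of the difference quotients to their limit. The limit supplied by
  termwise differentiation equals the prescribed \<open>Y\<close> by uniqueness of limits.\<close>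

lemma has_vector_derivative_sequence:
  fixes D :: "nat \<Rightarrow> real \<Rightarrow> 'b::banach"
  assumes D: "\<And>n s. s \<in> {0..1} \<Longrightarrow> (D n has_vector_derivative D' n s) (at s within {0..1})"
    and lim: "uniform_limit {0..1} D' Y' sequentially"
    and "\<And>s. s \<in> {0..1} \<Longrightarrow> (\<lambda>n. D n s) \<longlonglongrightarrow> Y s"
    and s: "s \<in> {0..1::real}"
  shows "(Y has_vector_derivative Y' s) (at s within {0..1})"
proof -
  have "\<exists>g. \<forall>x\<in>{0..1}. (\<lambda>n. D n x) \<longlonglongrightarrow> g x \<and> (g has_derivative (\<lambda>h. h *\<^sub>R Y' x)) (at x within {0..1})"
  proof (rule has_derivative_sequence[where f' = "\<lambda>n x h. h *\<^sub>R D' n x"])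
    show "(D n has_derivative (\<lambda>h. h *\<^sub>R D' n x)) (at x within {0..1})" if "x \<in> {0..1}" for n x
      using D[OF that] by (simp add: has_vector_derivative_def)
    show "\<forall>\<^sub>F n in sequentially. \<forall>x\<in>{0..1}. \<forall>h. norm (h *\<^sub>R D' n x - h *\<^sub>R Y' x) \<le> e * norm h"
      if "e > 0" for e
      using uniform_limitD[OF lim that]
      by eventually_elim (auto simp: dist_norm mult.commute[of e] simp flip: scaleR_right_diff_distrib
          intro!: mult_left_mono intro: less_imp_le)
    show "(\<lambda>n. D n 0) \<longlonglongrightarrow> Y 0" "(0::real) \<in> {0..1}" "convex {0..1::real}"
      using assms(3) by auto
  qed
  then obtain g where g: "\<And>x. x \<in> {0..1} \<Longrightarrow> (\<lambda>n. D n x) \<longlonglongrightarrow> g x"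
    "\<And>x. x \<in> {0..1} \<Longrightarrow> (g has_vector_derivative Y' x) (at x within {0..1})"
    unfolding has_vector_derivative_def by blast
  have "g x = Y x" if "x \<in> {0..1}" for x
    using LIMSEQ_unique g(1) assms(3) that by blast
  then show ?thesis
    using has_vector_derivative_transform[OF s _ g(2)[OF s]] by simp
qed

lemma has_vector_derivative_at_0:
  "(g has_vector_derivative d) (at 0) \<longleftrightarrow> ((\<lambda>s. (1 / s) *\<^sub>R (g s - g 0)) \<longlongrightarrow> d) (at 0)"
proof -
  have "norm (g s - g 0 - s *\<^sub>R d) / \<bar>s\<bar> = norm ((1 / s) *\<^sub>R (g s - g 0) - d)" if "s \<noteq> 0" for s
  proof -
    have "g s - g 0 - s *\<^sub>R d = s *\<^sub>R ((1 / s) *\<^sub>R (g s - g 0) - d)"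
      using that by (simp add: scaleR_right_diff_distrib)
    then show ?thesis
      using that by simp
  qed
  then have "((\<lambda>s. norm (g s - g 0 - s *\<^sub>R d) / \<bar>s\<bar>) \<longlongrightarrow> 0) (at 0) \<longleftrightarrow>
      ((\<lambda>s. norm ((1 / s) *\<^sub>R (g s - g 0) - d)) \<longlongrightarrow> 0) (at 0)"
    by (intro filterlim_cong refl) (auto simp: eventually_at_filter)
  also have "\<dots> \<longleftrightarrow> ((\<lambda>s. (1 / s) *\<^sub>R (g s - g 0)) \<longlongrightarrow> d) (at 0)"
    by (simp add: tendsto_norm_zero_iff flip: LIM_zero_iff[of _ d])
  finally show ?thesis
    by (simp add: has_vector_derivative_def has_derivative_at bounded_linear_scaleR_left)
qed

text \<open>No existence theorem for the linearized equation is needed: by Gronwall's inequality the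
  difference quotients form a Cauchy family uniformly in time, and their limit solves it.\<close>

lemma solution_difference_quotients:
  fixes f :: "'b::euclidean_space \<Rightarrow> 'b" and x :: "real \<Rightarrow> real \<Rightarrow> 'b"
  assumes f: "\<And>z. (f has_derivative f' z) (at z)" "\<And>h. continuous_on UNIV (\<lambda>z. f' z h)"
    and x: "\<And>\<sigma>. solves f (x \<sigma>)" and init: "\<And>\<sigma>. x \<sigma> 0 = x 0 0 + \<sigma> *\<^sub>R y0"
  obtains Y where "Y 0 = y0"
    and "\<And>t. t \<in> {0..1} \<Longrightarrow> ((\<lambda>\<sigma>. x \<sigma> t) has_vector_derivative Y t) (at 0)"
    and "\<And>t. t \<in> {0..1} \<Longrightarrow> (Y has_vector_derivative f' (x 0 t) (Y t)) (at t within {0..1})"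
proof -
  obtain R K where "K > 0" and stab: "\<And>t y. solves f y \<Longrightarrow> K * norm (y 0 - x 0 0) < 1 \<Longrightarrow> t \<in> {0..1} \<Longrightarrow>
      norm (y t) \<le> R \<and> norm (y t - x 0 t) \<le> K * norm (y 0 - x 0 0)"
    using solution_stability[of f f' "x 0"] f x by metis
  obtain L where "L > 0" and L: "\<And>z h. norm z \<le> R \<Longrightarrow> norm (f' z h) \<le> L * norm h"
    using derivative_bounded_cball[of f f' R] f by blast
  \<comment> \<open>The summand 1 keeps \<open>N\<close> positive when \<open>y0 = 0\<close>, since
    \<open>N\<close> is divided by.\<close>
  define N where "N = norm y0 + 1"
  have "N > 0"
    by (simp add: N_def add_nonneg_pos)
  define d0 where "d0 = 1 / (K * N)"
  have "d0 > 0"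
    using \<open>K > 0\<close> \<open>N > 0\<close> by (simp add: d0_def)
  have near: "norm (x \<sigma> t) \<le> R \<and> norm (x \<sigma> t - x 0 t) \<le> K * N * \<bar>\<sigma>\<bar>"
    if "\<bar>\<sigma>\<bar> < d0" "t \<in> {0..1}" for \<sigma> t
  proof -
    have "norm (x \<sigma> 0 - x 0 0) \<le> \<bar>\<sigma>\<bar> * N"
      by (subst init) (simp add: N_def mult_left_mono)
    then have *: "K * norm (x \<sigma> 0 - x 0 0) \<le> K * N * \<bar>\<sigma>\<bar>"
      using \<open>K > 0\<close> by (simp add: mult.commute mult.left_commute)
    also have "\<dots> < 1"
      using that \<open>K > 0\<close> \<open>N > 0\<close> by (simp add: d0_def field_simps)
    finally have "K * norm (x \<sigma> 0 - x 0 0) < 1" .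
    then show ?thesis
      using stab[of "x \<sigma>" t] x that * by fastforce
  qed
  have bounded_x: "norm (x 0 t) \<le> R" if "t \<in> {0..1}" for t
    using near[of 0 t] that \<open>d0 > 0\<close> by simp
  define D where "D \<sigma> t = (1 / \<sigma>) *\<^sub>R (x \<sigma> t - x 0 t)" for \<sigma> t
  define D' where "D' \<sigma> t = (1 / \<sigma>) *\<^sub>R (f (x \<sigma> t) - f (x 0 t))" for \<sigma> t
  have D: "(D \<sigma> has_vector_derivative D' \<sigma> t) (at t within {0..1})" if "t \<in> {0..1}" for \<sigma> t
    unfolding D_def D'_def using x that
    by (auto simp: solves_def intro!: derivative_eq_intros)
  have D0: "D \<sigma> 0 = y0" if "\<sigma> \<noteq> 0" for \<sigma>
    using that init[of \<sigma>] by (simp add: D_def)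
  have norm_D: "norm (D \<sigma> t) = norm (x \<sigma> t - x 0 t) / \<bar>\<sigma>\<bar>" for \<sigma> t
    by (simp add: D_def)
  \<comment> \<open>At \<open>\<sigma> = 0\<close> this holds because division by zero gives
    \<open>D 0 t = 0\<close>.\<close>
  have D_bound: "norm (D \<sigma> t) \<le> K * N" if "\<bar>\<sigma>\<bar> < d0" "t \<in> {0..1}" for \<sigma> t
    using near[OF that] \<open>K > 0\<close> \<open>N > 0\<close>
    by (cases "\<sigma> = 0") (auto simp: norm_D divide_simps)
  \<comment> \<open>The quotients solve the linearized equation up to an error that is small
    uniformly in time.\<close>
  have lin: "\<exists>\<delta>>0. \<forall>\<sigma> t. \<sigma> \<noteq> 0 \<longrightarrow> \<bar>\<sigma>\<bar> < \<delta> \<longrightarrow> t \<in> {0..1} \<longrightarrow> norm (D' \<sigma> t - f' (x 0 t) (D \<sigma> t)) \<le> e"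
    if "e > 0" for e
  proof -
    define e' where "e' = e / (K * N)"
    have "e' > 0"
      using that \<open>K > 0\<close> \<open>N > 0\<close> by (simp add: e'_def)
    obtain d where "d > 0" and d: "\<And>x y h. norm x \<le> R \<Longrightarrow> norm y \<le> R \<Longrightarrow> norm (y - x) < d \<Longrightarrow>
        norm (f' y h - f' x h) \<le> e' * norm h"
      using derivative_modulus_cball[of f f' e' R] f \<open>e' > 0\<close> by blast
    define \<delta> where "\<delta> = min d0 (d / (K * N))"
    show ?thesis
    proof (intro exI[of _ \<delta>] conjI allI impI)
      show "\<delta> > 0"
        using \<open>d > 0\<close> \<open>d0 > 0\<close> \<open>K > 0\<close> \<open>N > 0\<close> by (simp add: \<delta>_def)
      fix \<sigma> t :: real assume *: "\<sigma> \<noteq> 0" "\<bar>\<sigma>\<bar> < \<delta>" "t \<in> {0..1}"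
      then have "\<bar>\<sigma>\<bar> < d0" "K * N * \<bar>\<sigma>\<bar> < d"
        using \<open>K > 0\<close> \<open>N > 0\<close> by (auto simp: \<delta>_def field_simps)
      then have "norm (f (x \<sigma> t) - f (x 0 t) - f' (x 0 t) (x \<sigma> t - x 0 t)) \<le> e' * norm (x \<sigma> t - x 0 t)"
        using near[of \<sigma> t] bounded_x[of t] * by (intro linearization_cball[of f f' R d, OF f(1) d]) auto
      then have "\<bar>1 / \<sigma>\<bar> * norm (f (x \<sigma> t) - f (x 0 t) - f' (x 0 t) (x \<sigma> t - x 0 t)) \<le> e' * norm (D \<sigma> t)"
        using * by (simp add: norm_D divide_right_mono)
      also have "f (x \<sigma> t) - f (x 0 t) - f' (x 0 t) (x \<sigma> t - x 0 t) = \<sigma> *\<^sub>R (D' \<sigma> t - f' (x 0 t) (D \<sigma> t))"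
      proof -
        have "linear (f' (x 0 t))"
          using f(1) has_derivative_linear by blast
        moreover have "x \<sigma> t - x 0 t = \<sigma> *\<^sub>R D \<sigma> t" "f (x \<sigma> t) - f (x 0 t) = \<sigma> *\<^sub>R D' \<sigma> t"
          using * by (simp_all add: D_def D'_def)
        ultimately show ?thesis
          by (simp add: linear_cmul scaleR_diff_right)
      qed
      also have "e' * norm (D \<sigma> t) \<le> e' * (K * N)"
        using D_bound[of \<sigma> t] \<open>\<bar>\<sigma>\<bar> < d0\<close> * \<open>e' > 0\<close> by (intro mult_left_mono) auto
      also have "\<dots> = e"
        using \<open>K > 0\<close> \<open>N > 0\<close> by (simp add: e'_def)
      finally show "norm (D' \<sigma> t - f' (x 0 t) (D \<sigma> t)) \<le> e"
        using * by simp
    qed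
  qed
  \<comment> \<open>Gronwall's inequality bounds squares, hence the root.\<close>
  define G where "G = sqrt (exp (2 * L + 1))"
  have "G > 0"
    by (simp add: G_def)
  \<comment> \<open>All quotients start from \<open>y0\<close>, so the distance of two of them is
    caused by their two linearization errors alone; each is at most
    \<open>\<eta> = e / (2 * G)\<close>.\<close>
  have cauchy: "\<exists>\<delta>>0. \<forall>\<sigma> \<tau> t. \<sigma> \<noteq> 0 \<longrightarrow> \<tau> \<noteq> 0 \<longrightarrow> \<bar>\<sigma>\<bar> < \<delta> \<longrightarrow> \<bar>\<tau>\<bar> < \<delta> \<longrightarrow> t \<in> {0..1} \<longrightarrow> norm (D \<sigma> t - D \<tau> t) \<le> e"
    if "e > 0" for e
  proof -
    define \<eta> where "\<eta> = e / (2 * G)"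
    have "\<eta> > 0"
      using that \<open>G > 0\<close> by (simp add: \<eta>_def)
    obtain \<delta> where "\<delta> > 0" and \<delta>: "\<And>\<sigma> t. \<sigma> \<noteq> 0 \<Longrightarrow> \<bar>\<sigma>\<bar> < \<delta> \<Longrightarrow> t \<in> {0..1} \<Longrightarrow> norm (D' \<sigma> t - f' (x 0 t) (D \<sigma> t)) \<le> \<eta>"
      using lin[OF \<open>\<eta> > 0\<close>] by blast
    show ?thesis
    proof (intro exI[of _ \<delta>] conjI allI impI)
      fix \<sigma> \<tau> t :: real
      assume *: "\<sigma> \<noteq> 0" "\<tau> \<noteq> 0" "\<bar>\<sigma>\<bar> < \<delta>" "\<bar>\<tau>\<bar> < \<delta>" "t \<in> {0..1}"
      have "(norm (D \<sigma> t - D \<tau> t))\<^sup>2 + (2 * \<eta>)\<^sup>2 \<le> ((norm (D \<sigma> 0 - D \<tau> 0))\<^sup>2 + (2 * \<eta>)\<^sup>2) * exp ((2 * L + 1) * t)"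
      proof (rule gronwall_norm[where T = 1 and D = "\<lambda>s. D \<sigma> s - D \<tau> s" and D' = "\<lambda>s. D' \<sigma> s - D' \<tau> s"])
        fix s :: real assume s: "s \<in> {0..1}"
        show "((\<lambda>s. D \<sigma> s - D \<tau> s) has_vector_derivative D' \<sigma> s - D' \<tau> s) (at s within {0..1})"
          by (intro has_vector_derivative_diff D s)
        have "D' \<sigma> s - D' \<tau> s = f' (x 0 s) (D \<sigma> s - D \<tau> s)
            + (D' \<sigma> s - f' (x 0 s) (D \<sigma> s)) - (D' \<tau> s - f' (x 0 s) (D \<tau> s))"
          using linear_diff[OF has_derivative_linear[OF f(1)[of "x 0 s"]]] by (simp add: algebra_simps)
        also have "norm \<dots> \<le> L * norm (D \<sigma> s - D \<tau> s) + \<eta> + \<eta>"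
          using L[OF bounded_x[OF s], of "D \<sigma> s - D \<tau> s"] \<delta>[of \<sigma> s] \<delta>[of \<tau> s] * s
            norm_triangle_ineq[of "f' (x 0 s) (D \<sigma> s - D \<tau> s)" "D' \<sigma> s - f' (x 0 s) (D \<sigma> s)"]
            norm_triangle_ineq4[of "f' (x 0 s) (D \<sigma> s - D \<tau> s) + (D' \<sigma> s - f' (x 0 s) (D \<sigma> s))"
              "D' \<tau> s - f' (x 0 s) (D \<tau> s)"]
          by linarith
        finally show "norm (D' \<sigma> s - D' \<tau> s) \<le> L * norm (D \<sigma> s - D \<tau> s) + 2 * \<eta>"
          by simp
      qed (use * \<open>L > 0\<close> in auto)
      also have "\<dots> \<le> (2 * \<eta>)\<^sup>2 * G\<^sup>2"
        using * \<open>L > 0\<close> by (auto simp: D0 G_def intro!: mult_left_mono mult_left_le)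
      also have "\<dots> = e\<^sup>2"
        using \<open>G > 0\<close> by (simp add: \<eta>_def field_simps)
      finally have "(norm (D \<sigma> t - D \<tau> t))\<^sup>2 \<le> e\<^sup>2"
        using zero_le_power2[of "2 * \<eta>"] by linarith
      then show "norm (D \<sigma> t - D \<tau> t) \<le> e"
        by (rule power2_le_imp_le) (use \<open>e > 0\<close> in simp)
    qed fact
  qed
  \<comment> \<open>A concrete sequence of nonzero parameters along which the limit \<open>Y\<close>
    is formed; \<open>unif\<close> later extends the convergence to all small
    \<open>\<sigma>\<close>.\<close>
  define r where "r n = 1 / real (Suc n)" for n
  have r: "\<forall>\<^sub>F n in sequentially. \<bar>r n\<bar> < \<delta>" if "\<delta> > 0" for \<delta>
    using order_tendstoD(2)[OF LIMSEQ_inverse_real_of_nat that]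
    by eventually_elim (simp add: r_def inverse_eq_divide)
  have [simp]: "r n \<noteq> 0" for n
    by (simp add: r_def)
  define Y where "Y t = lim (\<lambda>n. D (r n) t)" for t
  have Y: "(\<lambda>n. D (r n) t) \<longlonglongrightarrow> Y t" if "t \<in> {0..1}" for t
  proof -
    have "Cauchy (\<lambda>n. D (r n) t)"
    proof (rule metric_CauchyI)
      fix e :: real assume "e > 0"
      then obtain \<delta> where "\<delta> > 0" and \<delta>: "\<forall>\<sigma> \<tau> t. \<sigma> \<noteq> 0 \<longrightarrow> \<tau> \<noteq> 0 \<longrightarrow> \<bar>\<sigma>\<bar> < \<delta> \<longrightarrow> \<bar>\<tau>\<bar> < \<delta> \<longrightarrow> t \<in> {0..1} \<longrightarrow> norm (D \<sigma> t - D \<tau> t) \<le> e / 2"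
        using cauchy[OF half_gt_zero[OF \<open>e > 0\<close>]] by blast
      obtain M where "\<And>n. n \<ge> M \<Longrightarrow> \<bar>r n\<bar> < \<delta>"
        using r[OF \<open>\<delta> > 0\<close>] unfolding eventually_sequentially by blast
      then have "dist (D (r m) t) (D (r n) t) < e" if "m \<ge> M" "n \<ge> M" for m n
        using \<delta>[rule_format, of "r m" "r n" t] that \<open>t \<in> {0..1}\<close> \<open>e > 0\<close> by (simp add: dist_norm)
      then show "\<exists>M. \<forall>m\<ge>M. \<forall>n\<ge>M. dist (D (r m) t) (D (r n) t) < e"
        by blast
    qed
    then show ?thesis
      unfolding Y_def by (simp add: Cauchy_convergent_iff convergent_LIMSEQ_iff)
  qed
  have unif: "\<exists>\<delta>>0. \<forall>\<sigma> t. \<sigma> \<noteq> 0 \<longrightarrow> \<bar>\<sigma>\<bar> < \<delta> \<longrightarrow> t \<in> {0..1} \<longrightarrow> norm (D \<sigma> t - Y t) \<le> e"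
    if "e > 0" for e
  proof -
    obtain \<delta> where "\<delta> > 0" and \<delta>: "\<And>\<sigma> \<tau> t. \<sigma> \<noteq> 0 \<Longrightarrow> \<tau> \<noteq> 0 \<Longrightarrow> \<bar>\<sigma>\<bar> < \<delta> \<Longrightarrow> \<bar>\<tau>\<bar> < \<delta> \<Longrightarrow> t \<in> {0..1} \<Longrightarrow> norm (D \<sigma> t - D \<tau> t) \<le> e"
      using cauchy[OF \<open>e > 0\<close>] by blast
    have "norm (D \<sigma> t - Y t) \<le> e" if "\<sigma> \<noteq> 0" "\<bar>\<sigma>\<bar> < \<delta>" "t \<in> {0..1}" for \<sigma> t
    proof (rule tendsto_upperbound)
      show "(\<lambda>n. norm (D \<sigma> t - D (r n) t)) \<longlonglongrightarrow> norm (D \<sigma> t - Y t)"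
        by (intro tendsto_intros Y that)
      show "\<forall>\<^sub>F n in sequentially. norm (D \<sigma> t - D (r n) t) \<le> e"
        using r[OF \<open>\<delta> > 0\<close>] by eventually_elim (use \<delta> that in auto)
    qed simp
    then show ?thesis
      using \<open>\<delta> > 0\<close> by blast
  qed
  show ?thesis
  proof (rule that[of Y])
    show "Y 0 = y0"
      using Y[of 0] by (simp add: D0 LIMSEQ_const_iff)
    show "((\<lambda>\<sigma>. x \<sigma> t) has_vector_derivative Y t) (at 0)" if "t \<in> {0..1}" for t
    proof -
      have "((\<lambda>\<sigma>. D \<sigma> t) \<longlongrightarrow> Y t) (at 0)"
      proof (rule tendstoI)
        fix e :: real assume "e > 0"
        then obtain \<delta> where "\<delta> > 0"
          and \<delta>: "\<forall>\<sigma> t. \<sigma> \<noteq> 0 \<longrightarrow> \<bar>\<sigma>\<bar> < \<delta> \<longrightarrow> t \<in> {0..1} \<longrightarrow> norm (D \<sigma> t - Y t) \<le> e / 2"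
          using unif[OF half_gt_zero[OF \<open>e > 0\<close>]] by blast
        have "dist (D \<sigma> t) (Y t) < e" if "\<sigma> \<noteq> 0" "\<bar>\<sigma>\<bar> < \<delta>" for \<sigma>
          using \<delta>[rule_format, of \<sigma> t] that \<open>t \<in> {0..1}\<close> \<open>e > 0\<close> by (simp add: dist_norm)
        then show "\<forall>\<^sub>F \<sigma> in at 0. dist (D \<sigma> t) (Y t) < e"
          using \<open>\<delta> > 0\<close> unfolding eventually_at by (intro exI[of _ \<delta>]) (simp add: dist_norm)
      qed
      then show ?thesis
        by (simp add: D_def has_vector_derivative_at_0)
    qed
    show "(Y has_vector_derivative f' (x 0 t) (Y t)) (at t within {0..1})" if "t \<in> {0..1}" for t
    proof (rule has_vector_derivative_sequence[of "\<lambda>n. D (r n)" "\<lambda>n. D' (r n)"])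
      show "uniform_limit {0..1} (\<lambda>n. D' (r n)) (\<lambda>t. f' (x 0 t) (Y t)) sequentially"
      proof (rule uniform_limitI)
        fix e :: real assume "e > 0"
        obtain \<delta>1 where "\<delta>1 > 0" and \<delta>1: "\<And>\<sigma> t. \<sigma> \<noteq> 0 \<Longrightarrow> \<bar>\<sigma>\<bar> < \<delta>1 \<Longrightarrow> t \<in> {0..1} \<Longrightarrow> norm (D' \<sigma> t - f' (x 0 t) (D \<sigma> t)) \<le> e / 3"
          using lin[OF divide_pos_pos[OF \<open>e > 0\<close> zero_less_numeral]] by blast
        obtain \<delta>2 where "\<delta>2 > 0" and \<delta>2: "\<And>\<sigma> t. \<sigma> \<noteq> 0 \<Longrightarrow> \<bar>\<sigma>\<bar> < \<delta>2 \<Longrightarrow> t \<in> {0..1} \<Longrightarrow> norm (D \<sigma> t - Y t) \<le> e / (3 * L)"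
          using unif[OF divide_pos_pos[OF \<open>e > 0\<close> mult_pos_pos[OF zero_less_numeral \<open>L > 0\<close>]]] by blast
        show "\<forall>\<^sub>F n in sequentially. \<forall>t\<in>{0..1}. dist (D' (r n) t) (f' (x 0 t) (Y t)) < e"
          using r[OF \<open>\<delta>1 > 0\<close>] r[OF \<open>\<delta>2 > 0\<close>]
        proof eventually_elim
          case (elim n)
          show ?case
          proof
            fix t :: real assume t: "t \<in> {0..1}"
            have "norm (f' (x 0 t) (D (r n) t - Y t)) \<le> L * (e / (3 * L))"
              using \<delta>2[of "r n" t] elim t \<open>L > 0\<close>
              by (intro order_trans[OF L[OF bounded_x[OF t]]] mult_left_mono) auto
            then have "norm (f' (x 0 t) (D (r n) t) - f' (x 0 t) (Y t)) \<le> e / 3"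
              using linear_diff[OF has_derivative_linear[OF f(1)[of "x 0 t"]]] \<open>L > 0\<close> by simp
            moreover have "norm (D' (r n) t - f' (x 0 t) (D (r n) t)) \<le> e / 3"
              using \<delta>1 elim t by simp
            ultimately show "dist (D' (r n) t) (f' (x 0 t) (Y t)) < e"
              using \<open>e > 0\<close> norm_triangle_ineq[of "D' (r n) t - f' (x 0 t) (D (r n) t)" "f' (x 0 t) (D (r n) t) - f' (x 0 t) (Y t)"]
              by (simp add: dist_norm)
          qed
        qed
      qed
    qed (use D Y that in auto)
  qed
qed

lemma flow_continuous_on:
  fixes f :: "'b::euclidean_space \<Rightarrow> 'b" and X :: "real \<Rightarrow> 'a::real_normed_vector \<Rightarrow> 'b"
  assumes f: "\<And>z. (f has_derivative f' z) (at z)" "\<And>h. continuous_on UNIV (\<lambda>z. f' z h)"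
    and X: "\<And>a. solves f (\<lambda>t. X t a)" and cont: "continuous_on UNIV (X 0)"
    and t: "t \<in> {0..1}"
  shows "continuous_on UNIV (X t)"
proof -
  have "isCont (X t) a" for a
  proof -
    obtain R K where "K > 0" and stab: "\<And>t y. solves f y \<Longrightarrow> K * norm (y 0 - X 0 a) < 1 \<Longrightarrow> t \<in> {0..1} \<Longrightarrow>
        norm (y t) \<le> R \<and> norm (y t - X t a) \<le> K * norm (y 0 - X 0 a)"
      using solution_stability[of f f' "\<lambda>t. X t a"] f X by metis
    have lim: "((\<lambda>a'. K * norm (X 0 a' - X 0 a)) \<longlongrightarrow> 0) (at a)"
      using cont by (auto intro!: tendsto_eq_intros simp: continuous_on_eq_continuous_at isCont_def)
    have "\<forall>\<^sub>F a' in at a. norm (X t a' - X t a) \<le> K * norm (X 0 a' - X 0 a)"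
      using order_tendstoD(2)[OF lim zero_less_one]
      by eventually_elim (use stab[OF X _ t] in auto)
    then have "((\<lambda>a'. X t a' - X t a) \<longlongrightarrow> 0) (at a)"
      using lim by (rule Lim_null_comparison)
    then show ?thesis
      unfolding isCont_def by (rule LIM_zero_cancel)
  qed
  then show ?thesis
    by (simp add: continuous_at_imp_continuous_on)
qed

text \<open>A change of base point perturbs the coefficients of the linearized equation. In
  \<open>f' X' Y' - f' X Y = f' X' (Y' - Y) + (f' X' - f' X) Y\<close> the last term is a small
  forcing, because \<open>X'\<close> stays uniformly close to \<open>X\<close> by stability; the
  initial value \<open>y0\<close> is the same for all base points, so Gronwall's inequality leaves
  the forcing only.\<close>

lemma flow_linearization_continuous_on:
  fixes f :: "'b::euclidean_space \<Rightarrow> 'b" and X Y :: "real \<Rightarrow> 'a::real_normed_vector \<Rightarrow> 'b"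
  assumes f: "\<And>z. (f has_derivative f' z) (at z)" "\<And>h. continuous_on UNIV (\<lambda>z. f' z h)"
    and X: "\<And>a. solves f (\<lambda>t. X t a)" and cont: "continuous_on UNIV (X 0)"
    and Y: "\<And>t a. t \<in> {0..1} \<Longrightarrow>
      ((\<lambda>t. Y t a) has_vector_derivative f' (X t a) (Y t a)) (at t within {0..1})"
    and Y0: "\<And>a. Y 0 a = y0" and t: "t \<in> {0..1}"
  shows "continuous_on UNIV (Y t)"
proof -
  have "isCont (Y t) a" for a
  proof -
    obtain R K where "K > 0" and stab: "\<And>t y. solves f y \<Longrightarrow> K * norm (y 0 - X 0 a) < 1 \<Longrightarrow> t \<in> {0..1} \<Longrightarrow>
        norm (y t) \<le> R \<and> norm (y t - X t a) \<le> K * norm (y 0 - X 0 a)"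
      using solution_stability[of f f' "\<lambda>t. X t a"] f X by metis
    obtain L where "L > 0" and L: "\<And>z h. norm z \<le> R \<Longrightarrow> norm (f' z h) \<le> L * norm h"
      using derivative_bounded_cball[of f f' R] f by blast
    have "continuous_on {0..1} (\<lambda>t. Y t a)"
      unfolding continuous_on_eq_continuous_within
      using Y has_vector_derivative_continuous by blast
    then have "bounded ((\<lambda>t. Y t a) ` {0..1})"
      by (intro compact_imp_bounded compact_continuous_image) auto
    then obtain B where "B > 0" and B: "\<And>t. t \<in> {0..1} \<Longrightarrow> norm (Y t a) \<le> B"
      unfolding bounded_pos by blast
    define G where "G = sqrt (exp (2 * L + 1))"
    have "G > 0"
      by (simp add: G_def)
    have lim: "((\<lambda>a'. K * norm (X 0 a' - X 0 a)) \<longlongrightarrow> 0) (at a)"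
      using cont by (auto intro!: tendsto_eq_intros simp: continuous_on_eq_continuous_at isCont_def)
    have "\<forall>\<^sub>F a' in at a. dist (Y t a') (Y t a) < e" if "e > 0" for e
    proof -
      \<comment> \<open>\<open>G\<close> is Gronwall's factor and \<open>B\<close> bounds the base
        solution \<open>Y\<close>; the half leaves room for a strict inequality.\<close>
      define e' where "e' = e / 2 / (G * B)"
      have "e' > 0"
        using that \<open>G > 0\<close> \<open>B > 0\<close> by (simp add: e'_def)
      obtain d where "d > 0" and d: "\<And>x y h. norm x \<le> R \<Longrightarrow> norm y \<le> R \<Longrightarrow> norm (y - x) < d \<Longrightarrow>
          norm (f' y h - f' x h) \<le> e' * norm h"
        using derivative_modulus_cball[of f f' e' R] f \<open>e' > 0\<close> by blast
      show ?thesis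
        using order_tendstoD(2)[OF lim zero_less_one] order_tendstoD(2)[OF lim \<open>d > 0\<close>]
      proof eventually_elim
        case (elim a')
        have "(norm (Y t a' - Y t a))\<^sup>2 + (e' * B)\<^sup>2
            \<le> ((norm (Y 0 a' - Y 0 a))\<^sup>2 + (e' * B)\<^sup>2) * exp ((2 * L + 1) * t)"
        proof (rule gronwall_norm[where T = 1 and D = "\<lambda>s. Y s a' - Y s a"
              and D' = "\<lambda>s. f' (X s a') (Y s a') - f' (X s a) (Y s a)"])
          fix s :: real assume s: "s \<in> {0..1}"
          show "((\<lambda>s. Y s a' - Y s a) has_vector_derivative f' (X s a') (Y s a') - f' (X s a) (Y s a))
              (at s within {0..1})"
            by (intro has_vector_derivative_diff Y s)
          have X': "norm (X s a') \<le> R" "norm (X s a' - X s a) < d" "norm (X s a) \<le> R"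
            using stab[OF X _ s, of a'] stab[OF X _ s, of a] elim by auto
          have "f' (X s a') (Y s a') - f' (X s a) (Y s a)
              = f' (X s a') (Y s a' - Y s a) + (f' (X s a') (Y s a) - f' (X s a) (Y s a))"
            using linear_diff[OF has_derivative_linear[OF f(1)[of "X s a'"]]] by simp
          also have "norm \<dots> \<le> L * norm (Y s a' - Y s a) + e' * B"
          proof (intro norm_triangle_le add_mono)
            have "norm (f' (X s a') (Y s a) - f' (X s a) (Y s a)) \<le> e' * norm (Y s a)"
              using d X' by blast
            also have "\<dots> \<le> e' * B"
              using B[OF s] \<open>e' > 0\<close> by simp
            finally show "norm (f' (X s a') (Y s a) - f' (X s a) (Y s a)) \<le> e' * B" .
          qed (use L X' in blast)
          finally show "norm (f' (X s a') (Y s a') - f' (X s a) (Y s a)) \<le> L * norm (Y s a' - Y s a) + e' * B" .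
        qed (use t \<open>L > 0\<close> in auto)
        also have "\<dots> \<le> (e' * B)\<^sup>2 * G\<^sup>2"
          using t \<open>L > 0\<close> by (auto simp: Y0 G_def intro!: mult_left_mono mult_left_le)
        also have "\<dots> = (e / 2)\<^sup>2"
          using \<open>G > 0\<close> \<open>B > 0\<close> by (simp add: e'_def field_simps)
        finally have "(norm (Y t a' - Y t a))\<^sup>2 \<le> (e / 2)\<^sup>2"
          using zero_le_power2[of "e' * B"] by linarith
        then have "norm (Y t a' - Y t a) \<le> e / 2"
          by (rule power2_le_imp_le) (use \<open>e > 0\<close> in simp)
        then show ?case
          using \<open>e > 0\<close> by (simp add: dist_norm)
      qed
    qed
    then show ?thesis
      unfolding isCont_def by (intro tendstoI)
  qed
  then show ?thesis
    by (simp add: continuous_at_imp_continuous_on)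
qed

text \<open>Parameters and states live in different spaces, so that the statement also covers
  extended systems: states paired with their linearization or with the action start at values such
  as \<open>(b, 0)\<close> relative to a shift of the parameter by \<open>b\<close>.\<close>

lemma flow_derivative:
  fixes f :: "'b::euclidean_space \<Rightarrow> 'b" and X :: "real \<Rightarrow> 'a::real_normed_vector \<Rightarrow> 'b"
  assumes f: "\<And>z. (f has_derivative f' z) (at z)" "\<And>h. continuous_on UNIV (\<lambda>z. f' z h)"
    and X: "\<And>a. solves f (\<lambda>t. X t a)" and cont: "continuous_on UNIV (X 0)"
    and init: "\<And>a \<sigma>. X 0 (a + \<sigma> *\<^sub>R b) = X 0 a + \<sigma> *\<^sub>R y0"
  obtains Y where "\<And>a. Y 0 a = y0"
    and "\<And>t a. t \<in> {0..1} \<Longrightarrow> ((\<lambda>\<sigma>. X t (a + \<sigma> *\<^sub>R b)) has_vector_derivative Y t a) (at 0)"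
    and "\<And>t a. t \<in> {0..1} \<Longrightarrow>
      ((\<lambda>t. Y t a) has_vector_derivative f' (X t a) (Y t a)) (at t within {0..1})"
    and "\<And>t. t \<in> {0..1} \<Longrightarrow> continuous_on UNIV (Y t)"
proof -
  have "\<exists>Y. Y 0 = y0 \<and>
      (\<forall>t\<in>{0..1}. ((\<lambda>\<sigma>. X t (a + \<sigma> *\<^sub>R b)) has_vector_derivative Y t) (at 0) \<and>
        (Y has_vector_derivative f' (X t a) (Y t)) (at t within {0..1}))" for a
  proof -
    obtain Y where "Y 0 = y0"
      "\<And>t. t \<in> {0..1} \<Longrightarrow> ((\<lambda>\<sigma>. X t (a + \<sigma> *\<^sub>R b)) has_vector_derivative Y t) (at 0)"
      "\<And>t. t \<in> {0..1} \<Longrightarrow> (Y has_vector_derivative f' (X t (a + 0 *\<^sub>R b)) (Y t)) (at t within {0..1})"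
    proof (rule solution_difference_quotients[of f f' "\<lambda>\<sigma> t. X t (a + \<sigma> *\<^sub>R b)" y0])
      show "X 0 (a + \<sigma> *\<^sub>R b) = X 0 (a + 0 *\<^sub>R b) + \<sigma> *\<^sub>R y0" for \<sigma>
        by (simp add: init)
    qed (use f X in auto)
    then show ?thesis
      by (intro exI[of _ Y]) simp
  qed
  then obtain Y where Y: "\<And>a. Y a 0 = y0"
    "\<And>t a. t \<in> {0..1} \<Longrightarrow> ((\<lambda>\<sigma>. X t (a + \<sigma> *\<^sub>R b)) has_vector_derivative Y a t) (at 0)"
    "\<And>t a. t \<in> {0..1} \<Longrightarrow> (Y a has_vector_derivative f' (X t a) (Y a t)) (at t within {0..1})"
    by metis
  have "continuous_on UNIV (\<lambda>a. Y a t)" if "t \<in> {0..1}" for t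
    using flow_linearization_continuous_on[of f f' X "\<lambda>t a. Y a t" y0 t] f X cont Y that by blast
  then show ?thesis
    using that[of "\<lambda>t a. Y a t"] Y by blast
qed

text \<open>Differentiability in \<open>x\<close> for each fixed \<open>h\<close> gives joint
  differentiability in \<open>(x, h)\<close>, because linearity in \<open>h\<close> reduces the
  family to finitely many coefficient functions \<open>A x i\<close>.\<close>

lemma linear_family_derivative:
  fixes A :: "'b::euclidean_space \<Rightarrow> 'b \<Rightarrow> 'c::real_normed_vector"
  assumes lin: "\<And>x. linear (A x)"
    and A: "\<And>x h. ((\<lambda>x. A x h) has_derivative A' x h) (at x)"
  shows "A' x h k = (\<Sum>i\<in>Basis. (h \<bullet> i) *\<^sub>R A' x i k)"
    and "((\<lambda>p. A (fst p) (snd p)) has_derivative (\<lambda>q. A' (fst p) (snd p) (fst q) + A (fst p) (snd q))) (at p)"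
proof -
  have expand: "A x h = (\<Sum>i\<in>Basis. (h \<bullet> i) *\<^sub>R A x i)" for x h
  proof -
    have "A x h = A x (\<Sum>i\<in>Basis. (h \<bullet> i) *\<^sub>R i)"
      by (simp add: euclidean_representation)
    also have "\<dots> = (\<Sum>i\<in>Basis. A x ((h \<bullet> i) *\<^sub>R i))"
      by (rule linear_sum[OF lin])
    finally show ?thesis
      by (simp add: linear_cmul[OF lin])
  qed
  have expand': "A' x h k = (\<Sum>i\<in>Basis. (h \<bullet> i) *\<^sub>R A' x i k)" for x h k
  proof -
    have "((\<lambda>x. \<Sum>i\<in>Basis. (h \<bullet> i) *\<^sub>R A x i) has_derivative (\<lambda>k. \<Sum>i\<in>Basis. (h \<bullet> i) *\<^sub>R A' x i k)) (at x)"
      by (intro has_derivative_sum has_derivative_scaleR_right A)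
    then have "((\<lambda>x. A x h) has_derivative (\<lambda>k. \<Sum>i\<in>Basis. (h \<bullet> i) *\<^sub>R A' x i k)) (at x)"
      by (simp flip: expand)
    then show ?thesis
      using has_derivative_unique[OF A] by (blast dest: fun_cong)
  qed
  show "A' x h k = (\<Sum>i\<in>Basis. (h \<bullet> i) *\<^sub>R A' x i k)"
    by (rule expand')
  have A_fst: "((\<lambda>p. A (fst p) i) has_derivative (\<lambda>q. A' (fst p) i (fst q))) (at p)" for i and p :: "'b \<times> 'b"
    using has_derivative_compose[OF has_derivative_fst[OF has_derivative_ident] A] by blast
  have "((\<lambda>p. \<Sum>i\<in>Basis. (snd p \<bullet> i) *\<^sub>R A (fst p) i) has_derivative
      (\<lambda>q. \<Sum>i\<in>Basis. (snd p \<bullet> i) *\<^sub>R A' (fst p) i (fst q) + (snd q \<bullet> i) *\<^sub>R A (fst p) i)) (at p)"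
    by (auto intro!: derivative_eq_intros A_fst simp: fun_eq_iff)
  then show "((\<lambda>p. A (fst p) (snd p)) has_derivative (\<lambda>q. A' (fst p) (snd p) (fst q) + A (fst p) (snd q))) (at p)"
    by (simp add: sum.distrib flip: expand expand')
qed

text \<open>The derivative \<open>Y\<close> and \<open>X\<close> together solve the system with right-hand side
  \<open>(f x, f' x y)\<close>, to which the first-order result applies again.\<close>

lemma flow_second_derivative:
  fixes f :: "'b::euclidean_space \<Rightarrow> 'b" and X Y W :: "real \<Rightarrow> 'a::real_normed_vector \<Rightarrow> 'b"
  assumes f: "\<And>z. (f has_derivative f' z) (at z)"
    and f': "\<And>z h. ((\<lambda>z. f' z h) has_derivative f'' z h) (at z)"
    and f'': "\<And>h k. continuous_on UNIV (\<lambda>z. f'' z h k)"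
    and X: "\<And>a. solves f (\<lambda>t. X t a)" and cont: "continuous_on UNIV (X 0)"
    and init: "\<And>a \<sigma>. X 0 (a + \<sigma> *\<^sub>R c) = X 0 a + \<sigma> *\<^sub>R w0"
    and W: "\<And>t a. t \<in> {0..1} \<Longrightarrow> ((\<lambda>\<sigma>. X t (a + \<sigma> *\<^sub>R c)) has_vector_derivative W t a) (at 0)"
    and Y0: "\<And>a. Y 0 a = y0"
    and Y: "\<And>t a. t \<in> {0..1} \<Longrightarrow>
      ((\<lambda>t. Y t a) has_vector_derivative f' (X t a) (Y t a)) (at t within {0..1})"
  obtains Z where "\<And>a. Z 0 a = 0"
    and "\<And>t a. t \<in> {0..1} \<Longrightarrow> ((\<lambda>\<sigma>. Y t (a + \<sigma> *\<^sub>R c)) has_vector_derivative Z t a) (at 0)"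
    and "\<And>t a. t \<in> {0..1} \<Longrightarrow> ((\<lambda>t. Z t a) has_vector_derivative
        f'' (X t a) (Y t a) (W t a) + f' (X t a) (Z t a)) (at t within {0..1})"
    and "\<And>t. t \<in> {0..1} \<Longrightarrow> continuous_on UNIV (Z t)"
proof -
  have lin: "linear (f' z)" for z
    using f has_derivative_linear by blast
  have f'_cont: "continuous_on UNIV (\<lambda>z. f' z h)" for h
    using f' by (rule has_derivative_imp_continuous_on)
  define F where "F p = (f (fst p), f' (fst p) (snd p))" for p
  define F' where "F' p q = (f' (fst p) (fst q), f'' (fst p) (snd p) (fst q) + f' (fst p) (snd q))" for p q
  define XY where "XY t a = (X t a, Y t a)" for t a
  have F: "(F has_derivative F' p) (at p)" for p
    unfolding F_def[abs_def] F'_def[abs_def]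
    by (intro has_derivative_Pair linear_family_derivative(2)[OF lin f']
        has_derivative_comp_fst f)
  have F'_cont: "continuous_on UNIV (\<lambda>p. F' p q)" for q
  proof -
    note comp = continuous_on_comp_fst[OF f''] continuous_on_comp_fst[OF f'_cont]
    \<comment> \<open>\<open>f''\<close> is assumed continuous only with both directions fixed;
      expanding the varying direction over the basis makes the continuity joint.\<close>
    have "F' p q = (f' (fst p) (fst q),
        (\<Sum>i\<in>Basis. (snd p \<bullet> i) *\<^sub>R f'' (fst p) i (fst q)) + f' (fst p) (snd q))" for p
      using linear_family_derivative(1)[OF lin f', of "fst p" "snd p" "fst q"] by (simp add: F'_def)
    then show ?thesis
      by (simp only:) (intro continuous_intros comp)
  qed
  obtain U where U: "\<And>a. U 0 a = (w0, 0)"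
    "\<And>t a. t \<in> {0..1} \<Longrightarrow> ((\<lambda>\<sigma>. XY t (a + \<sigma> *\<^sub>R c)) has_vector_derivative U t a) (at 0)"
    "\<And>t a. t \<in> {0..1} \<Longrightarrow> ((\<lambda>t. U t a) has_vector_derivative F' (XY t a) (U t a)) (at t within {0..1})"
    "\<And>t. t \<in> {0..1} \<Longrightarrow> continuous_on UNIV (U t)"
  proof (rule flow_derivative[of F F' XY c "(w0, 0)"])
    show "solves F (\<lambda>t. XY t a)" for a
      using X[of a] Y unfolding solves_def XY_def F_def
      by (auto intro!: has_vector_derivative_Pair)
    show "continuous_on UNIV (XY 0)"
      unfolding XY_def[abs_def] using cont by (simp add: Y0 continuous_on_Pair)
    show "XY 0 (a + \<sigma> *\<^sub>R c) = XY 0 a + \<sigma> *\<^sub>R (w0, 0)" for a \<sigma>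
      by (simp add: XY_def Y0 init)
  qed (use F F'_cont in auto)
  \<comment> \<open>The derivative of the pair has \<open>W\<close> as its first component, by
    uniqueness of derivatives along a line.\<close>
  have fst_U: "fst (U t a) = W t a" if "t \<in> {0..1}" for t a
    using vector_derivative_unique_at[OF has_vector_derivative_fst_snd(1)[OF U(2)[OF that, of a], unfolded XY_def fst_conv] W[OF that]] .
  show ?thesis
  proof (rule that[of "\<lambda>t a. snd (U t a)"])
    fix t :: real and a assume t: "t \<in> {0..1}"
    show "((\<lambda>\<sigma>. Y t (a + \<sigma> *\<^sub>R c)) has_vector_derivative snd (U t a)) (at 0)"
      using has_vector_derivative_fst_snd(2)[OF U(2)[OF t, of a]] by (simp add: XY_def)
    show "((\<lambda>t. snd (U t a)) has_vector_derivative
        f'' (X t a) (Y t a) (W t a) + f' (X t a) (snd (U t a))) (at t within {0..1})"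
      using has_vector_derivative_fst_snd(2)[OF U(3)[OF t, of a]] by (simp add: F'_def XY_def fst_U[OF t])
    show "continuous_on UNIV (\<lambda>a. snd (U t a))"
      using U(4)[OF t] by (intro continuous_intros)
  qed (simp add: U)
qed

section \<open>Partial derivatives\<close>

lemma partialI:
  "((\<lambda>s. f (x + s *\<^sub>R b)) has_vector_derivative d) (at 0) \<Longrightarrow> partial b f x = d"
  unfolding partial_def by (rule vector_derivative_at)

lemma has_derivative_line:
  assumes "(f has_derivative f') (at (x + s *\<^sub>R b))"
  shows "((\<lambda>s. f (x + s *\<^sub>R b)) has_vector_derivative f' b) (at s)"
proof -
  have "((\<lambda>s. x + s *\<^sub>R b) has_derivative (\<lambda>h. h *\<^sub>R b)) (at s)"
    by (auto intro!: derivative_eq_intros)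
  from has_derivative_compose[OF this assms] show ?thesis
    unfolding has_vector_derivative_def
    using linear_cmul[OF has_derivative_linear[OF assms]] by simp
qed

lemma partial_eq_derivative:
  assumes "(f has_derivative f') (at x)"
  shows "partial b f x = f' b"
  using has_derivative_line[of f f' x 0 b] assms by (intro partialI) simp

lemma has_vector_derivative_partial:
  assumes "f differentiable (at (x + s *\<^sub>R b))"
  shows "((\<lambda>s. f (x + s *\<^sub>R b)) has_vector_derivative partial b f (x + s *\<^sub>R b)) (at s)"
  using assms has_derivative_line partial_eq_derivative unfolding differentiable_def by metis

lemma Ck_Suc_imp: "Ck (Suc k) f \<Longrightarrow> Ck k f"
proof (induction k arbitrary: f)
  case 0
  then show ?case
    by (auto intro!: continuous_at_imp_continuous_on differentiable_imp_continuous_within)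
next
  case (Suc k)
  then show ?case
    by (metis Ck.simps(2))
qed

lemma Ck_antimono: "Ck n f \<Longrightarrow> m \<le> n \<Longrightarrow> Ck m f"
  by (induction n) (auto simp del: Ck.simps simp: le_Suc_eq dest: Ck_Suc_imp)

lemma has_derivative_partial_axis:
  fixes f :: "real ^ 'n \<Rightarrow> 'b::real_normed_vector"
  assumes "f differentiable (at x)"
  shows "(f has_derivative (\<lambda>h. \<Sum>j\<in>UNIV. (h $ j) *\<^sub>R partial (axis j 1) f x)) (at x)"
proof -
  obtain f' where f': "(f has_derivative f') (at x)"
    using assms unfolding differentiable_def by blast
  have "f' h = (\<Sum>j\<in>UNIV. (h $ j) *\<^sub>R partial (axis j 1) f x)" for h
  proof -
    have "f' h = f' (\<Sum>j\<in>UNIV. (h $ j) *\<^sub>R axis j 1)"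
      using basis_expansion[of h] by (simp add: scalar_mult_eq_scaleR)
    also have "\<dots> = (\<Sum>j\<in>UNIV. (h $ j) *\<^sub>R f' (axis j 1))"
      by (simp add: linear_sum[OF has_derivative_linear[OF f']] linear_cmul[OF has_derivative_linear[OF f']])
    finally show ?thesis
      by (simp add: partial_eq_derivative[OF f'])
  qed
  then show ?thesis
    using f' by (metis (no_types, lifting) ext)
qed

text \<open>The mean value theorem is applied twice: along \<open>a\<close> to the difference of
  \<open>f\<close> on two parallel lines, then along \<open>b\<close> to
  \<open>partial a f\<close>.\<close>

lemma second_difference_mean_value:
  fixes f :: "'a::real_normed_vector \<Rightarrow> real"
  assumes f: "\<And>x. f differentiable (at x)" and f': "\<And>x. partial a f differentiable (at x)"
    and "0 < h"
  obtains s r where "0 < s" "s < h" "0 < r" "r < h"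
    and "f (x + h *\<^sub>R a + h *\<^sub>R b) - f (x + h *\<^sub>R a) - (f (x + h *\<^sub>R b) - f x)
      = h * (h * partial b (partial a f) (x + s *\<^sub>R a + r *\<^sub>R b))"
proof -
  have line: "((\<lambda>s. g (x + s *\<^sub>R c)) has_real_derivative partial c g (x + s *\<^sub>R c)) (at s)"
    if "\<And>x. g differentiable (at x)" for g :: "'a \<Rightarrow> real" and x c s
    using has_vector_derivative_partial[OF that] by (simp add: has_real_derivative_iff_has_vector_derivative)
  have "((\<lambda>s. f (x + h *\<^sub>R b + s *\<^sub>R a) - f (x + s *\<^sub>R a)) has_real_derivative
      partial a f (x + h *\<^sub>R b + s *\<^sub>R a) - partial a f (x + s *\<^sub>R a)) (at s)" for s
    by (intro DERIV_diff line f)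
  then obtain s where s: "0 < s" "s < h"
    "f (x + h *\<^sub>R b + h *\<^sub>R a) - f (x + h *\<^sub>R a) - (f (x + h *\<^sub>R b + 0 *\<^sub>R a) - f (x + 0 *\<^sub>R a))
      = (h - 0) * (partial a f (x + h *\<^sub>R b + s *\<^sub>R a) - partial a f (x + s *\<^sub>R a))"
    using MVT2[OF \<open>0 < h\<close>, of "\<lambda>s. f (x + h *\<^sub>R b + s *\<^sub>R a) - f (x + s *\<^sub>R a)"
        "\<lambda>s. partial a f (x + h *\<^sub>R b + s *\<^sub>R a) - partial a f (x + s *\<^sub>R a)"] by blast
  obtain r where r: "0 < r" "r < h"
    "partial a f (x + s *\<^sub>R a + h *\<^sub>R b) - partial a f (x + s *\<^sub>R a + 0 *\<^sub>R b)
      = (h - 0) * partial b (partial a f) (x + s *\<^sub>R a + r *\<^sub>R b)"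
    using MVT2[OF \<open>0 < h\<close>, of "\<lambda>r. partial a f (x + s *\<^sub>R a + r *\<^sub>R b)"
        "\<lambda>r. partial b (partial a f) (x + s *\<^sub>R a + r *\<^sub>R b)"] line[OF f'] by blast
  show ?thesis
    using that[OF s(1,2) r(1,2)] s(3) r(3) by (simp add: add.commute add.left_commute)
qed

text \<open>Schwarz's theorem: the second difference is symmetric in \<open>a\<close> and
  \<open>b\<close>, so both mixed derivatives take a common value at points arbitrarily close to
  \<open>x\<close>, and continuity concludes.\<close>

lemma partial_commute:
  fixes f :: "'a::euclidean_space \<Rightarrow> real"
  assumes "Ck 2 f" and a: "a \<in> Basis" and b: "b \<in> Basis"
  shows "partial a (partial b f) x = partial b (partial a f) x"
proof (rule ccontr)
  assume neq: "partial a (partial b f) x \<noteq> partial b (partial a f) x"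
  \<comment> \<open>Half the gap: near \<open>x\<close> each mixed derivative is within
    \<open>e\<close> of its value at \<open>x\<close>, so a common value forces the gap below
    \<open>2 * e\<close>.\<close>
  define e where "e = \<bar>partial a (partial b f) x - partial b (partial a f) x\<bar> / 2"
  have "e > 0"
    using neq by (simp add: e_def)
  have diff: "f differentiable (at y)" "partial a f differentiable (at y)" "partial b f differentiable (at y)" for y
    using assms by (auto simp: numeral_2_eq_2)
  have "isCont (partial a (partial b f)) x" "isCont (partial b (partial a f)) x"
    using assms by (auto simp: numeral_2_eq_2 continuous_on_eq_continuous_at)
  then obtain d where "d > 0"
    and d: "\<And>y. dist y x < d \<Longrightarrow> dist (partial a (partial b f) y) (partial a (partial b f) x) < e"
      "\<And>y. dist y x < d \<Longrightarrow> dist (partial b (partial a f) y) (partial b (partial a f) x) < e"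
    using \<open>e > 0\<close> unfolding continuous_at_eps_delta by (metis min_less_iff_conj)
  \<comment> \<open>The intermediate points are displaced by less than \<open>h\<close> in each of
    two unit directions.\<close>
  define h where "h = d / 2"
  have "h > 0"
    using \<open>d > 0\<close> by (simp add: h_def)
  have close: "dist (x + s *\<^sub>R u + r *\<^sub>R w) x < d"
    if "u \<in> Basis" "w \<in> Basis" "0 < s" "s < h" "0 < r" "r < h" for s r u w
    using that norm_triangle_ineq[of "s *\<^sub>R u" "r *\<^sub>R w"] by (simp add: dist_norm h_def add.assoc)
  obtain s r where sr: "0 < s" "s < h" "0 < r" "r < h"
    "f (x + h *\<^sub>R a + h *\<^sub>R b) - f (x + h *\<^sub>R a) - (f (x + h *\<^sub>R b) - f x)
      = h * (h * partial b (partial a f) (x + s *\<^sub>R a + r *\<^sub>R b))"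
    using second_difference_mean_value[of f a h x b] diff \<open>h > 0\<close> by metis
  obtain s' r' where sr': "0 < s'" "s' < h" "0 < r'" "r' < h"
    "f (x + h *\<^sub>R b + h *\<^sub>R a) - f (x + h *\<^sub>R b) - (f (x + h *\<^sub>R a) - f x)
      = h * (h * partial a (partial b f) (x + s' *\<^sub>R b + r' *\<^sub>R a))"
    using second_difference_mean_value[of f b h x a] diff \<open>h > 0\<close> by metis
  have "f (x + h *\<^sub>R b + h *\<^sub>R a) = f (x + h *\<^sub>R a + h *\<^sub>R b)"
    by (simp add: add.commute add.left_commute)
  then have "h * (h * partial b (partial a f) (x + s *\<^sub>R a + r *\<^sub>R b))
      = h * (h * partial a (partial b f) (x + s' *\<^sub>R b + r' *\<^sub>R a))"
    using sr(5) sr'(5) by linarith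
  then have "partial b (partial a f) (x + s *\<^sub>R a + r *\<^sub>R b) = partial a (partial b f) (x + s' *\<^sub>R b + r' *\<^sub>R a)"
    using \<open>h > 0\<close> by simp
  then have "\<bar>partial a (partial b f) x - partial b (partial a f) x\<bar> < 2 * e"
    using d(1)[OF close[OF b a sr'(1-4)]] d(2)[OF close[OF a b sr(1-4)]] unfolding dist_real_def by linarith
  then show False
    by (simp add: e_def)
qed

section \<open>Gradient, Hessian and third derivative in coordinates\<close>

lemma has_derivative_vec_lambda:
  fixes f :: "'n::finite \<Rightarrow> 'a::real_normed_vector \<Rightarrow> real"
  assumes "\<And>i. (f i has_derivative f' i) (at x)"
  shows "((\<lambda>x. \<chi> i. f i x) has_derivative (\<lambda>h. \<chi> i. f' i h)) (at x)"
  using assms by (subst has_derivative_componentwise_within) (auto simp: Basis_vec_def inner_axis)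

text \<open>Kept as a linear map in \<open>h\<close>, the form in which it is the derivative of
  \<open>grad f\<close>. In the list the last entry is differentiated first, so
  \<open>axis i 1\<close> belongs to the gradient component.\<close>

definition hess :: "(real ^ 'n \<Rightarrow> real) \<Rightarrow> real ^ 'n \<Rightarrow> real ^ 'n \<Rightarrow> real ^ 'n" where
  "hess f x h = (\<chi> i. \<Sum>j\<in>UNIV. h $ j * partials [axis j 1, axis i 1] f x)"

definition third_deriv :: "(real ^ 'n \<Rightarrow> real) \<Rightarrow> real ^ 'n \<Rightarrow> real ^ 'n \<Rightarrow> real ^ 'n \<Rightarrow> real ^ 'n" where
  "third_deriv f x h k = (\<chi> i. \<Sum>j\<in>UNIV. h $ j * (\<Sum>l\<in>UNIV. k $ l * partials [axis l 1, axis j 1, axis i 1] f x))"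

context
  fixes f :: "real ^ 'n \<Rightarrow> real"
  assumes f: "Ck 3 f"
begin

lemma Ck_3_partial:
  shows "f differentiable (at x)"
    and "partial (axis i 1) f differentiable (at x)"
    and "partial (axis j 1) (partial (axis i 1) f) differentiable (at x)"
    and "continuous_on UNIV (partial (axis l 1) (partial (axis j 1) (partial (axis i 1) f)))"
  using f by (auto simp: numeral_3_eq_3)

lemma has_derivative_grad: "(f has_derivative (\<lambda>h. h \<bullet> grad f x)) (at x)"
  using has_derivative_partial_axis[OF Ck_3_partial(1)[of x]] by (simp add: inner_vec_def grad_def)

lemma grad_has_derivative: "(grad f has_derivative hess f x) (at x)"
  unfolding grad_def[abs_def] hess_def[abs_def]
  using has_derivative_partial_axis[OF Ck_3_partial(2)] by (intro has_derivative_vec_lambda) simp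

lemma hess_has_derivative: "((\<lambda>x. hess f x h) has_derivative third_deriv f x h) (at x)"
  unfolding third_deriv_def[abs_def] hess_def[abs_def]
  using has_derivative_partial_axis[OF Ck_3_partial(3)]
  by (intro has_derivative_vec_lambda has_derivative_sum has_derivative_mult_right) simp

lemma third_deriv_continuous_on: "continuous_on UNIV (\<lambda>x. third_deriv f x h k)"
  unfolding third_deriv_def using Ck_3_partial(4) by (intro continuous_intros) simp

text \<open>Follows from the symmetry of mixed partial derivatives; this is what makes the
  linearized flow preserve the symplectic form.\<close>

lemma hess_symmetric: "hess f x h \<bullet> k = h \<bullet> hess f x k"
proof -
  have "Ck 2 f"
    by (rule Ck_antimono[OF f]) simp
  then have comm: "partial (axis j 1) (partial (axis i 1) f) x = partial (axis i 1) (partial (axis j 1) f) x" for i j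
    by (rule partial_commute) (simp_all add: axis_in_Basis_iff)
  have "hess f x h \<bullet> k = (\<Sum>i\<in>UNIV. \<Sum>j\<in>UNIV. h $ j * k $ i * partials [axis j 1, axis i 1] f x)"
    by (simp add: hess_def inner_vec_def sum_distrib_left sum_distrib_right ac_simps)
  also have "\<dots> = (\<Sum>j\<in>UNIV. \<Sum>i\<in>UNIV. h $ j * k $ i * partials [axis j 1, axis i 1] f x)"
    by (rule sum.swap)
  also have "\<dots> = (\<Sum>j\<in>UNIV. \<Sum>i\<in>UNIV. h $ j * k $ i * partials [axis i 1, axis j 1] f x)"
    using comm by (intro sum.cong refl) simp
  also have "\<dots> = h \<bullet> hess f x k"
    by (simp add: hess_def inner_vec_def sum_distrib_left sum_distrib_right ac_simps)
  finally show ?thesis .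
qed

end

lemma norm_vec_le_sum_norm:
  fixes g :: "'n::finite \<Rightarrow> real"
  shows "norm (\<chi> i. g i) \<le> (\<Sum>i\<in>UNIV. \<bar>g i\<bar>)"
  using norm_le_l1_cart[of "\<chi> i. g i"] by simp

text \<open>There are finitely many coordinate entries, each bounded on the whole space; the sums of
  their bounds serve both estimates, and the maximum with 1 makes the constant positive.\<close>

lemma subquadratic_bounds:
  fixes f :: "real ^ 'n \<Rightarrow> real"
  assumes "subquadratic f"
  obtains C where "C > 0" and "\<And>x h. norm (hess f x h) \<le> C * norm h"
    and "\<And>x h k. norm (third_deriv f x h k) \<le> C * norm h * norm k"
proof -
  have bounded: "\<exists>B. \<forall>x. \<bar>partials bs f x\<bar> \<le> B" if "set bs \<subseteq> Basis" "length bs \<in> {2, 3}" for bs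
    using assms that unfolding subquadratic_def bounded_iff by (auto simp del: partials.simps)
  define B where "B bs = (SOME B. \<forall>x. \<bar>partials bs f x\<bar> \<le> B)" for bs
  have B: "\<bar>partials bs f x\<bar> \<le> B bs" if "set bs \<subseteq> Basis" "length bs \<in> {2, 3}" for bs x
    using someI_ex[OF bounded[OF that]] by (simp add: B_def)
  have B2: "\<bar>partials [axis j 1, axis i 1] f x\<bar> \<le> B [axis j 1, axis i 1]" for i j x
    by (rule B) (auto simp: axis_in_Basis_iff)
  have B3: "\<bar>partials [axis l 1, axis j 1, axis i 1] f x\<bar> \<le> B [axis l 1, axis j 1, axis i 1]" for i j l x
    by (rule B) (auto simp: axis_in_Basis_iff)
  define C1 where "C1 = (\<Sum>i\<in>UNIV. \<Sum>j\<in>UNIV. B [axis j 1, axis i 1])"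
  define C2 where "C2 = (\<Sum>i\<in>UNIV. \<Sum>j\<in>UNIV. \<Sum>l\<in>UNIV. B [axis l 1, axis j 1, axis i 1])"
  have 1: "norm (hess f x h) \<le> C1 * norm h" for x h
  proof -
    have "norm (hess f x h) \<le> (\<Sum>i\<in>UNIV. \<bar>\<Sum>j\<in>UNIV. h $ j * partials [axis j 1, axis i 1] f x\<bar>)"
      unfolding hess_def by (rule norm_vec_le_sum_norm)
    also have "\<dots> \<le> (\<Sum>i\<in>UNIV. \<Sum>j\<in>UNIV. norm h * B [axis j 1, axis i 1])"
      by (intro sum_mono order_trans[OF sum_abs]) (simp only: abs_mult, intro mult_mono B2 component_le_norm_cart, auto)
    also have "\<dots> = C1 * norm h"
      by (simp add: C1_def sum_distrib_left mult.commute)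
    finally show ?thesis .
  qed
  have 2: "norm (third_deriv f x h k) \<le> C2 * norm h * norm k" for x h k
  proof -
    have "norm (third_deriv f x h k) \<le> (\<Sum>i\<in>UNIV. \<bar>\<Sum>j\<in>UNIV. h $ j * (\<Sum>l\<in>UNIV. k $ l * partials [axis l 1, axis j 1, axis i 1] f x)\<bar>)"
      unfolding third_deriv_def by (rule norm_vec_le_sum_norm)
    also have "\<dots> \<le> (\<Sum>i\<in>UNIV. \<Sum>j\<in>UNIV. norm h * (\<Sum>l\<in>UNIV. norm k * B [axis l 1, axis j 1, axis i 1]))"
      by (intro sum_mono order_trans[OF sum_abs]) (simp only: abs_mult, intro mult_mono component_le_norm_cart
          order_trans[OF sum_abs] sum_mono, simp only: abs_mult, intro mult_mono B3 component_le_norm_cart, auto)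
    also have "\<dots> = C2 * norm h * norm k"
      by (simp add: C2_def sum_distrib_left sum_distrib_right ac_simps)
    finally show ?thesis .
  qed
  define C where "C = max 1 (max C1 C2)"
  have "norm (hess f x h) \<le> C * norm h" for x h
    by (rule order_trans[OF 1]) (intro mult_right_mono, auto simp: C_def)
  moreover have "norm (third_deriv f x h k) \<le> C * norm h * norm k" for x h k
    by (rule order_trans[OF 2]) (intro mult_right_mono, auto simp: C_def)
  ultimately show ?thesis
    using that[of C] by (simp add: C_def)
qed

lemma partial_add_const:
  assumes "f differentiable (at x)"
  shows "partial b (\<lambda>x. f x + c) x = partial b f x"
    and "partial b (\<lambda>x. c + f x) x = partial b f x"
  using has_vector_derivative_partial[of f x 0 b] assms
  by (auto intro!: partialI derivative_eq_intros)

lemma Ck_3_differentiable: "Ck 3 f \<Longrightarrow> f differentiable (at x)"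
  by (simp add: numeral_3_eq_3)

section \<open>The Hamiltonian flow\<close>

definition symplectic :: "(real ^ 'n) \<times> (real ^ 'n) \<Rightarrow> (real ^ 'n) \<times> (real ^ 'n) \<Rightarrow> real" where
  "symplectic u w = fst u \<bullet> snd w - fst w \<bullet> snd u"

text \<open>The flow is given for all times and all initial data, so no existence argument enters.
  Growth conditions stay outside the locale and are assumed only by the lemmas that bound
  derivatives globally.\<close>

locale separable_flow =
  fixes T V :: "real ^ 'n \<Rightarrow> real"
    and Q P :: "real \<Rightarrow> real ^ 'n \<Rightarrow> real ^ 'n \<Rightarrow> real ^ 'n"
    and S :: "real \<Rightarrow> real ^ 'n \<Rightarrow> real ^ 'n \<Rightarrow> real"
  assumes T: "Ck 3 T" and V: "Ck 3 V"
    and flow: "hamiltonian_flow (separable_hamiltonian T V) Q P"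
    and action: "dual_action (separable_hamiltonian T V) Q P S"
begin

text \<open>The factor \<open>t\<close> rescales time, so that a solution on \<open>[0, 1]\<close> reaches time \<open>t\<close> of either sign.\<close>

definition vfield :: "real \<Rightarrow> (real ^ 'n) \<times> (real ^ 'n) \<Rightarrow> (real ^ 'n) \<times> (real ^ 'n)" where
  "vfield t z = (t *\<^sub>R grad T (snd z), - (t *\<^sub>R grad V (fst z)))"

definition vfield' :: "real \<Rightarrow> (real ^ 'n) \<times> (real ^ 'n) \<Rightarrow> (real ^ 'n) \<times> (real ^ 'n) \<Rightarrow> (real ^ 'n) \<times> (real ^ 'n)" where
  "vfield' t z h = (t *\<^sub>R hess T (snd z) (snd h), - (t *\<^sub>R hess V (fst z) (fst h)))"

definition vfield'' :: "real \<Rightarrow> (real ^ 'n) \<times> (real ^ 'n) \<Rightarrow> (real ^ 'n) \<times> (real ^ 'n) \<Rightarrow> (real ^ 'n) \<times> (real ^ 'n) \<Rightarrow> (real ^ 'n) \<times> (real ^ 'n)" where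
  "vfield'' t z h k = (t *\<^sub>R third_deriv T (snd z) (snd h) (snd k), - (t *\<^sub>R third_deriv V (fst z) (fst h) (fst k)))"

definition flow_map :: "real \<Rightarrow> (real ^ 'n) \<times> (real ^ 'n) \<Rightarrow> (real ^ 'n) \<times> (real ^ 'n)" where
  "flow_map t a = (Q t (fst a) (snd a), P t (fst a) (snd a))"

definition flow_deriv :: "real \<Rightarrow> (real ^ 'n) \<times> (real ^ 'n) \<Rightarrow> (real ^ 'n) \<times> (real ^ 'n) \<Rightarrow> (real ^ 'n) \<times> (real ^ 'n)" where
  "flow_deriv t b a = vector_derivative (\<lambda>\<sigma>. flow_map t (a + \<sigma> *\<^sub>R b)) (at 0)"

definition flow_deriv2 :: "real \<Rightarrow> (real ^ 'n) \<times> (real ^ 'n) \<Rightarrow> (real ^ 'n) \<times> (real ^ 'n) \<Rightarrow> (real ^ 'n) \<times> (real ^ 'n) \<Rightarrow> (real ^ 'n) \<times> (real ^ 'n)" where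
  "flow_deriv2 t b c a = vector_derivative (\<lambda>\<sigma>. flow_deriv t b (a + \<sigma> *\<^sub>R c)) (at 0)"

lemma vfield_has_derivative: "(vfield t has_derivative vfield' t z) (at z)"
  unfolding vfield_def[abs_def] vfield'_def[abs_def]
  by (intro has_derivative_Pair has_derivative_minus has_derivative_scaleR_right
      has_derivative_comp_fst has_derivative_comp_snd grad_has_derivative T V)

lemma vfield'_has_derivative: "((\<lambda>z. vfield' t z h) has_derivative vfield'' t z h) (at z)"
  unfolding vfield'_def[abs_def] vfield''_def[abs_def]
  by (intro has_derivative_Pair has_derivative_minus has_derivative_scaleR_right
      has_derivative_comp_fst has_derivative_comp_snd hess_has_derivative T V)

lemma vfield'_continuous_on: "continuous_on UNIV (\<lambda>z. vfield' t z h)"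
  using vfield'_has_derivative by (rule has_derivative_imp_continuous_on)

lemma vfield''_continuous_on: "continuous_on UNIV (\<lambda>z. vfield'' t z h k)"
  unfolding vfield''_def
  by (intro continuous_on_Pair continuous_on_minus continuous_on_scaleR continuous_on_const
      continuous_on_comp_fst continuous_on_comp_snd third_deriv_continuous_on T V)

lemma grad_hamiltonian:
  "grad (\<lambda>y. separable_hamiltonian T V x y) p = grad T p"
  "grad (\<lambda>x. separable_hamiltonian T V x y) q = grad V q"
  using T V by (simp_all add: grad_def separable_hamiltonian_def partial_add_const Ck_3_differentiable)

lemma flow_map_0: "flow_map 0 a = a"
  using flow by (simp add: flow_map_def hamiltonian_flow_def)

lemma flow_map_solves: "solves (vfield t) (\<lambda>\<tau>. flow_map (\<tau> * t) a)"
  unfolding solves_def vfield_def flow_map_def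
proof (intro ballI has_vector_derivative_Pair)
  fix \<tau>
  have "((\<lambda>s. Q s (fst a) (snd a)) has_vector_derivative grad T (P t (fst a) (snd a))) (at t)"
    and "((\<lambda>s. P s (fst a) (snd a)) has_vector_derivative - grad V (Q t (fst a) (snd a))) (at t)" for t
    using flow by (simp_all add: hamiltonian_flow_def grad_hamiltonian)
  from rescale_time[OF this(1)] rescale_time[OF this(2)]
  show "((\<lambda>\<tau>. Q (\<tau> * t) (fst a) (snd a)) has_vector_derivative
      t *\<^sub>R grad T (snd (Q (\<tau> * t) (fst a) (snd a), P (\<tau> * t) (fst a) (snd a)))) (at \<tau> within {0..1})"
    and "((\<lambda>\<tau>. P (\<tau> * t) (fst a) (snd a)) has_vector_derivative
      - (t *\<^sub>R grad V (fst (Q (\<tau> * t) (fst a) (snd a), P (\<tau> * t) (fst a) (snd a))))) (at \<tau> within {0..1})"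
    by simp_all
qed

lemma flow_map_continuous_on: "continuous_on UNIV (flow_map t)"
  using flow_continuous_on[of "vfield t" "vfield' t" "\<lambda>\<tau>. flow_map (\<tau> * t)" 1]
    vfield_has_derivative vfield'_continuous_on flow_map_solves by (simp add: flow_map_0)

text \<open>The first variational equation. \<open>flow_deriv\<close> is identified with the family
  \<open>Y\<close> of the abstract theorem by uniqueness of derivatives; taking
  \<open>\<tau> = 1\<close> gives the facts at time \<open>t\<close>.\<close>

lemma flow_deriv_path:
  shows "flow_deriv 0 b a = b"
    and "\<And>\<tau>. \<tau> \<in> {0..1} \<Longrightarrow>
      ((\<lambda>\<sigma>. flow_map (\<tau> * t) (a + \<sigma> *\<^sub>R b)) has_vector_derivative flow_deriv (\<tau> * t) b a) (at 0)"
    and "\<And>\<tau>. \<tau> \<in> {0..1} \<Longrightarrow> ((\<lambda>\<tau>. flow_deriv (\<tau> * t) b a) has_vector_derivative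
      vfield' t (flow_map (\<tau> * t) a) (flow_deriv (\<tau> * t) b a)) (at \<tau> within {0..1})"
    and "\<And>\<tau>. \<tau> \<in> {0..1} \<Longrightarrow> continuous_on UNIV (flow_deriv (\<tau> * t) b)"
proof -
  obtain Y where Y: "\<And>a. Y 0 a = b"
    "\<And>\<tau> a. \<tau> \<in> {0..1} \<Longrightarrow> ((\<lambda>\<sigma>. flow_map (\<tau> * t) (a + \<sigma> *\<^sub>R b)) has_vector_derivative Y \<tau> a) (at 0)"
    "\<And>\<tau> a. \<tau> \<in> {0..1} \<Longrightarrow>
      ((\<lambda>\<tau>. Y \<tau> a) has_vector_derivative vfield' t (flow_map (\<tau> * t) a) (Y \<tau> a)) (at \<tau> within {0..1})"
    "\<And>\<tau>. \<tau> \<in> {0..1} \<Longrightarrow> continuous_on UNIV (Y \<tau>)"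
  proof (rule flow_derivative[of "vfield t" "vfield' t" "\<lambda>\<tau>. flow_map (\<tau> * t)" b b])
  qed (use vfield_has_derivative vfield'_continuous_on flow_map_solves in \<open>auto simp: flow_map_0\<close>)
  have eq: "flow_deriv (\<tau> * t) b a = Y \<tau> a" if "\<tau> \<in> {0..1}" for \<tau> a
    unfolding flow_deriv_def by (rule vector_derivative_at[OF Y(2)[OF that]])
  show "flow_deriv 0 b a = b"
    using eq[of 0 a] Y(1) by simp
  fix \<tau> :: real assume \<tau>: "\<tau> \<in> {0..1}"
  show "((\<lambda>\<sigma>. flow_map (\<tau> * t) (a + \<sigma> *\<^sub>R b)) has_vector_derivative flow_deriv (\<tau> * t) b a) (at 0)"
    using Y(2)[OF \<tau>, of a] by (simp add: eq[OF \<tau>])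
  show "((\<lambda>\<tau>. flow_deriv (\<tau> * t) b a) has_vector_derivative
      vfield' t (flow_map (\<tau> * t) a) (flow_deriv (\<tau> * t) b a)) (at \<tau> within {0..1})"
    unfolding eq[OF \<tau>] by (rule has_vector_derivative_transform[OF \<tau> eq Y(3)[OF \<tau>]])
  have "flow_deriv (\<tau> * t) b = Y \<tau>"
    using eq[OF \<tau>] by (rule ext)
  then show "continuous_on UNIV (flow_deriv (\<tau> * t) b)"
    using Y(4)[OF \<tau>] by simp
qed

lemma flow_map_has_vector_derivative:
  "((\<lambda>\<sigma>. flow_map t (a + \<sigma> *\<^sub>R b)) has_vector_derivative flow_deriv t b a) (at 0)"
  using flow_deriv_path(2)[of 1 t] by simp

lemma flow_deriv_continuous_on: "continuous_on UNIV (flow_deriv t b)"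
  using flow_deriv_path(4)[of 1 t] by simp

text \<open>The second variational equation: the linearized one driven by \<open>vfield''\<close>
  applied to the two first derivatives, with initial value 0 because \<open>flow_deriv 0 b\<close>
  is constant.\<close>

lemma flow_deriv2_path:
  shows "flow_deriv2 0 b c a = 0"
    and "\<And>\<tau>. \<tau> \<in> {0..1} \<Longrightarrow>
      ((\<lambda>\<sigma>. flow_deriv (\<tau> * t) b (a + \<sigma> *\<^sub>R c)) has_vector_derivative flow_deriv2 (\<tau> * t) b c a) (at 0)"
    and "\<And>\<tau>. \<tau> \<in> {0..1} \<Longrightarrow> ((\<lambda>\<tau>. flow_deriv2 (\<tau> * t) b c a) has_vector_derivative
      vfield'' t (flow_map (\<tau> * t) a) (flow_deriv (\<tau> * t) b a) (flow_deriv (\<tau> * t) c a)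
      + vfield' t (flow_map (\<tau> * t) a) (flow_deriv2 (\<tau> * t) b c a)) (at \<tau> within {0..1})"
    and "\<And>\<tau>. \<tau> \<in> {0..1} \<Longrightarrow> continuous_on UNIV (flow_deriv2 (\<tau> * t) b c)"
proof -
  obtain Z where Z: "\<And>a. Z 0 a = 0"
    "\<And>\<tau> a. \<tau> \<in> {0..1} \<Longrightarrow> ((\<lambda>\<sigma>. flow_deriv (\<tau> * t) b (a + \<sigma> *\<^sub>R c)) has_vector_derivative Z \<tau> a) (at 0)"
    "\<And>\<tau> a. \<tau> \<in> {0..1} \<Longrightarrow> ((\<lambda>\<tau>. Z \<tau> a) has_vector_derivative
      vfield'' t (flow_map (\<tau> * t) a) (flow_deriv (\<tau> * t) b a) (flow_deriv (\<tau> * t) c a)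
      + vfield' t (flow_map (\<tau> * t) a) (Z \<tau> a)) (at \<tau> within {0..1})"
    "\<And>\<tau>. \<tau> \<in> {0..1} \<Longrightarrow> continuous_on UNIV (Z \<tau>)"
  proof (rule flow_second_derivative[of "vfield t" "vfield' t" "vfield'' t" "\<lambda>\<tau>. flow_map (\<tau> * t)" c c
        "\<lambda>\<tau>. flow_deriv (\<tau> * t) c" "\<lambda>\<tau>. flow_deriv (\<tau> * t) b" b])
    show "flow_deriv (0 * t) b a = b" for a
      by (simp add: flow_deriv_path(1))
  qed (use vfield_has_derivative vfield'_has_derivative vfield''_continuous_on flow_map_solves
      flow_deriv_path(2,3) in \<open>auto simp: flow_map_0\<close>)
  have eq: "flow_deriv2 (\<tau> * t) b c a = Z \<tau> a" if "\<tau> \<in> {0..1}" for \<tau> a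
    unfolding flow_deriv2_def by (rule vector_derivative_at[OF Z(2)[OF that]])
  show "flow_deriv2 0 b c a = 0"
    using eq[of 0 a] Z(1) by simp
  fix \<tau> :: real assume \<tau>: "\<tau> \<in> {0..1}"
  show "((\<lambda>\<sigma>. flow_deriv (\<tau> * t) b (a + \<sigma> *\<^sub>R c)) has_vector_derivative flow_deriv2 (\<tau> * t) b c a) (at 0)"
    using Z(2)[OF \<tau>, of a] by (simp add: eq[OF \<tau>])
  show "((\<lambda>\<tau>. flow_deriv2 (\<tau> * t) b c a) has_vector_derivative
      vfield'' t (flow_map (\<tau> * t) a) (flow_deriv (\<tau> * t) b a) (flow_deriv (\<tau> * t) c a)
      + vfield' t (flow_map (\<tau> * t) a) (flow_deriv2 (\<tau> * t) b c a)) (at \<tau> within {0..1})"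
    unfolding eq[OF \<tau>] by (rule has_vector_derivative_transform[OF \<tau> eq Z(3)[OF \<tau>]])
  have "flow_deriv2 (\<tau> * t) b c = Z \<tau>"
    using eq[OF \<tau>] by (rule ext)
  then show "continuous_on UNIV (flow_deriv2 (\<tau> * t) b c)"
    using Z(4)[OF \<tau>] by simp
qed

lemma flow_deriv_has_vector_derivative:
  "((\<lambda>\<sigma>. flow_deriv t b (a + \<sigma> *\<^sub>R c)) has_vector_derivative flow_deriv2 t b c a) (at 0)"
  using flow_deriv2_path(2)[of 1 t] by simp

lemma flow_deriv2_continuous_on: "continuous_on UNIV (flow_deriv2 t b c)"
  using flow_deriv2_path(4)[of 1 t] by simp

text \<open>Along the variational equation the symplectic form has derivative zero, since the
  Hessians of \<open>T\<close> and \<open>V\<close> are symmetric; at time 0 it has the stated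
  value.\<close>

lemma symplectic_flow_deriv: "symplectic (flow_deriv t b a) (flow_deriv t c a) = symplectic b c"
proof -
  define g where "g \<tau> = symplectic (flow_deriv (\<tau> * t) b a) (flow_deriv (\<tau> * t) c a)" for \<tau>
  have "(g has_vector_derivative 0) (at \<tau> within {0..1})" if "\<tau> \<in> {0..1}" for \<tau>
  proof -
    note Yb = has_vector_derivative_fst_snd[OF flow_deriv_path(3)[OF that, of t b a]]
    note Yc = has_vector_derivative_fst_snd[OF flow_deriv_path(3)[OF that, of t c a]]
    note inner = bounded_bilinear.has_vector_derivative[OF bounded_bilinear_inner]
    have *: "(g has_vector_derivative
        (fst (flow_deriv (\<tau> * t) b a) \<bullet> snd (vfield' t (flow_map (\<tau> * t) a) (flow_deriv (\<tau> * t) c a))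
          + fst (vfield' t (flow_map (\<tau> * t) a) (flow_deriv (\<tau> * t) b a)) \<bullet> snd (flow_deriv (\<tau> * t) c a))
        - (fst (flow_deriv (\<tau> * t) c a) \<bullet> snd (vfield' t (flow_map (\<tau> * t) a) (flow_deriv (\<tau> * t) b a))
          + fst (vfield' t (flow_map (\<tau> * t) a) (flow_deriv (\<tau> * t) c a)) \<bullet> snd (flow_deriv (\<tau> * t) b a)))
        (at \<tau> within {0..1})"
      unfolding g_def[abs_def] symplectic_def
      by (intro has_vector_derivative_diff inner Yb Yc)
    have sym: "x \<bullet> hess T p y = y \<bullet> hess T p x" "x \<bullet> hess V p y = y \<bullet> hess V p x" for p x y
      using hess_symmetric[OF T, of p x y] hess_symmetric[OF V, of p x y] by (simp_all add: inner_commute)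
    with * show ?thesis
      using sym(1)[of "snd (flow_deriv (\<tau> * t) c a)" _ "snd (flow_deriv (\<tau> * t) b a)"]
        sym(2)[of "fst (flow_deriv (\<tau> * t) c a)" _ "fst (flow_deriv (\<tau> * t) b a)"]
      by (simp add: vfield'_def inner_commute)
  qed
  then obtain k where "\<And>\<tau>. \<tau> \<in> {0..1} \<Longrightarrow> g \<tau> = k"
    using has_vector_derivative_zero_constant[of "{0..1}" g] by (metis convex_real_interval(5))
  from this[of 0] this[of 1] show ?thesis
    by (simp add: g_def flow_deriv_path(1))
qed

text \<open>The action is adjoined to the state as a further coordinate, so the theorem on flow
  derivatives differentiates it too. Then \<open>\<partial>S + Q \<bullet> \<partial>P\<close> is
  constant in time: the \<open>V\<close> terms cancel between the two summands, and so do the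
  \<open>T\<close> terms. Its value at time 0 is \<open>fst a \<bullet> snd b\<close>.\<close>

lemma action_derivative:
  "((\<lambda>\<sigma>. case_prod (S t) (a + \<sigma> *\<^sub>R b)) has_vector_derivative
    fst a \<bullet> snd b - fst (flow_map t a) \<bullet> snd (flow_deriv t b a)) (at 0)"
  and action_continuous_on: "continuous_on UNIV (case_prod (S t))"
proof -
  define rate where "rate z = fst z \<bullet> grad V (fst z) - (T (snd z) + V (fst z))" for z
  define rate' where "rate' z h = fst z \<bullet> hess V (fst z) (fst h) - snd h \<bullet> grad T (snd z)" for z h :: "(real ^ 'n) \<times> (real ^ 'n)"
  define F where "F p = (vfield t (fst p), t *\<^sub>R rate (fst p))" for p :: "((real ^ 'n) \<times> (real ^ 'n)) \<times> real"
  define F' where "F' p h = (vfield' t (fst p) (fst h), t *\<^sub>R rate' (fst p) (fst h))" for p h :: "((real ^ 'n) \<times> (real ^ 'n)) \<times> real"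
  have rate: "(rate has_derivative rate' z) (at z)" for z
  proof -
    \<comment> \<open>The two occurrences of \<open>fst h \<bullet> grad V (fst z)\<close> cancel,
      which leaves \<open>rate'\<close>.\<close>
    have "(rate has_derivative (\<lambda>h. (fst z \<bullet> hess V (fst z) (fst h) + fst h \<bullet> grad V (fst z))
        - (snd h \<bullet> grad T (snd z) + fst h \<bullet> grad V (fst z)))) (at z)"
      unfolding rate_def[abs_def]
      by (intro has_derivative_diff has_derivative_add has_derivative_inner has_derivative_fst
          has_derivative_ident has_derivative_comp_fst has_derivative_comp_snd grad_has_derivative has_derivative_grad T V)
    then show ?thesis
      by (simp add: rate'_def[abs_def])
  qed
  have F: "(F has_derivative F' p) (at p)" for p
    unfolding F_def[abs_def] F'_def[abs_def]
    by (intro has_derivative_Pair has_derivative_scaleR_right has_derivative_comp_fst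
        vfield_has_derivative rate)
  have "continuous_on UNIV (grad T)"
    using grad_has_derivative[OF T] by (rule has_derivative_imp_continuous_on)
  moreover have "continuous_on UNIV (\<lambda>x. hess V x h)" for h
    using hess_has_derivative[OF V] by (rule has_derivative_imp_continuous_on)
  ultimately have "continuous_on UNIV (\<lambda>z. rate' z h)" for h
    unfolding rate'_def
    by (intro continuous_on_diff continuous_on_inner continuous_on_const continuous_on_fst
        continuous_on_id continuous_on_comp_fst continuous_on_comp_snd)
  then have F': "continuous_on UNIV (\<lambda>p. F' p h)" for h
    unfolding F'_def
    by (intro continuous_on_Pair continuous_on_scaleR continuous_on_const continuous_on_comp_fst
        vfield'_continuous_on)
  define X where "X \<tau> a = (flow_map (\<tau> * t) a, case_prod (S (\<tau> * t)) a)" for \<tau> a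
  have X: "solves F (\<lambda>\<tau>. X \<tau> a)" for a
  proof -
    have "((\<lambda>s. case_prod (S s) a) has_vector_derivative rate (flow_map t a)) (at t)" for t
    proof -
      have "((\<lambda>s. S s (fst a) (snd a)) has_real_derivative
          Q t (fst a) (snd a) \<bullet> grad V (Q t (fst a) (snd a))
          - separable_hamiltonian T V (Q t (fst a) (snd a)) (P t (fst a) (snd a))) (at t)"
        using action unfolding dual_action_def grad_hamiltonian by blast
      then show ?thesis
        by (simp add: rate_def flow_map_def case_prod_beta separable_hamiltonian_def
            flip: has_real_derivative_iff_has_vector_derivative)
    qed
    from rescale_time[OF this] show ?thesis
      using flow_map_solves[of t a] by (simp add: solves_def X_def F_def has_vector_derivative_Pair)
  qed
  have X0: "X 0 a = (a, 0)" for a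
    using action by (simp add: X_def flow_map_0 dual_action_def case_prod_beta)
  have X0_cont: "continuous_on UNIV (X 0)"
    unfolding X0[abs_def] by (intro continuous_intros)
  have "continuous_on UNIV (X 1)"
    using flow_continuous_on[of F F' X 1] F F' X X0_cont by simp
  then have "continuous_on UNIV (\<lambda>a. snd (X 1 a))"
    by (intro continuous_on_snd)
  then show "continuous_on UNIV (case_prod (S t))"
    by (simp add: X_def)
  obtain Y where Y: "\<And>a. Y 0 a = (b, 0)"
    "\<And>\<tau> a. \<tau> \<in> {0..1} \<Longrightarrow> ((\<lambda>\<sigma>. X \<tau> (a + \<sigma> *\<^sub>R b)) has_vector_derivative Y \<tau> a) (at 0)"
    "\<And>\<tau> a. \<tau> \<in> {0..1} \<Longrightarrow> ((\<lambda>\<tau>. Y \<tau> a) has_vector_derivative F' (X \<tau> a) (Y \<tau> a)) (at \<tau> within {0..1})"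
    "\<And>\<tau>. \<tau> \<in> {0..1} \<Longrightarrow> continuous_on UNIV (Y \<tau>)"
  proof (rule flow_derivative[of F F' X b "(b, 0)"])
    show "X 0 (a + \<sigma> *\<^sub>R b) = X 0 a + \<sigma> *\<^sub>R (b, 0)" for a \<sigma>
      by (simp add: X0)
  qed (use F F' X X0_cont in auto)
  have fst_Y: "fst (Y \<tau> a) = flow_deriv (\<tau> * t) b a" if "\<tau> \<in> {0..1}" for \<tau>
    using vector_derivative_unique_at[OF has_vector_derivative_fst_snd(1)[OF Y(2)[OF that, of a], unfolded X_def fst_conv]
        flow_deriv_path(2)[OF that]] .
  \<comment> \<open>The conserved quantity \<open>\<partial>S + Q \<bullet> \<partial>P\<close>,
    with \<open>snd (Y \<tau> a)\<close> in the role of \<open>\<partial>S\<close>.\<close>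
  define g where "g \<tau> = snd (Y \<tau> a) + fst (flow_map (\<tau> * t) a) \<bullet> snd (flow_deriv (\<tau> * t) b a)" for \<tau>
  have "(g has_vector_derivative 0) (at \<tau> within {0..1})" if "\<tau> \<in> {0..1}" for \<tau>
  proof -
    have x: "((\<lambda>\<tau>. flow_map (\<tau> * t) a) has_vector_derivative vfield t (flow_map (\<tau> * t) a)) (at \<tau> within {0..1})"
      using flow_map_solves[of t a] that by (simp add: solves_def)
    have "(g has_vector_derivative snd (F' (X \<tau> a) (Y \<tau> a))
        + (fst (flow_map (\<tau> * t) a) \<bullet> snd (vfield' t (flow_map (\<tau> * t) a) (flow_deriv (\<tau> * t) b a))
          + fst (vfield t (flow_map (\<tau> * t) a)) \<bullet> snd (flow_deriv (\<tau> * t) b a))) (at \<tau> within {0..1})"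
      unfolding g_def[abs_def]
      by (intro has_vector_derivative_add bounded_bilinear.has_vector_derivative[OF bounded_bilinear_inner]
          has_vector_derivative_fst_snd Y(3) flow_deriv_path(3) x that)
    then show ?thesis
      by (simp add: F'_def X_def fst_Y[OF that] rate'_def vfield'_def vfield_def algebra_simps inner_commute)
  qed
  then obtain k where "\<And>\<tau>. \<tau> \<in> {0..1} \<Longrightarrow> g \<tau> = k"
    using has_vector_derivative_zero_constant[of "{0..1}" g] by (metis convex_real_interval(5))
  from this[of 0] this[of 1]
  have "snd (Y 1 a) = fst a \<bullet> snd b - fst (flow_map t a) \<bullet> snd (flow_deriv t b a)"
    by (simp add: g_def Y(1) flow_deriv_path(1) flow_map_0)
  then show "((\<lambda>\<sigma>. case_prod (S t) (a + \<sigma> *\<^sub>R b)) has_vector_derivative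
      fst a \<bullet> snd b - fst (flow_map t a) \<bullet> snd (flow_deriv t b a)) (at 0)"
    using has_vector_derivative_fst_snd(2)[OF Y(2)[of 1 a]] by (simp add: X_def)
qed

text \<open>The growth conditions make the constants of the variational equations independent of the
  base point, so Gronwall's inequality gives bounds uniform in \<open>a\<close>; the bound on first
  derivatives controls the forcing of the second equation.\<close>

lemma flow_deriv_bounded:
  assumes "subquadratic T" "subquadratic V"
  shows "bounded (range (flow_deriv t b))" and "bounded (range (flow_deriv2 t b c))"
proof -
  obtain C1 where C1: "C1 > 0" "\<And>x h. norm (hess T x h) \<le> C1 * norm h"
    "\<And>x h k. norm (third_deriv T x h k) \<le> C1 * norm h * norm k"
    using subquadratic_bounds[OF assms(1)] by blast
  obtain C2 where C2: "C2 > 0" "\<And>x h. norm (hess V x h) \<le> C2 * norm h"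
    "\<And>x h k. norm (third_deriv V x h k) \<le> C2 * norm h * norm k"
    using subquadratic_bounds[OF assms(2)] by blast
  define L where "L = \<bar>t\<bar> * C1 + \<bar>t\<bar> * C2"
  have "L \<ge> 0"
    using C1(1) C2(1) by (simp add: L_def)
  have norm_proj: "norm (fst h) \<le> norm h" "norm (snd h) \<le> norm h" for h :: "(real ^ 'n) \<times> (real ^ 'n)"
    using norm_fst_le norm_snd_le by (metis prod.collapse)+
  have vfield'_le: "norm (vfield' t z h) \<le> L * norm h" for z h
  proof -
    have "norm (vfield' t z h) \<le> \<bar>t\<bar> * norm (hess T (snd z) (snd h)) + \<bar>t\<bar> * norm (hess V (fst z) (fst h))"
      using norm_Pair_le[of "t *\<^sub>R hess T (snd z) (snd h)" "- (t *\<^sub>R hess V (fst z) (fst h))"] by (simp add: vfield'_def)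
    also have "\<dots> \<le> \<bar>t\<bar> * (C1 * norm h) + \<bar>t\<bar> * (C2 * norm h)"
      using C1 C2 by (intro add_mono mult_left_mono order_trans[OF C1(2)] order_trans[OF C2(2)] norm_proj) auto
    finally show ?thesis
      by (simp add: L_def algebra_simps)
  qed
  have vfield''_le: "norm (vfield'' t z h k) \<le> L * norm h * norm k" for z h k
  proof -
    have "norm (vfield'' t z h k) \<le> \<bar>t\<bar> * norm (third_deriv T (snd z) (snd h) (snd k)) + \<bar>t\<bar> * norm (third_deriv V (fst z) (fst h) (fst k))"
      using norm_Pair_le[of "t *\<^sub>R third_deriv T (snd z) (snd h) (snd k)" "- (t *\<^sub>R third_deriv V (fst z) (fst h) (fst k))"]
      by (simp add: vfield''_def)
    also have "\<dots> \<le> \<bar>t\<bar> * (C1 * norm h * norm k) + \<bar>t\<bar> * (C2 * norm h * norm k)"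
      using C1 C2 by (intro add_mono mult_left_mono order_trans[OF C1(3)] order_trans[OF C2(3)] mult_mono norm_proj) auto
    finally show ?thesis
      by (simp add: L_def algebra_simps)
  qed
  define G where "G b = norm b * exp (2 * L + 1)" for b :: "(real ^ 'n) \<times> (real ^ 'n)"
  have exp_ge: "1 \<le> exp (2 * L + 1)"
    using \<open>L \<ge> 0\<close> by simp
  have G: "norm (flow_deriv (\<tau> * t) b a) \<le> G b" if "\<tau> \<in> {0..1}" for \<tau> b a
  proof -
    have "(norm (flow_deriv (\<tau> * t) b a))\<^sup>2 + 0\<^sup>2 \<le> ((norm (flow_deriv (0 * t) b a))\<^sup>2 + 0\<^sup>2) * exp ((2 * L + 1) * \<tau>)"
      by (rule gronwall_norm[where D = "\<lambda>\<tau>. flow_deriv (\<tau> * t) b a", OF flow_deriv_path(3)])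
        (use that \<open>L \<ge> 0\<close> vfield'_le in auto)
    also have "\<dots> \<le> (norm b)\<^sup>2 * exp (2 * L + 1)"
      using that \<open>L \<ge> 0\<close> by (auto simp: flow_deriv_path(1) intro!: mult_left_mono mult_left_le)
    \<comment> \<open>The exponential is at least 1; squaring it turns the bound into a perfect
      square.\<close>
    also have "\<dots> \<le> (norm b)\<^sup>2 * (exp (2 * L + 1))\<^sup>2"
      using exp_ge by (intro mult_left_mono self_le_power) auto
    finally have "(norm (flow_deriv (\<tau> * t) b a))\<^sup>2 \<le> (G b)\<^sup>2"
      by (simp add: G_def power_mult_distrib)
    then show ?thesis
      by (rule power2_le_imp_le) (simp add: G_def)
  qed
  show "bounded (range (flow_deriv t b))"
    using G[of 1 b] by (auto simp: bounded_iff)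
  \<comment> \<open>Bounds the forcing of the second variational equation; the initial value is 0,
    so Gronwall's inequality leaves a multiple of \<open>\<eta>\<close>.\<close>
  define \<eta> where "\<eta> = L * G b * G c"
  have "norm (flow_deriv2 t b c a) \<le> \<bar>\<eta>\<bar> * exp (2 * L + 1)" for a
  proof -
    have "(norm (flow_deriv2 (1 * t) b c a))\<^sup>2 + \<eta>\<^sup>2 \<le> ((norm (flow_deriv2 (0 * t) b c a))\<^sup>2 + \<eta>\<^sup>2) * exp ((2 * L + 1) * 1)"
    proof (rule gronwall_norm[where D = "\<lambda>\<tau>. flow_deriv2 (\<tau> * t) b c a", OF flow_deriv2_path(3)])
      fix \<tau> :: real assume \<tau>: "\<tau> \<in> {0..1}"
      have "norm (vfield'' t (flow_map (\<tau> * t) a) (flow_deriv (\<tau> * t) b a) (flow_deriv (\<tau> * t) c a)) \<le> \<eta>"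
        unfolding \<eta>_def
        using \<open>L \<ge> 0\<close> G[OF \<tau>] by (intro order_trans[OF vfield''_le] mult_mono) (auto simp: G_def)
      then show "norm (vfield'' t (flow_map (\<tau> * t) a) (flow_deriv (\<tau> * t) b a) (flow_deriv (\<tau> * t) c a)
          + vfield' t (flow_map (\<tau> * t) a) (flow_deriv2 (\<tau> * t) b c a)) \<le> L * norm (flow_deriv2 (\<tau> * t) b c a) + \<eta>"
        using vfield'_le[of "flow_map (\<tau> * t) a" "flow_deriv2 (\<tau> * t) b c a"]
        by (intro norm_triangle_le) linarith
    qed (use \<open>L \<ge> 0\<close> in auto)
    also have "\<dots> \<le> \<eta>\<^sup>2 * (exp (2 * L + 1))\<^sup>2"
      using self_le_power[OF exp_ge, of 2] by (simp add: flow_deriv2_path(1) mult_left_mono)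
    finally have "(norm (flow_deriv2 t b c a))\<^sup>2 \<le> (\<bar>\<eta>\<bar> * exp (2 * L + 1))\<^sup>2"
      using zero_le_power2[of \<eta>] unfolding power_mult_distrib power2_abs mult_1 by linarith
    then show ?thesis
      by (rule power2_le_imp_le) simp
  qed
  then show "bounded (range (flow_deriv2 t b c))"
    by (auto simp: bounded_iff)
qed

end

section \<open>The matrix \<open>Z\<close> and its inverse\<close>

lemma matrix_inv_mult:
  assumes "invertible A"
  shows "A ** matrix_inv A = mat 1" and "matrix_inv A ** A = mat 1"
  using someI_ex[OF assms[unfolded invertible_def]] by (simp_all add: matrix_inv_def)

text \<open>The bound makes the row action injective, hence \<open>A\<close> invertible. A row
  \<open>w\<close> of the inverse satisfies \<open>w v* A = axis j 1\<close>, so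
  \<open>2 * (norm w)^2 \<le> 1\<close>.\<close>

lemma norm_row_ge_invertible:
  fixes A :: "complex ^ 'n ^ 'n"
  assumes A: "\<And>w. 2 * (norm w)\<^sup>2 \<le> (norm (w v* A))\<^sup>2"
  shows "invertible A" and "norm (matrix_inv A $ j $ k) \<le> 1"
proof -
  \<comment> \<open>The kernel criterion speaks of column vectors, so it is applied to the
    transpose.\<close>
  have "\<exists>B. B ** transpose A = mat 1"
    unfolding matrix_left_invertible_ker
  proof (intro allI impI)
    fix w assume "transpose A *v w = 0"
    then have "w v* A = 0"
      by simp
    then show "w = 0"
      using A[of w] by simp
  qed
  then obtain B where "B ** transpose A = mat 1"
    by blast
  then have "transpose (B ** transpose A) = transpose (mat 1)"
    by simp
  then have "A ** transpose B = mat 1"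
    by (simp add: matrix_transpose_mul)
  then show inv: "invertible A"
    using invertible_right_inverse by blast
  define w where "w = matrix_inv A $ j"
  have "w v* A = axis j 1"
  proof -
    have "(w v* A) $ l = (matrix_inv A ** A) $ j $ l" for l
      by (simp add: vector_matrix_mult_def matrix_matrix_mult_def w_def mult.commute)
    then show ?thesis
      using matrix_inv_mult(2)[OF inv] by (simp add: vec_eq_iff mat_def axis_def)
  qed
  then have "2 * (norm w)\<^sup>2 \<le> 1"
    using A[of w] by simp
  then have "(norm w)\<^sup>2 \<le> 1\<^sup>2"
    by simp
  then have "norm w \<le> 1"
    by (rule power2_le_imp_le) simp
  then show "norm (matrix_inv A $ j $ k) \<le> 1"
    using Finite_Cartesian_Product.norm_nth_le order_trans unfolding w_def by blast
qed

text \<open>The resolvent identity \<open>A^-1 - B^-1 = - A^-1 (A - B) B^-1\<close>, entry by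
  entry.\<close>

lemma matrix_inv_diff_nth:
  fixes A B :: "'a::field ^ 'n ^ 'n"
  assumes "invertible A" "invertible B"
  shows "matrix_inv A $ j $ k - matrix_inv B $ j $ k
    = - (\<Sum>l\<in>UNIV. \<Sum>m\<in>UNIV. matrix_inv A $ j $ l * (A $ l $ m - B $ l $ m) * matrix_inv B $ m $ k)"
proof -
  have "(matrix_inv A ** (A - B)) ** matrix_inv B
      = (matrix_inv A ** A) ** matrix_inv B - matrix_inv A ** (B ** matrix_inv B)"
    unfolding matrix_mul_assoc
    by (simp add: vec_eq_iff matrix_matrix_mult_def algebra_simps sum_subtractf)
  then have "(matrix_inv A ** (A - B)) ** matrix_inv B = matrix_inv B - matrix_inv A"
    by (simp add: matrix_inv_mult assms)
  then have "matrix_inv B $ j $ k - matrix_inv A $ j $ k = ((matrix_inv A ** (A - B)) ** matrix_inv B) $ j $ k"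
    by simp
  also have "\<dots> = (\<Sum>m\<in>UNIV. \<Sum>l\<in>UNIV. matrix_inv A $ j $ l * (A $ l $ m - B $ l $ m) * matrix_inv B $ m $ k)"
    by (simp add: matrix_matrix_mult_def sum_distrib_right)
  also have "\<dots> = (\<Sum>l\<in>UNIV. \<Sum>m\<in>UNIV. matrix_inv A $ j $ l * (A $ l $ m - B $ l $ m) * matrix_inv B $ m $ k)"
    by (rule sum.swap)
  finally show ?thesis
    by (simp add: algebra_simps)
qed

text \<open>With entries of the inverses bounded by 1, the resolvent identity bounds the change of
  the inverse by the summed changes of the entries; determinants are avoided.\<close>

lemma matrix_inv_tendsto:
  fixes A :: "'b \<Rightarrow> complex ^ 'n ^ 'n"
  assumes inv: "\<And>x. invertible (A x)" "invertible A0"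
    and bound: "\<And>x j k. norm (matrix_inv (A x) $ j $ k) \<le> 1" "\<And>j k. norm (matrix_inv A0 $ j $ k) \<le> 1"
    and lim: "\<And>l m. ((\<lambda>x. A x $ l $ m) \<longlongrightarrow> A0 $ l $ m) F"
  shows "((\<lambda>x. matrix_inv (A x) $ j $ k) \<longlongrightarrow> matrix_inv A0 $ j $ k) F"
proof -
  have "((\<lambda>x. matrix_inv (A x) $ j $ k - matrix_inv A0 $ j $ k) \<longlongrightarrow> 0) F"
  proof (rule Lim_null_comparison)
    show "\<forall>\<^sub>F x in F. norm (matrix_inv (A x) $ j $ k - matrix_inv A0 $ j $ k)
        \<le> (\<Sum>l\<in>UNIV. \<Sum>m\<in>UNIV. norm (A x $ l $ m - A0 $ l $ m))"
    proof (intro always_eventually allI)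
      fix x
      have "norm (matrix_inv (A x) $ j $ l * (A x $ l $ m - A0 $ l $ m) * matrix_inv A0 $ m $ k)
          \<le> norm (A x $ l $ m - A0 $ l $ m)" for l m
      proof -
        have "norm (matrix_inv (A x) $ j $ l) * norm (A x $ l $ m - A0 $ l $ m) * norm (matrix_inv A0 $ m $ k)
            \<le> 1 * norm (A x $ l $ m - A0 $ l $ m) * 1"
          by (intro mult_mono bound) auto
        then show ?thesis
          by (simp add: norm_mult)
      qed
      then show "norm (matrix_inv (A x) $ j $ k - matrix_inv A0 $ j $ k)
          \<le> (\<Sum>l\<in>UNIV. \<Sum>m\<in>UNIV. norm (A x $ l $ m - A0 $ l $ m))"
        unfolding matrix_inv_diff_nth[OF inv] norm_minus_cancel
        by (intro sum_norm_le)
    qed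
    have "((\<lambda>x. \<Sum>l\<in>UNIV. \<Sum>m\<in>UNIV. norm (A x $ l $ m - A0 $ l $ m)) \<longlongrightarrow>
        (\<Sum>l\<in>UNIV. \<Sum>m\<in>UNIV. norm (A0 $ l $ m - A0 $ l $ m))) F"
      by (intro tendsto_intros lim)
    then show "((\<lambda>x. \<Sum>l\<in>UNIV. \<Sum>m\<in>UNIV. norm (A x $ l $ m - A0 $ l $ m)) \<longlongrightarrow> 0) F"
      by simp
  qed
  then show ?thesis
    by (rule LIM_zero_cancel)
qed

text \<open>The resolvent identity divided by \<open>s\<close>: one inverse stays fixed, the other
  converges by the previous lemma.\<close>

lemma matrix_inv_has_vector_derivative:
  fixes A :: "real \<Rightarrow> complex ^ 'n ^ 'n"
  assumes inv: "\<And>s. invertible (A s)"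
    and bound: "\<And>s j k. norm (matrix_inv (A s) $ j $ k) \<le> 1"
    and deriv: "\<And>l m. ((\<lambda>s. A s $ l $ m) has_vector_derivative A' $ l $ m) (at 0)"
  shows "((\<lambda>s. matrix_inv (A s) $ j $ k) has_vector_derivative
    - (\<Sum>l\<in>UNIV. \<Sum>m\<in>UNIV. matrix_inv (A 0) $ j $ l * A' $ l $ m * matrix_inv (A 0) $ m $ k)) (at 0)"
proof -
  have lim: "((\<lambda>s. matrix_inv (A s) $ j $ l) \<longlongrightarrow> matrix_inv (A 0) $ j $ l) (at 0)" for l
  proof (rule matrix_inv_tendsto[OF inv inv bound bound])
    show "((\<lambda>s. A s $ l $ m) \<longlongrightarrow> A 0 $ l $ m) (at 0)" for l m
      using has_vector_derivative_continuous[OF deriv] by (simp add: continuous_within)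
  qed
  have quot: "((\<lambda>s. (1 / s) *\<^sub>R (A s $ l $ m - A 0 $ l $ m)) \<longlongrightarrow> A' $ l $ m) (at 0)" for l m
    using deriv by (simp add: has_vector_derivative_at_0)
  have "((\<lambda>s. - (\<Sum>l\<in>UNIV. \<Sum>m\<in>UNIV. matrix_inv (A s) $ j $ l
        * ((1 / s) *\<^sub>R (A s $ l $ m - A 0 $ l $ m)) * matrix_inv (A 0) $ m $ k))
      \<longlongrightarrow> - (\<Sum>l\<in>UNIV. \<Sum>m\<in>UNIV. matrix_inv (A 0) $ j $ l * A' $ l $ m * matrix_inv (A 0) $ m $ k)) (at 0)"
    by (intro tendsto_intros lim quot)
  then show ?thesis
    unfolding has_vector_derivative_at_0 matrix_inv_diff_nth[OF inv inv]
    by (simp add: scaleR_sum_right)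
qed

definition complexify :: "(real ^ 'n) \<times> (real ^ 'n) \<Rightarrow> complex ^ 'n" where
  "complexify u = (\<chi> k. of_real (fst u $ k) + \<i> * of_real (snd u $ k))"

lemma bounded_linear_complexify_nth: "bounded_linear (\<lambda>u. complexify u $ k)"
  unfolding linear_conv_bounded_linear[symmetric]
  by (rule linearI) (simp_all add: complexify_def complex_eq_iff algebra_simps)

lemma bilinear_symplectic: "bilinear symplectic"
  unfolding bilinear_def symplectic_def
  by (auto intro!: linearI simp: algebra_simps inner_commute)

lemma Basis_prod_vec_cases:
  fixes b :: "(real ^ 'n) \<times> (real ^ 'n)"
  assumes "b \<in> Basis"
  obtains j where "b = (axis j 1, 0)" | j where "b = (0, axis j 1)"
  using assms by (auto simp: Basis_prod_def Basis_vec_def)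

text \<open>Under the identification of phase space with complex space, the real inner product of
  \<open>u\<close> with \<open>\<i>\<close> times \<open>w\<close> is
  \<open>- symplectic u w\<close>; this is the cross term of the square.\<close>

lemma norm_complexify_pair:
  "(norm (\<chi> k. complexify u $ k + \<i> * complexify w $ k))\<^sup>2 = (norm u)\<^sup>2 + (norm w)\<^sup>2 - 2 * symplectic u w"
proof -
  have "(norm (\<chi> k. complexify u $ k + \<i> * complexify w $ k))\<^sup>2
      = (\<Sum>k\<in>UNIV. (fst u $ k - snd w $ k)\<^sup>2 + (snd u $ k + fst w $ k)\<^sup>2)"
    by (simp add: norm_vec_def L2_set_def sum_nonneg cmod_power2 complexify_def)
  also have "\<dots> = (norm u)\<^sup>2 + (norm w)\<^sup>2 - 2 * symplectic u w"
    unfolding symplectic_def power2_norm_eq_inner inner_prod_def inner_vec_def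
    by (simp add: power2_eq_square algebra_simps sum.distrib sum_subtractf sum_distrib_left)
  finally show ?thesis .
qed

context separable_flow
begin

lemma complexify_flow_has_vector_derivative:
  "((\<lambda>\<sigma>. complexify (flow_map t (a + \<sigma> *\<^sub>R b)) $ k) has_vector_derivative
    complexify (flow_deriv t b a) $ k) (at 0)"
  by (rule bounded_linear.has_vector_derivative[OF bounded_linear_complexify_nth flow_map_has_vector_derivative])

lemma Zmat_nth: "Zmat Q P t (fst a) (snd a) $ j $ k =
    complexify (flow_deriv t (axis j 1, 0) a) $ k - \<i> * complexify (flow_deriv t (0, axis j 1) a) $ k"
proof -
  have "partial b (\<lambda>(q', p'). of_real (Q t q' p' $ k) + \<i> * of_real (P t q' p' $ k)) (fst a, snd a)
      = complexify (flow_deriv t b a) $ k" for b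
  proof (rule partialI)
    have eq: "(\<lambda>(q', p'). of_real (Q t q' p' $ k) + \<i> * of_real (P t q' p' $ k)) = (\<lambda>a. complexify (flow_map t a) $ k)"
      by (auto simp: fun_eq_iff complexify_def flow_map_def)
    show "((\<lambda>s. (\<lambda>(q', p'). of_real (Q t q' p' $ k) + \<i> * of_real (P t q' p' $ k)) ((fst a, snd a) + s *\<^sub>R b))
        has_vector_derivative complexify (flow_deriv t b a) $ k) (at 0)"
      unfolding eq using complexify_flow_has_vector_derivative by simp
  qed
  then show ?thesis
    by (simp add: Zmat_def dz_def)
qed

lemma norm_row_Zmat: "2 * (norm w)\<^sup>2 \<le> (norm (w v* Zmat Q P t (fst a) (snd a)))\<^sup>2"
proof -
  txt \<open>\<open>L\<close> preserves the symplectic form; with \<open>w = \<alpha> + \<i> \<beta>\<close>, the row \<open>w Z\<close> combines the images of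
    \<open>(\<alpha>, \<beta>)\<close> and \<open>(\<beta>, -\<alpha>)\<close>, whose symplectic product is \<open>- |w|\<^sup>2\<close>.\<close>
  define L where "L u = (\<Sum>j\<in>UNIV. (fst u $ j) *\<^sub>R flow_deriv t (axis j 1, 0) a
    + (snd u $ j) *\<^sub>R flow_deriv t (0, axis j 1) a)" for u
  have "linear L"
    unfolding L_def by (rule linearI) (simp_all add: algebra_simps sum.distrib scaleR_sum_right)
  have L_axis: "L (axis j 1, 0) = flow_deriv t (axis j 1, 0) a" "L (0, axis j 1) = flow_deriv t (0, axis j 1) a" for j
    by (simp_all add: L_def axis_def if_distrib[of "\<lambda>x. x *\<^sub>R _"] cong: if_cong)
  \<comment> \<open>\<open>L\<close> extends \<open>flow_deriv\<close> linearly from the coordinate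
    directions, so preservation of the form need only be checked on pairs of basis vectors.\<close>
  have eq: "(\<lambda>u w. symplectic (L u) (L w)) = symplectic"
  proof (rule bilinear_eq_stdbasis)
    show "bilinear (\<lambda>u w. symplectic (L u) (L w))"
      using bilinear_symplectic linear_compose[OF \<open>linear L\<close>] unfolding bilinear_def o_def by blast
    fix b c :: "(real ^ 'n) \<times> (real ^ 'n)" assume "b \<in> Basis" "c \<in> Basis"
    then have "L b = flow_deriv t b a" "L c = flow_deriv t c a"
      using L_axis by (auto elim!: Basis_prod_vec_cases)
    then show "symplectic (L b) (L c) = symplectic b c"
      by (simp add: symplectic_flow_deriv)
  qed (rule bilinear_symplectic)
  have L_symplectic: "symplectic (L u) (L w) = symplectic u w" for u w
    using fun_cong[OF fun_cong[OF eq, of u], of w] .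
  define \<alpha> \<beta> where "\<alpha> = (\<chi> j. Re (w $ j))" and "\<beta> = (\<chi> j. Im (w $ j))"
  have norm_w: "(norm w)\<^sup>2 = \<alpha> \<bullet> \<alpha> + \<beta> \<bullet> \<beta>"
    by (simp add: norm_vec_def L2_set_def sum_nonneg cmod_power2 \<alpha>_def \<beta>_def inner_vec_def sum.distrib
        flip: power2_eq_square)
  have "w v* Zmat Q P t (fst a) (snd a) = (\<chi> k. complexify (L (\<alpha>, \<beta>)) $ k + \<i> * complexify (L (\<beta>, - \<alpha>)) $ k)"
  proof -
    have "(w v* Zmat Q P t (fst a) (snd a)) $ k = complexify (L (\<alpha>, \<beta>)) $ k + \<i> * complexify (L (\<beta>, - \<alpha>)) $ k" for k
    proof -
      have L: "complexify (L u) $ k = (\<Sum>j\<in>UNIV. (fst u $ j) *\<^sub>R complexify (flow_deriv t (axis j 1, 0) a) $ k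
          + (snd u $ j) *\<^sub>R complexify (flow_deriv t (0, axis j 1) a) $ k)" for u
        unfolding L_def
        by (simp add: linear_sum[OF bounded_linear.linear[OF bounded_linear_complexify_nth]]
            linear_add[OF bounded_linear.linear[OF bounded_linear_complexify_nth]]
            linear_cmul[OF bounded_linear.linear[OF bounded_linear_complexify_nth]])
      have split: "w $ j * (x - \<i> * y) = ((\<alpha> $ j) *\<^sub>R x + (\<beta> $ j) *\<^sub>R y) + \<i> * ((\<beta> $ j) *\<^sub>R x + (- \<alpha> $ j) *\<^sub>R y)" for j x y
        by (simp add: complex_eq_iff \<alpha>_def \<beta>_def algebra_simps)
      then have "(x - \<i> * y) * w $ j = ((\<alpha> $ j) *\<^sub>R x + (\<beta> $ j) *\<^sub>R y) + \<i> * ((\<beta> $ j) *\<^sub>R x + (- \<alpha> $ j) *\<^sub>R y)" for j x y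
        by (simp only: mult.commute[of _ "w $ j"])
      with split show ?thesis
        unfolding L vector_matrix_mult_def
        by (simp add: Zmat_nth sum_distrib_left flip: sum.distrib)
    qed
    then show ?thesis
      by (simp add: vec_eq_iff)
  qed
  moreover have "symplectic (L (\<alpha>, \<beta>)) (L (\<beta>, - \<alpha>)) = - (norm w)\<^sup>2"
    unfolding L_symplectic by (simp add: symplectic_def norm_w)
  ultimately have "(norm (w v* Zmat Q P t (fst a) (snd a)))\<^sup>2
      = (norm (L (\<alpha>, \<beta>)))\<^sup>2 + (norm (L (\<beta>, - \<alpha>)))\<^sup>2 + 2 * (norm w)\<^sup>2"
    by (simp add: norm_complexify_pair)
  then show ?thesis
    by simp
qed

lemma invertible_Zmat: "invertible (Zmat Q P t q p)"
  using norm_row_ge_invertible(1)[of "Zmat Q P t q p"] norm_row_Zmat[of _ t "(q, p)"] by simp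

lemma norm_Zmat_inv_le: "norm (matrix_inv (Zmat Q P t q p) $ j $ k) \<le> 1"
  using norm_row_ge_invertible(2)[of "Zmat Q P t q p"] norm_row_Zmat[of _ t "(q, p)"] by simp

definition Zinv :: "real \<Rightarrow> 'n \<Rightarrow> 'n \<Rightarrow> (real ^ 'n) \<times> (real ^ 'n) \<Rightarrow> complex" where
  "Zinv t j k a = matrix_inv (Zmat Q P t (fst a) (snd a)) $ j $ k"

definition Zmat_deriv :: "real \<Rightarrow> (real ^ 'n) \<times> (real ^ 'n) \<Rightarrow> 'n \<Rightarrow> 'n \<Rightarrow> (real ^ 'n) \<times> (real ^ 'n) \<Rightarrow> complex" where
  "Zmat_deriv t c j k a = complexify (flow_deriv2 t (axis j 1, 0) c a) $ k
    - \<i> * complexify (flow_deriv2 t (0, axis j 1) c a) $ k"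

text \<open>An entry of \<open>- Z^-1 (\<partial>Z) Z^-1\<close>, the derivative of matrix inversion
  along \<open>c\<close>.\<close>

definition Zinv_deriv :: "real \<Rightarrow> (real ^ 'n) \<times> (real ^ 'n) \<Rightarrow> 'n \<Rightarrow> 'n \<Rightarrow> (real ^ 'n) \<times> (real ^ 'n) \<Rightarrow> complex" where
  "Zinv_deriv t c j k a = - (\<Sum>l\<in>UNIV. \<Sum>m\<in>UNIV. Zinv t j l a * Zmat_deriv t c l m a * Zinv t m k a)"

lemma norm_Zinv_le: "norm (Zinv t j k a) \<le> 1"
  unfolding Zinv_def by (rule norm_Zmat_inv_le)

lemma complexify_continuous_on:
  "continuous_on UNIV g \<Longrightarrow> continuous_on UNIV (\<lambda>a. complexify (g a) $ k)"
  by (rule bounded_linear.continuous_on[OF bounded_linear_complexify_nth])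

lemma Zmat_continuous_on: "continuous_on UNIV (\<lambda>a. Zmat Q P t (fst a) (snd a) $ j $ k)"
  unfolding Zmat_nth by (intro continuous_intros complexify_continuous_on flow_deriv_continuous_on)

lemma Zmat_has_vector_derivative:
  "((\<lambda>\<sigma>. Zmat Q P t (fst (a + \<sigma> *\<^sub>R c)) (snd (a + \<sigma> *\<^sub>R c)) $ j $ k) has_vector_derivative Zmat_deriv t c j k a) (at 0)"
  unfolding Zmat_nth Zmat_deriv_def
  by (intro has_vector_derivative_diff has_vector_derivative_mult_right
      bounded_linear.has_vector_derivative[OF bounded_linear_complexify_nth flow_deriv_has_vector_derivative])

lemma Zinv_continuous_on: "continuous_on UNIV (Zinv t j k)"
proof -
  have "isCont (Zinv t j k) a" for a
    unfolding isCont_def Zinv_def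
  proof (rule matrix_inv_tendsto[OF invertible_Zmat invertible_Zmat norm_Zmat_inv_le norm_Zmat_inv_le])
    fix l m
    have "isCont (\<lambda>a. Zmat Q P t (fst a) (snd a) $ l $ m) a"
      using Zmat_continuous_on continuous_on_eq_continuous_at open_UNIV by blast
    then show "((\<lambda>a. Zmat Q P t (fst a) (snd a) $ l $ m) \<longlongrightarrow> Zmat Q P t (fst a) (snd a) $ l $ m) (at a)"
      by (simp add: isCont_def)
  qed
  then show ?thesis
    by (simp add: continuous_at_imp_continuous_on)
qed

lemma Zmat_deriv_continuous_on: "continuous_on UNIV (Zmat_deriv t c j k)"
  unfolding Zmat_deriv_def[abs_def]
  by (intro continuous_intros complexify_continuous_on flow_deriv2_continuous_on)

lemma Zinv_deriv_continuous_on: "continuous_on UNIV (Zinv_deriv t c j k)"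
  unfolding Zinv_deriv_def[abs_def]
  by (intro continuous_intros Zinv_continuous_on Zmat_deriv_continuous_on)

lemma Zinv_has_vector_derivative:
  "((\<lambda>\<sigma>. Zinv t j k (a + \<sigma> *\<^sub>R c)) has_vector_derivative Zinv_deriv t c j k a) (at 0)"
  using matrix_inv_has_vector_derivative[of "\<lambda>\<sigma>. Zmat Q P t (fst (a + \<sigma> *\<^sub>R c)) (snd (a + \<sigma> *\<^sub>R c))"
      "\<chi> l m. Zmat_deriv t c l m a" j k, OF invertible_Zmat norm_Zmat_inv_le] Zmat_has_vector_derivative
  by (simp add: Zinv_def Zinv_deriv_def)

text \<open>Both factors \<open>Z^-1\<close> have entries bounded by 1, so bounded second
  derivatives of the flow suffice; these come from the growth conditions.\<close>

lemma Zinv_deriv_bounded: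
  assumes "subquadratic T" "subquadratic V"
  shows "bounded (range (Zinv_deriv t c j k))"
proof -
  have "bounded (range (Zmat_deriv t c l m))" for l m
  proof -
    have "bounded (range (\<lambda>a. complexify (flow_deriv2 t b c a) $ m))" for b
      using bounded_linear_image[OF flow_deriv_bounded(2)[OF assms] bounded_linear_complexify_nth]
      by (simp add: image_image)
    then obtain B where B: "\<And>b a. norm (complexify (flow_deriv2 t b c a) $ m) \<le> B b"
      unfolding bounded_iff by (metis rangeI)
    have "norm (Zmat_deriv t c l m a) \<le> B (axis l 1, 0) + B (0, axis l 1)" for a
      unfolding Zmat_deriv_def
      by (rule order_trans[OF norm_triangle_ineq4]) (simp add: norm_mult add_mono B)
    then show ?thesis
      by (auto simp: bounded_iff)
  qed
  then obtain B where B: "\<And>l m a. norm (Zmat_deriv t c l m a) \<le> B l m"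
    unfolding bounded_iff by (metis rangeI)
  have "norm (Zinv_deriv t c j k a) \<le> (\<Sum>l\<in>UNIV. \<Sum>m\<in>UNIV. B l m)" for a
  proof -
    have "norm (Zinv t j l a * Zmat_deriv t c l m a * Zinv t m k a) \<le> B l m" for l m
    proof -
      have "norm (Zinv t j l a) * norm (Zmat_deriv t c l m a) * norm (Zinv t m k a) \<le> 1 * B l m * 1"
        using order_trans[OF norm_ge_zero B] by (intro mult_mono norm_Zinv_le B) auto
      then show ?thesis
        by (simp add: norm_mult)
    qed
    then show ?thesis
      unfolding Zinv_deriv_def norm_minus_cancel by (intro sum_norm_le)
  qed
  then show ?thesis
    by (auto simp: bounded_iff)
qed

end

section \<open>Integration by parts\<close>

text \<open>The integral factors over the coordinates into one-dimensional integrals of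
  \<open>inverse (1 + x^2)\<close>.\<close>

lemma integrable_prod_inverse_square:
  "integrable lborel (\<lambda>x::'a::euclidean_space. \<Prod>b\<in>Basis. inverse (1 + (x \<bullet> b)\<^sup>2))"
proof (rule integrableI_nonneg)
  have "integrable lborel (\<lambda>x::real. inverse (1 + x\<^sup>2))"
    using integrable_inverse_1_plus_square by (simp add: set_integrable_def)
  then have fin: "(\<integral>\<^sup>+x. ennreal (inverse (1 + x\<^sup>2)) \<partial>(lborel::real measure)) < \<infinity>"
    by (simp add: integrable_iff_bounded)
  have "(\<integral>\<^sup>+x. ennreal (\<Prod>b\<in>Basis. inverse (1 + (x \<bullet> b)\<^sup>2)) \<partial>(lborel::'a measure))
      = (\<integral>\<^sup>+x. (\<Prod>b\<in>Basis. ennreal (inverse (1 + (x \<bullet> b)\<^sup>2))) \<partial>(lborel::'a measure))"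
    by (simp add: prod_ennreal)
  also have "\<dots> = (\<Prod>b\<in>(Basis::'a set). \<integral>\<^sup>+x. ennreal (inverse (1 + x\<^sup>2)) \<partial>lborel)"
    by (rule nn_integral_lborel_prod) auto
  also have "\<dots> < \<infinity>"
    using fin by (simp add: power_less_top_ennreal)
  finally show "(\<integral>\<^sup>+x. ennreal (\<Prod>b\<in>Basis. inverse (1 + (x \<bullet> b)\<^sup>2)) \<partial>(lborel::'a measure)) < \<infinity>" .
qed (auto intro!: AE_I2 prod_nonneg)

text \<open>The product of the factors \<open>1 + (x \<bullet> b)^2\<close> is at most
  \<open>2^d * (1 + norm x ^ (2 * d))\<close>, so decay with exponents 0 and \<open>2 * d\<close>
  dominates \<open>f\<close> by the integrable product above.\<close>

lemma integrable_rapidly_decreasing: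
  fixes f :: "'a::euclidean_space \<Rightarrow> 'b::{banach, second_countable_topology}"
  assumes cont: "continuous_on UNIV f" and decay: "\<And>N. bounded (range (\<lambda>x. norm x ^ N *\<^sub>R f x))"
  shows "integrable lborel f"
proof -
  define d where "d = DIM('a)"
  obtain B0 where B0: "\<And>x. norm (f x) \<le> B0"
    using decay[of 0] by (auto simp: bounded_iff)
  obtain B where B: "\<And>x. norm x ^ (2 * d) * norm (f x) \<le> B"
    using decay[of "2 * d"] by (auto simp: bounded_iff)
  have bound: "norm (f x) \<le> norm (2 ^ d * (B0 + B) * (\<Prod>b\<in>Basis. inverse (1 + (x \<bullet> b)\<^sup>2)))" for x
  proof -
    have "(\<Prod>b\<in>Basis. 1 + (x \<bullet> b)\<^sup>2) \<le> (\<Prod>b\<in>(Basis::'a set). 1 + (norm x)\<^sup>2)"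
      by (intro prod_mono) (auto simp: Basis_le_norm intro: abs_le_square_iff[THEN iffD1])
    also have "\<dots> = (1 + (norm x)\<^sup>2) ^ d"
      by (simp add: d_def)
    also have "\<dots> \<le> (2 * max 1 ((norm x)\<^sup>2)) ^ d"
      by (intro power_mono) auto
    also have "\<dots> \<le> 2 ^ d * (1 + norm x ^ (2 * d))"
      by (simp add: power_mult_distrib max_def power_mult)
    finally have "(\<Prod>b\<in>Basis. 1 + (x \<bullet> b)\<^sup>2) * norm (f x) \<le> 2 ^ d * (1 + norm x ^ (2 * d)) * norm (f x)"
      by (rule mult_right_mono) simp
    also have "\<dots> = 2 ^ d * (norm (f x) + norm x ^ (2 * d) * norm (f x))"
      by (simp add: algebra_simps)
    also have "\<dots> \<le> 2 ^ d * (B0 + B)"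
      using B0[of x] B[of x] by (intro mult_left_mono add_mono) auto
    finally have "norm (f x) \<le> 2 ^ d * (B0 + B) * inverse (\<Prod>b\<in>Basis. 1 + (x \<bullet> b)\<^sup>2)"
      by (simp add: field_simps prod_pos add_pos_nonneg)
    also have "inverse (\<Prod>b\<in>Basis. 1 + (x \<bullet> b)\<^sup>2) = (\<Prod>b\<in>Basis. inverse (1 + (x \<bullet> b)\<^sup>2))"
      by (simp flip: prod_inversef add: o_def)
    finally show ?thesis
      by (auto intro: order_trans[OF _ abs_ge_self])
  qed
  show ?thesis
    by (rule Bochner_Integration.integrable_bound[OF integrable_mult_right[OF integrable_prod_inverse_square]])
      (use cont bound in \<open>auto simp: borel_measurable_continuous_onI\<close>)
qed

section \<open>Vanishing integrals of derivatives and divergences\<close>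

lemma integral_translate_lborel:
  fixes f :: "'a::euclidean_space \<Rightarrow> 'b::{banach, second_countable_topology}"
  assumes "f \<in> borel_measurable borel"
  shows "(\<integral>x. f (x + c) \<partial>lborel) = (\<integral>x. f x \<partial>lborel)"
proof -
  have "(\<integral>x. f x \<partial>lborel) = (\<integral>x. f x \<partial>(distr lborel borel ((+) c)))"
    by (simp add: lborel_distr_plus)
  also have "\<dots> = (\<integral>x. f (c + x) \<partial>lborel)"
    using assms by (intro integral_distr) auto
  finally show ?thesis
    by (simp add: add.commute)
qed

lemma integrable_continuous_bounded_support:
  fixes f :: "'a::euclidean_space \<Rightarrow> 'b::{banach, second_countable_topology}"
  assumes "continuous_on UNIV f" and "\<And>x. norm x > R \<Longrightarrow> f x = 0"
  shows "integrable lborel f"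
proof -
  have "integrable lborel (\<lambda>x. indicator (cball 0 R) x *\<^sub>R f x)"
    by (rule borel_integrable_compact) (use assms(1) continuous_on_subset in auto)
  also have "(\<lambda>x. indicator (cball 0 R) x *\<^sub>R f x) = f"
    using assms(2) by (auto simp: indicator_def fun_eq_iff)
  finally show ?thesis .
qed

lemma has_vector_derivative_line_shift:
  fixes G :: "'a::real_normed_vector \<Rightarrow> 'b::real_normed_vector"
  assumes "\<And>x. ((\<lambda>s. G (x + s *\<^sub>R b)) has_vector_derivative g x) (at 0)"
  shows "((\<lambda>s. G (x + s *\<^sub>R b)) has_vector_derivative g (x + s *\<^sub>R b)) (at s)"
proof -
  have "((\<lambda>r. r - s) has_vector_derivative 1) (at s)"
    by (auto intro!: derivative_eq_intros)
  from vector_diff_chain_at[OF this, of "\<lambda>r. G (x + s *\<^sub>R b + r *\<^sub>R b)"] assms[of "x + s *\<^sub>R b"]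
  have "((\<lambda>r. G (x + s *\<^sub>R b + (r - s) *\<^sub>R b)) has_vector_derivative g (x + s *\<^sub>R b)) (at s)"
    by (simp add: o_def)
  moreover have "x + s *\<^sub>R b + (r - s) *\<^sub>R b = x + r *\<^sub>R b" for r
    by (simp add: scaleR_diff_left)
  ultimately show ?thesis
    by simp
qed

text \<open>By translation invariance the difference quotients of \<open>G\<close> have integral zero.\<close>

lemma integral_directional_derivative_bounded_support:
  fixes G g :: "'a::euclidean_space \<Rightarrow> 'b::{banach, second_countable_topology}"
  assumes G: "continuous_on UNIV G" and g: "continuous_on UNIV g"
    and deriv: "\<And>x. ((\<lambda>s. G (x + s *\<^sub>R b)) has_vector_derivative g x) (at 0)"
    and supp: "\<And>x. norm x > R \<Longrightarrow> G x = 0"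
  shows "integrable lborel g" and "(\<integral>x. g x \<partial>lborel) = 0"
proof -
  \<comment> \<open>Beyond radius \<open>R\<close> the function vanishes near the point, hence so
    does its derivative along the line.\<close>
  have supp_g: "g x = 0" if "norm x > R" for x
  proof -
    have "\<forall>\<^sub>F s in nhds 0. norm (x + s *\<^sub>R b) > R"
      by (rule order_tendstoD(1)[of _ "norm x"]) (auto intro!: tendsto_eq_intros filterlim_ident that)
    then have "\<forall>\<^sub>F s in nhds 0. G (x + s *\<^sub>R b) = 0"
      by eventually_elim (rule supp)
    then have "((\<lambda>s. G (x + s *\<^sub>R b)) has_vector_derivative 0) (at 0) \<longleftrightarrow> ((\<lambda>s::real. 0::'b) has_vector_derivative 0) (at 0)"
      using supp[OF that] by (intro has_vector_derivative_cong_ev) auto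
    then show ?thesis
      using vector_derivative_unique_at[OF deriv] by auto
  qed
  show int_g: "integrable lborel g"
    by (rule integrable_continuous_bounded_support[OF g supp_g])
  have int_G: "integrable lborel G"
    by (rule integrable_continuous_bounded_support[OF G supp])
  have "bounded (g ` cball 0 R)"
    using g by (intro compact_imp_bounded compact_continuous_image) (auto intro: continuous_on_subset)
  then obtain M where "M > 0" and M': "\<And>x. norm x \<le> R \<Longrightarrow> norm (g x) \<le> M"
    by (auto simp: bounded_pos)
  have M: "norm (g x) \<le> M" for x
    using M'[of x] supp_g[of x] \<open>M > 0\<close> by (cases "norm x \<le> R") auto
  define r where "r n = 1 / real (Suc n)" for n
  have r: "r n > 0" "r n \<le> 1" for n
    by (auto simp: r_def)
  have "r \<longlonglongrightarrow> 0"
    using LIMSEQ_inverse_real_of_nat by (simp add: r_def[abs_def] inverse_eq_divide)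
  define D where "D n x = (1 / r n) *\<^sub>R (G (x + r n *\<^sub>R b) - G x)" for n x
  have [measurable]: "G \<in> borel_measurable borel" "g \<in> borel_measurable borel"
    using G g by (auto intro: borel_measurable_continuous_onI)
  have "(\<lambda>n. \<integral>x. D n x \<partial>lborel) \<longlonglongrightarrow> (\<integral>x. g x \<partial>lborel)"
  proof (rule integral_dominated_convergence)
    \<comment> \<open>Shifts have length at most \<open>norm b\<close> because
      \<open>r n \<le> 1\<close>, so outside this ball both the point and its shift lie where
      \<open>G\<close> vanishes. The absolute value covers a negative \<open>R\<close>.\<close>
    show "integrable lborel (\<lambda>x::'a. indicator (cball 0 (\<bar>R\<bar> + norm b)) x *\<^sub>R M)"
      by (intro borel_integrable_compact) auto
    show "AE x in lborel. (\<lambda>n. D n x) \<longlonglongrightarrow> g x"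
    proof (rule AE_I2)
      fix x
      have "((\<lambda>s. (1 / s) *\<^sub>R (G (x + s *\<^sub>R b) - G (x + 0 *\<^sub>R b))) \<longlongrightarrow> g x) (at 0)"
        using deriv[of x] by (subst (asm) has_vector_derivative_at_0)
      moreover have "filterlim r (at 0) sequentially"
        using \<open>r \<longlonglongrightarrow> 0\<close> r(1) by (auto simp: filterlim_at less_imp_neq[symmetric] intro!: always_eventually)
      ultimately show "(\<lambda>n. D n x) \<longlonglongrightarrow> g x"
        unfolding D_def by (auto dest: filterlim_compose)
    qed
    show "AE x in lborel. norm (D n x) \<le> indicator (cball 0 (\<bar>R\<bar> + norm b)) x *\<^sub>R M" for n
    proof (rule AE_I2)
      fix x
      show "norm (D n x) \<le> indicator (cball 0 (\<bar>R\<bar> + norm b)) x *\<^sub>R M"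
      proof (cases "norm x \<le> \<bar>R\<bar> + norm b")
        case True
        have "norm (G (x + r n *\<^sub>R b) - G (x + 0 *\<^sub>R b)) \<le> M * norm (r n - 0)"
        proof (rule differentiable_bound[of UNIV "\<lambda>s. G (x + s *\<^sub>R b)" "\<lambda>s h. h *\<^sub>R g (x + s *\<^sub>R b)" M])
          show "((\<lambda>s. G (x + s *\<^sub>R b)) has_derivative (\<lambda>h. h *\<^sub>R g (x + s *\<^sub>R b))) (at s within UNIV)" for s
            using has_vector_derivative_line_shift[of G b g, OF deriv] by (simp add: has_vector_derivative_def)
          show "onorm (\<lambda>h. h *\<^sub>R g (x + s *\<^sub>R b)) \<le> M" for s
            by (intro onorm_le) (simp add: mult.commute[of M] M mult_left_mono)
        qed auto
        then show ?thesis
          using True r(1)[of n] by (simp add: D_def divide_simps)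
      next
        case False
        have "norm x \<le> norm (x + r n *\<^sub>R b) + norm (r n *\<^sub>R b)"
          using norm_triangle_ineq4[of "x + r n *\<^sub>R b" "r n *\<^sub>R b"] by simp
        moreover have "norm (r n *\<^sub>R b) \<le> norm b"
          using r[of n] by (simp add: mult_left_le_one_le)
        moreover have "norm b \<ge> 0"
          by simp
        ultimately have "norm (x + r n *\<^sub>R b) > R" "norm x > R"
          using False by linarith+
        then show ?thesis
          using False by (simp add: D_def supp)
      qed
    qed
  qed (auto simp: D_def)
  moreover have "(\<integral>x. D n x \<partial>lborel) = 0" for n
  proof -
    have "integrable lborel (\<lambda>x. G (x + r n *\<^sub>R b))"
    proof (rule integrable_continuous_bounded_support[of _ "R + norm (r n *\<^sub>R b)"])
      show "continuous_on UNIV (\<lambda>x. G (x + r n *\<^sub>R b))"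
        by (rule continuous_on_compose2[OF G]) (auto intro!: continuous_intros)
      show "G (x + r n *\<^sub>R b) = 0" if "norm x > R + norm (r n *\<^sub>R b)" for x
        using that norm_triangle_ineq4[of "x + r n *\<^sub>R b" "r n *\<^sub>R b"] by (intro supp) simp
    qed
    then show ?thesis
      using int_G integral_translate_lborel[of G "r n *\<^sub>R b"] by (simp add: D_def)
  qed
  ultimately show "(\<integral>x. g x \<partial>lborel) = 0"
    by (simp add: LIMSEQ_const_iff)
qed

text \<open>Only the whole divergence is assumed integrable, so the cutoffs must be applied to the sum.\<close>

lemma integral_divergence_eq_0:
  fixes G g :: "'i \<Rightarrow> 'a::euclidean_space \<Rightarrow> 'b::{banach, second_countable_topology}"
  assumes "finite I"
    and G: "\<And>i. i \<in> I \<Longrightarrow> continuous_on UNIV (G i)" "\<And>i. i \<in> I \<Longrightarrow> integrable lborel (G i)"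
    and g: "\<And>i. i \<in> I \<Longrightarrow> continuous_on UNIV (g i)"
    and deriv: "\<And>i x. i \<in> I \<Longrightarrow> ((\<lambda>s. G i (x + s *\<^sub>R b i)) has_vector_derivative g i x) (at 0)"
    and int: "integrable lborel (\<lambda>x. \<Sum>i\<in>I. g i x)"
  shows "(\<integral>x. (\<Sum>i\<in>I. g i x) \<partial>lborel) = 0"
proof -
  \<comment> \<open>A truncated paraboloid supported in the ball of radius \<open>n + 1\<close> and
    tending to 1. Squaring its positive part makes the cutoff \<open>\<phi>\<close> continuously
    differentiable across the edge, with the explicit derivative \<open>\<phi>'\<close>.\<close>
  define u where "u n x = max 0 (1 - (norm x)\<^sup>2 / (real (Suc n))\<^sup>2)" for n and x :: 'a
  define \<phi> where "\<phi> n x = (u n x)\<^sup>2" for n x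
  define \<phi>' where "\<phi>' n i x = - 4 * u n x * (x \<bullet> b i) / (real (Suc n))\<^sup>2" for n i x
  have u: "0 \<le> u n x" "u n x \<le> 1" for n x
    by (auto simp: u_def)
  have u_0: "u n x = 0" if "norm x > real (Suc n)" for n x
  proof -
    have "(real (Suc n))\<^sup>2 \<le> (norm x)\<^sup>2"
      using that by (intro power_mono) auto
    then show ?thesis
      by (simp add: u_def del: of_nat_Suc)
  qed
  have u_cont: "continuous_on UNIV (u n)" for n
    unfolding u_def by (intro continuous_intros) auto
  then have cont: "continuous_on UNIV (\<phi> n)" "continuous_on UNIV (\<phi>' n i)" for n i
    unfolding \<phi>_def[abs_def] \<phi>'_def by (intro continuous_intros; simp)+
  have max_sq: "((\<lambda>y::real. (max 0 y)\<^sup>2) has_real_derivative 2 * max 0 y) (at y)" for y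
  proof (cases "y = 0")
    case True
    have "((\<lambda>h. (max 0 h)\<^sup>2 / h) \<longlongrightarrow> 0) (at (0::real))"
    proof (rule Lim_null_comparison)
      show "\<forall>\<^sub>F h in at (0::real). norm ((max 0 h)\<^sup>2 / h) \<le> \<bar>h\<bar>"
        by (intro always_eventually) (auto simp: max_def power2_eq_square)
    qed (auto intro!: tendsto_eq_intros)
    then show ?thesis
      using True by (simp add: DERIV_def)
  next
    case False
    then consider "y > 0" | "y < 0"
      by linarith
    then show ?thesis
    proof cases
      case 1
      have "((\<lambda>y::real. y\<^sup>2) has_real_derivative 2 * max 0 y) (at y)"
        using 1 by (auto intro!: derivative_eq_intros)
      then show ?thesis
        by (rule has_field_derivative_transform_within_open[of _ _ _ "{0<..}"]) (use 1 in auto)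
    next
      case 2
      have "((\<lambda>y::real. 0) has_real_derivative 2 * max 0 y) (at y)"
        using 2 by auto
      then show ?thesis
        by (rule has_field_derivative_transform_within_open[of _ _ _ "{..<0}"]) (use 2 in auto)
    qed
  qed
  have \<phi>_deriv: "((\<lambda>s. \<phi> n (x + s *\<^sub>R b i)) has_real_derivative \<phi>' n i x) (at 0)" for n x i
  proof -
    have sq: "((\<lambda>s. (x + s *\<^sub>R b i) \<bullet> (x + s *\<^sub>R b i)) has_real_derivative 2 * (x \<bullet> b i)) (at 0)"
      unfolding has_field_derivative_def
      by (auto intro!: derivative_eq_intros simp: inner_commute fun_eq_iff)
    have "((\<lambda>s. 1 - ((x + s *\<^sub>R b i) \<bullet> (x + s *\<^sub>R b i)) / k) has_real_derivative
        - (2 * (x \<bullet> b i)) / k) (at 0)" if "k > 0" for k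
      using that by (auto intro!: derivative_eq_intros sq)
    from this[of "(real (Suc n))\<^sup>2"]
    have "((\<lambda>s. 1 - ((x + s *\<^sub>R b i) \<bullet> (x + s *\<^sub>R b i)) / (real (Suc n))\<^sup>2) has_real_derivative
        - (2 * (x \<bullet> b i)) / (real (Suc n))\<^sup>2) (at 0)"
      by simp
    from DERIV_chain2[OF max_sq this] show ?thesis
      by (simp add: \<phi>_def u_def \<phi>'_def power2_norm_eq_inner mult.assoc del: of_nat_Suc)
  qed
  \<comment> \<open>On the support \<open>norm x \<le> n + 1\<close>, which cancels one of the two
    such factors in the denominator.\<close>
  have \<phi>'_le: "\<bar>\<phi>' n i x\<bar> \<le> 4 * norm (b i) / real (Suc n)" for n i x
  proof (cases "norm x > real (Suc n)")
    case False
    have "\<bar>x \<bullet> b i\<bar> \<le> real (Suc n) * norm (b i)"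
      using False by (intro order_trans[OF Cauchy_Schwarz_ineq2] mult_right_mono) auto
    then have "u n x * \<bar>x \<bullet> b i\<bar> \<le> 1 * (real (Suc n) * norm (b i))"
      using u[of n x] by (intro mult_mono) auto
    then have "4 * (u n x * \<bar>x \<bullet> b i\<bar>) / (real (Suc n))\<^sup>2 \<le> 4 * (real (Suc n) * norm (b i)) / (real (Suc n))\<^sup>2"
      by (intro divide_right_mono) auto
    also have "\<dots> = 4 * norm (b i) / real (Suc n)"
      by (simp add: power2_eq_square del: of_nat_Suc)
    finally show ?thesis
      using u[of n x] by (simp add: \<phi>'_def abs_mult del: of_nat_Suc)
  qed (simp add: \<phi>'_def u_0 del: of_nat_Suc)
  have G_le: "norm (\<phi>' n i x *\<^sub>R G i x) \<le> 4 * norm (b i) / real (Suc n) * norm (G i x)" for n i x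
    unfolding norm_scaleR by (rule mult_right_mono[OF \<phi>'_le]) simp
  \<comment> \<open>The case of bounded support, applied to the product of \<open>\<phi> n\<close>
    and \<open>G i\<close>, moves the derivative onto the cutoff.\<close>
  have parts: "integrable lborel (\<lambda>x. \<phi>' n i x *\<^sub>R G i x)" "integrable lborel (\<lambda>x. \<phi> n x *\<^sub>R g i x)"
    "(\<integral>x. \<phi> n x *\<^sub>R g i x \<partial>lborel) = - (\<integral>x. \<phi>' n i x *\<^sub>R G i x \<partial>lborel)" if i: "i \<in> I" for n i
  proof -
    have d: "((\<lambda>s. \<phi> n (x + s *\<^sub>R b i) *\<^sub>R G i (x + s *\<^sub>R b i)) has_vector_derivative
        \<phi> n x *\<^sub>R g i x + \<phi>' n i x *\<^sub>R G i x) (at 0)" for x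
      using has_vector_derivative_scaleR[OF \<phi>_deriv deriv[OF i], of n x i x] by simp
    have supp: "\<phi> n x *\<^sub>R G i x = 0" if "norm x > real (Suc n)" for x
      using u_0[OF that] by (simp add: \<phi>_def)
    have cont1: "continuous_on UNIV (\<lambda>x. \<phi> n x *\<^sub>R G i x)"
      by (intro continuous_on_scaleR cont G i)
    have cont2: "continuous_on UNIV (\<lambda>x. \<phi> n x *\<^sub>R g i x + \<phi>' n i x *\<^sub>R G i x)"
      by (intro continuous_on_add continuous_on_scaleR cont G g i)
    note zero = integral_directional_derivative_bounded_support[OF cont1 cont2 d supp]
    show 1: "integrable lborel (\<lambda>x. \<phi>' n i x *\<^sub>R G i x)"
    proof (rule Bochner_Integration.integrable_bound[OF integrable_scaleR_right[OF integrable_norm[OF G(2)[OF i]], of "4 * norm (b i) / real (Suc n)"]])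
      show "AE x in lborel. norm (\<phi>' n i x *\<^sub>R G i x) \<le> norm ((4 * norm (b i) / real (Suc n)) *\<^sub>R norm (G i x))"
        by (intro AE_I2 order_trans[OF G_le]) (simp add: abs_mult)
      show "(\<lambda>x. \<phi>' n i x *\<^sub>R G i x) \<in> borel_measurable lborel"
        by (auto intro!: borel_measurable_continuous_onI continuous_on_scaleR cont G i)
    qed
    show 2: "integrable lborel (\<lambda>x. \<phi> n x *\<^sub>R g i x)"
      using Bochner_Integration.integrable_diff[OF zero(1) 1] by simp
    show "(\<integral>x. \<phi> n x *\<^sub>R g i x \<partial>lborel) = - (\<integral>x. \<phi>' n i x *\<^sub>R G i x \<partial>lborel)"
      using zero(2) by (simp add: Bochner_Integration.integral_add[OF 2 1] eq_neg_iff_add_eq_0)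
  qed
  \<comment> \<open>The whole sum is dominated by its own norm because
    \<open>0 \<le> \<phi> n x \<le> 1\<close>.\<close>
  have "(\<lambda>n. \<integral>x. \<phi> n x *\<^sub>R (\<Sum>i\<in>I. g i x) \<partial>lborel) \<longlonglongrightarrow> (\<integral>x. (\<Sum>i\<in>I. g i x) \<partial>lborel)"
  proof (rule integral_dominated_convergence)
    show "integrable lborel (\<lambda>x. norm (\<Sum>i\<in>I. g i x))"
      by (rule integrable_norm[OF int])
    show "AE x in lborel. (\<lambda>n. \<phi> n x *\<^sub>R (\<Sum>i\<in>I. g i x)) \<longlonglongrightarrow> (\<Sum>i\<in>I. g i x)"
    proof (rule AE_I2)
      fix x
      have "(\<lambda>n. (inverse (real (Suc n)))\<^sup>2) \<longlonglongrightarrow> 0"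
        using tendsto_power[OF LIMSEQ_inverse_real_of_nat, of 2] by simp
      then have "(\<lambda>n. \<phi> n x) \<longlonglongrightarrow> (max 0 (1 - (norm x)\<^sup>2 * 0))\<^sup>2"
        unfolding \<phi>_def u_def divide_inverse power_inverse[symmetric]
        by (intro tendsto_intros)
      then have "(\<lambda>n. \<phi> n x *\<^sub>R (\<Sum>i\<in>I. g i x)) \<longlonglongrightarrow> (max 0 (1 - (norm x)\<^sup>2 * 0))\<^sup>2 *\<^sub>R (\<Sum>i\<in>I. g i x)"
        by (intro tendsto_intros)
      then show "(\<lambda>n. \<phi> n x *\<^sub>R (\<Sum>i\<in>I. g i x)) \<longlonglongrightarrow> (\<Sum>i\<in>I. g i x)"
        by simp
    qed
    show "AE x in lborel. norm (\<phi> n x *\<^sub>R (\<Sum>i\<in>I. g i x)) \<le> norm (\<Sum>i\<in>I. g i x)" for n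
      using u by (intro AE_I2) (auto simp: \<phi>_def mult_left_le_one_le power_le_one)
    show "(\<lambda>x. \<phi> n x *\<^sub>R (\<Sum>i\<in>I. g i x)) \<in> borel_measurable lborel" for n
      using cont g by (auto intro!: borel_measurable_continuous_onI continuous_intros)
  qed (use int in auto)
  moreover have "(\<lambda>n. \<integral>x. \<phi> n x *\<^sub>R (\<Sum>i\<in>I. g i x) \<partial>lborel) \<longlonglongrightarrow> 0"
  proof (rule Lim_null_comparison)
    define C where "C = (\<Sum>i\<in>I. 4 * norm (b i) * (\<integral>x. norm (G i x) \<partial>lborel))"
    show "\<forall>\<^sub>F n in sequentially. norm (\<integral>x. \<phi> n x *\<^sub>R (\<Sum>i\<in>I. g i x) \<partial>lborel) \<le> C * inverse (real (Suc n))"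
    proof (intro always_eventually allI)
      fix n
      have "(\<integral>x. \<phi> n x *\<^sub>R (\<Sum>i\<in>I. g i x) \<partial>lborel) = (\<Sum>i\<in>I. \<integral>x. \<phi> n x *\<^sub>R g i x \<partial>lborel)"
        using parts(2) by (simp add: scaleR_sum_right)
      also have "\<dots> = (\<Sum>i\<in>I. - (\<integral>x. \<phi>' n i x *\<^sub>R G i x \<partial>lborel))"
        using parts(3) by simp
      also have "norm \<dots> \<le> (\<Sum>i\<in>I. 4 * norm (b i) * (\<integral>x. norm (G i x) \<partial>lborel) * inverse (real (Suc n)))"
      proof (rule sum_norm_le)
        fix i assume i: "i \<in> I"
        have "norm (\<integral>x. \<phi>' n i x *\<^sub>R G i x \<partial>lborel) \<le> (\<integral>x. (4 * norm (b i) / real (Suc n)) * norm (G i x) \<partial>lborel)"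
          by (intro order_trans[OF integral_norm_bound] integral_mono G_le integrable_norm parts(1)[OF i]
              integrable_mult_right G(2)[OF i])
        then show "norm (- (\<integral>x. \<phi>' n i x *\<^sub>R G i x \<partial>lborel)) \<le> 4 * norm (b i) * (\<integral>x. norm (G i x) \<partial>lborel) * inverse (real (Suc n))"
          by (simp add: field_simps del: of_nat_Suc)
      qed
      also have "\<dots> = C * inverse (real (Suc n))"
        by (simp add: C_def sum_distrib_right)
      finally show "norm (\<integral>x. \<phi> n x *\<^sub>R (\<Sum>i\<in>I. g i x) \<partial>lborel) \<le> C * inverse (real (Suc n))" .
    qed
    show "(\<lambda>n. C * inverse (real (Suc n))) \<longlonglongrightarrow> 0"
      using tendsto_mult_left[OF LIMSEQ_inverse_real_of_nat, of C] by simp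
  qed
  ultimately show ?thesis
    by (rule LIMSEQ_unique)
qed

section \<open>The Fourier integral operator\<close>

lemma integrable_mult_bounded:
  fixes f m :: "'a::euclidean_space \<Rightarrow> complex"
  assumes f: "integrable lborel f" and m: "continuous_on UNIV m" and bound: "\<And>x. norm (m x) \<le> B"
  shows "integrable lborel (\<lambda>x. m x * f x)"
proof (rule Bochner_Integration.integrable_bound[OF integrable_mult_right[OF integrable_norm[OF f], of B]])
  have "m \<in> borel_measurable borel"
    using m by (rule borel_measurable_continuous_onI)
  then show "(\<lambda>x. m x * f x) \<in> borel_measurable lborel"
    using f by simp
  show "AE x in lborel. norm (m x * f x) \<le> norm (B * norm (f x))"
    using bound by (intro AE_I2) (auto simp: norm_mult abs_mult intro!: mult_right_mono order_trans[OF _ abs_ge_self])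
qed

lemma schwartz_bounded:
  assumes "schwartz f"
  obtains B where "\<And>x. norm (f x) \<le> B"
proof -
  have "bounded (range (\<lambda>x. norm x ^ 0 *\<^sub>R partials [] f x))"
    using assms unfolding schwartz_def by (metis empty_set empty_subsetI)
  then show ?thesis
    using that by (auto simp: bounded_iff)
qed

lemma schwartz_continuous_on: "schwartz f \<Longrightarrow> continuous_on UNIV f"
  unfolding schwartz_def using Ck.simps(1) by blast

lemma schwartz_differentiable: "schwartz f \<Longrightarrow> f differentiable (at x)"
  unfolding schwartz_def using Ck.simps(2) by blast

lemma schwartz_partial:
  assumes "schwartz f" "b \<in> Basis"
  shows "schwartz (partial b f)"
  unfolding schwartz_def
proof (intro conjI allI impI)
  show "Ck k (partial b f)" for k
    using assms unfolding schwartz_def by (metis Ck.simps(2))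
  fix bs N assume "set bs \<subseteq> (Basis::'a set)"
  \<comment> \<open>\<open>b\<close> goes to the end of the list because the last entry is
    differentiated first.\<close>
  then have "bounded (range (\<lambda>x. norm x ^ N *\<^sub>R partials (bs @ [b]) f x))"
    using assms unfolding schwartz_def by (metis Un_subset_iff empty_subsetI insert_subset list.set(1,2) set_append)
  moreover have "partials (bs @ [b]) f = partials bs (partial b f)"
    by (induction bs) auto
  ultimately show "bounded (range (\<lambda>x. norm x ^ N *\<^sub>R partials bs (partial b f) x))"
    by simp
qed

lemma schwartz_integrable:
  fixes f :: "'a::euclidean_space \<Rightarrow> 'b::{banach, second_countable_topology}"
  assumes "schwartz f"
  shows "integrable lborel f"
proof (rule integrable_rapidly_decreasing[OF schwartz_continuous_on[OF assms]])
  show "bounded (range (\<lambda>x. norm x ^ N *\<^sub>R f x))" for N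
    using assms unfolding schwartz_def by (metis empty_set empty_subsetI partials.simps(1))
qed

section \<open>The exponential and the field to be differentiated\<close>

locale dual_fio = separable_flow T V Q P S
  for T V :: "real ^ 'n \<Rightarrow> real" and Q P S +
  fixes \<epsilon> t :: real and \<xi> :: "real ^ 'n"
    and v :: "(real ^ 'n) \<times> (real ^ 'n) \<times> (real ^ 'n) \<Rightarrow> complex ^ 'n"
    and \<psi> :: "real ^ 'n \<Rightarrow> complex"
  assumes \<epsilon>: "\<epsilon> > 0" and v: "schwartz v" and \<psi>: "schwartz \<psi>"
begin

definition displacement :: "(real ^ 'n) \<times> (real ^ 'n) \<Rightarrow> real ^ 'n" where
  "displacement a = \<xi> - snd (flow_map t a)"

text \<open>The dual phase at \<open>x = (\<zeta>, (q, p))\<close>, grouped into its real part and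
  \<open>\<i>\<close> times its imaginary part, so that the modulus of the exponential can be read
  off.\<close>

definition phase :: "(real ^ 'n) \<times> (real ^ 'n) \<times> (real ^ 'n) \<Rightarrow> complex" where
  "phase x = of_real (case_prod (S t) (snd x) - displacement (snd x) \<bullet> fst (flow_map t (snd x))
      + (fst x - snd (snd x)) \<bullet> fst (snd x))
    + \<i> / 2 * of_real (displacement (snd x) \<bullet> displacement (snd x) + (fst x - snd (snd x)) \<bullet> (fst x - snd (snd x)))"

definition phase_deriv :: "(real ^ 'n) \<times> (real ^ 'n) \<Rightarrow> (real ^ 'n) \<times> (real ^ 'n) \<times> (real ^ 'n) \<Rightarrow> complex" where
  "phase_deriv c x = of_real ((fst x - snd (snd x)) \<bullet> fst c - displacement (snd x) \<bullet> fst (flow_deriv t c (snd x)))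
    - \<i> * of_real (displacement (snd x) \<bullet> snd (flow_deriv t c (snd x)) + (fst x - snd (snd x)) \<bullet> snd c)"

definition wave :: "(real ^ 'n) \<times> (real ^ 'n) \<times> (real ^ 'n) \<Rightarrow> complex" where
  "wave x = exp (\<i> * phase x / of_real \<epsilon>)"

lemma dual_phase_eq: "dual_phase S Q P t \<xi> (fst x) (fst (snd x)) (snd (snd x)) = phase x"
  by (simp add: dual_phase_def phase_def displacement_def flow_map_def case_prod_beta power2_norm_eq_inner algebra_simps)

lemma displacement_has_vector_derivative:
  "((\<lambda>\<sigma>. displacement (a + \<sigma> *\<^sub>R c)) has_vector_derivative - snd (flow_deriv t c a)) (at 0)"
  unfolding displacement_def
  using has_vector_derivative_diff[OF has_vector_derivative_const[of \<xi>]
      has_vector_derivative_fst_snd(2)[OF flow_map_has_vector_derivative[of t a c]]] by simp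

text \<open>The two terms of the derivative of the action cancel against those in which the
  derivative falls on \<open>P\<close> in \<open>(\<xi> - P) \<bullet> Q\<close> and on
  \<open>p\<close> in \<open>(\<zeta> - p) \<bullet> q\<close>. What survives is linear in
  \<open>\<xi> - P\<close> and \<open>\<zeta> - p\<close>.\<close>

lemma phase_has_vector_derivative:
  "((\<lambda>\<sigma>. phase (x + \<sigma> *\<^sub>R (0, c))) has_vector_derivative phase_deriv c x) (at 0)"
proof -
  obtain \<zeta> a where x: "x = (\<zeta>, a)"
    by (rule prod.exhaust)
  define J where "J = flow_deriv t c a"
  note S' = action_derivative[of t a c]
  note D' = displacement_has_vector_derivative[of a c]
  note Q' = has_vector_derivative_fst_snd(1)[OF flow_map_has_vector_derivative[of t a c]]
  have q': "((\<lambda>\<sigma>. fst (a + \<sigma> *\<^sub>R c)) has_vector_derivative fst c) (at 0)"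
    and p': "((\<lambda>\<sigma>. \<zeta> - snd (a + \<sigma> *\<^sub>R c)) has_vector_derivative - snd c) (at 0)"
    unfolding has_vector_derivative_def by (auto intro!: derivative_eq_intros)
  note re = has_vector_derivative_add[OF has_vector_derivative_diff[OF S' inner_has_vector_derivative[OF D' Q']]
      inner_has_vector_derivative[OF p' q']]
  note im = has_vector_derivative_add[OF inner_has_vector_derivative[OF D' D'] inner_has_vector_derivative[OF p' p']]
  note cplx = bounded_linear.has_vector_derivative[OF bounded_linear_of_real]
  note main = has_vector_derivative_add[OF cplx[OF re] has_vector_derivative_mult_right[OF cplx[OF im], of "\<i> / 2"]]
  have eq: "x + \<sigma> *\<^sub>R (0, c) = (\<zeta>, a + \<sigma> *\<^sub>R c)" for \<sigma>
    by (simp add: x)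
  show ?thesis
    unfolding phase_def eq fst_conv snd_conv unfolding x
    by (rule has_vector_derivative_eq_rhs[OF main])
      (simp add: phase_deriv_def inner_commute algebra_simps)
qed

lemma displacement_continuous_on: "continuous_on UNIV displacement"
  unfolding displacement_def[abs_def] by (intro continuous_intros flow_map_continuous_on)

lemma wave_continuous_on: "continuous_on UNIV wave"
  unfolding wave_def[abs_def] phase_def
  by (intro continuous_intros continuous_on_comp_snd[OF displacement_continuous_on]
      continuous_on_comp_snd[OF flow_map_continuous_on] continuous_on_comp_snd[OF action_continuous_on]) (use \<epsilon> in auto)

lemma phase_deriv_continuous_on: "continuous_on UNIV (phase_deriv c)"
  unfolding phase_deriv_def[abs_def]
  by (intro continuous_intros continuous_on_comp_snd[OF displacement_continuous_on]
      continuous_on_comp_snd[OF flow_deriv_continuous_on])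

lemma wave_has_vector_derivative:
  "((\<lambda>\<sigma>. wave (x + \<sigma> *\<^sub>R (0, c))) has_vector_derivative wave x * (\<i> / of_real \<epsilon> * phase_deriv c x)) (at 0)"
proof -
  have "((\<lambda>\<sigma>. \<i> / of_real \<epsilon> * phase (x + \<sigma> *\<^sub>R (0, c))) has_vector_derivative \<i> / of_real \<epsilon> * phase_deriv c x) (at 0)"
    by (intro has_vector_derivative_mult_right phase_has_vector_derivative)
  from field_vector_diff_chain_at[OF this DERIV_exp] show ?thesis
    by (simp add: wave_def[abs_def] o_def algebra_simps flip: zero_prod_def)
qed

lemma norm_wave:
  "norm (wave x) = exp (- ((norm (displacement (snd x)))\<^sup>2 + (norm (fst x - snd (snd x)))\<^sup>2) / (2 * \<epsilon>))"
  using \<epsilon> by (simp add: wave_def phase_def power2_norm_eq_inner field_simps)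

lemma norm_wave_le: "norm (wave x) \<le> 1"
  unfolding norm_wave using \<epsilon> by (simp add: divide_nonpos_nonneg)

text \<open>The Gaussian modulus absorbs linear growth: \<open>y \<le> 1 + y^2 \<le> (1 + 2 *
  \<epsilon>) * (1 + y^2 / (2 * \<epsilon>))\<close>, and the last factor is at most
  \<open>exp (y^2 / (2 * \<epsilon>))\<close>.\<close>

lemma norm_wave_displacement_le: "norm (wave x) * \<bar>displacement (snd x) $ j\<bar> \<le> 1 + 2 * \<epsilon>"
proof -
  define y where "y = norm (displacement (snd x))"
  have "y \<le> 1 + y\<^sup>2"
    using zero_le_power2[of "y - 1 / 2"] by (simp add: power2_eq_square algebra_simps)
  also have "\<dots> \<le> (1 + 2 * \<epsilon>) * (1 + y\<^sup>2 / (2 * \<epsilon>))"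
    using \<epsilon> by (simp add: field_simps)
  also have "\<dots> \<le> (1 + 2 * \<epsilon>) * exp (y\<^sup>2 / (2 * \<epsilon>))"
    using \<epsilon> by (intro mult_left_mono exp_ge_add_one_self) auto
  finally have "exp (- (y\<^sup>2 / (2 * \<epsilon>))) * y \<le> 1 + 2 * \<epsilon>"
    by (simp add: exp_minus field_simps)
  moreover have "norm (wave x) \<le> exp (- (y\<^sup>2 / (2 * \<epsilon>)))"
  proof -
    have "y\<^sup>2 / (2 * \<epsilon>) \<le> (y\<^sup>2 + (norm (fst x - snd (snd x)))\<^sup>2) / (2 * \<epsilon>)"
      using \<epsilon> by (intro divide_right_mono) auto
    then show ?thesis
      unfolding norm_wave y_def by (simp only: exp_le_cancel_iff minus_divide_left[symmetric] neg_le_iff_le)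
  qed
  moreover have "\<bar>displacement (snd x) $ j\<bar> \<le> y"
    unfolding y_def by (rule component_le_norm_cart)
  ultimately show ?thesis
    by (smt (verit) exp_gt_zero mult_mono norm_ge_zero abs_ge_zero)
qed

text \<open>The index \<open>(k, False)\<close> stands for \<open>\<partial>/\<partial>q\<^sub>k\<close> and \<open>(k, True)\<close> for \<open>-\<i> \<partial>/\<partial>p\<^sub>k\<close>; together they
  form the derivative in \<open>z\<^sub>k\<close>.\<close>

definition direction :: "'n \<times> bool \<Rightarrow> (real ^ 'n) \<times> (real ^ 'n)" where
  "direction i = (if snd i then (0, axis (fst i) 1) else (axis (fst i) 1, 0))"

definition weight :: "'n \<times> bool \<Rightarrow> complex" where
  "weight i = (if snd i then - \<i> else 1)"

definition amp_deriv :: "'n \<times> bool \<Rightarrow> 'n \<Rightarrow> (real ^ 'n) \<times> (real ^ 'n) \<times> (real ^ 'n) \<Rightarrow> complex" where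
  "amp_deriv i j x = partial (0, direction i) v x $ j * Zinv t j (fst i) (snd x)
    + v x $ j * Zinv_deriv t (direction i) j (fst i) (snd x)"

text \<open>The vector field to which the divergence theorem is applied, in the direction
  \<open>i\<close>. The weight is built in, so that the ordinary divergence in \<open>(q, p)\<close>
  is the sum of the derivatives in \<open>z_k\<close>.\<close>

definition div_field :: "'n \<times> bool \<Rightarrow> (real ^ 'n) \<times> (real ^ 'n) \<times> (real ^ 'n) \<Rightarrow> complex" where
  "div_field i x = (\<Sum>j\<in>UNIV. weight i * wave x * \<psi> (fst x) * Zinv t j (fst i) (snd x) * v x $ j)"

definition div_field_deriv :: "'n \<times> bool \<Rightarrow> (real ^ 'n) \<times> (real ^ 'n) \<times> (real ^ 'n) \<Rightarrow> complex" where
  "div_field_deriv i x = weight i * wave x * \<psi> (fst x) *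
    (\<Sum>j\<in>UNIV. \<i> / of_real \<epsilon> * phase_deriv (direction i) x * (v x $ j * Zinv t j (fst i) (snd x)) + amp_deriv i j x)"

lemma direction_in_Basis: "(0, direction i) \<in> Basis"
proof -
  have "direction i \<in> Basis"
    by (auto simp: direction_def Basis_prod_def axis_in_Basis_iff)
  then show ?thesis
    by (subst Basis_prod_def) blast
qed

lemma nth_continuous_on: "continuous_on UNIV g \<Longrightarrow> continuous_on UNIV (\<lambda>x. g x $ j)"
  by (intro continuous_intros)

lemma amplitude_has_vector_derivative:
  "((\<lambda>\<sigma>. v (x + \<sigma> *\<^sub>R (0, direction i)) $ j * Zinv t j (fst i) (snd (x + \<sigma> *\<^sub>R (0, direction i))))
    has_vector_derivative amp_deriv i j x) (at 0)"
proof -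
  have "((\<lambda>\<sigma>. v (x + \<sigma> *\<^sub>R (0, direction i))) has_vector_derivative partial (0, direction i) v x) (at 0)"
    using has_vector_derivative_partial[OF schwartz_differentiable[OF v], where x = x and s = 0 and b = "(0, direction i)"]
    by (simp flip: zero_prod_def)
  from bounded_linear.has_vector_derivative[OF bounded_linear_vec_nth this]
    Zinv_has_vector_derivative[of t j "fst i" "snd x" "direction i"]
  show ?thesis
    unfolding amp_deriv_def
    by (intro has_vector_derivative_eq_rhs[OF has_vector_derivative_mult]) (auto simp flip: zero_prod_def)
qed

lemma div_field_has_vector_derivative:
  "((\<lambda>\<sigma>. div_field i (x + \<sigma> *\<^sub>R (0, direction i))) has_vector_derivative div_field_deriv i x) (at 0)"
proof -
  define A where "A j y = v y $ j * Zinv t j (fst i) (snd y)" for j y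
  have A: "((\<lambda>\<sigma>. A j (x + \<sigma> *\<^sub>R (0, direction i))) has_vector_derivative amp_deriv i j x) (at 0)" for j
    unfolding A_def by (rule amplitude_has_vector_derivative)
  have "div_field i y = (\<Sum>j\<in>UNIV. weight i * \<psi> (fst y) * (wave y * A j y))" for y
    by (simp add: div_field_def A_def algebra_simps)
  moreover have "((\<lambda>\<sigma>. \<Sum>j\<in>UNIV. weight i * \<psi> (fst x) * (wave (x + \<sigma> *\<^sub>R (0, direction i)) * A j (x + \<sigma> *\<^sub>R (0, direction i))))
      has_vector_derivative (\<Sum>j\<in>UNIV. weight i * \<psi> (fst x) * (wave x * amp_deriv i j x
        + wave x * (\<i> / of_real \<epsilon> * phase_deriv (direction i) x) * A j x))) (at 0)"
    using has_vector_derivative_mult[OF wave_has_vector_derivative[of x "direction i"] A]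
    by (intro has_vector_derivative_sum has_vector_derivative_mult_right) (simp flip: zero_prod_def)
  moreover have "div_field_deriv i x = (\<Sum>j\<in>UNIV. weight i * \<psi> (fst x) * (wave x * amp_deriv i j x
        + wave x * (\<i> / of_real \<epsilon> * phase_deriv (direction i) x) * A j x))"
    by (simp add: div_field_deriv_def A_def sum_distrib_left algebra_simps)
  ultimately show ?thesis
    by simp
qed

lemma v_nth_continuous_on: "continuous_on UNIV (\<lambda>x. v x $ j)"
  by (intro nth_continuous_on schwartz_continuous_on v)

lemma partial_v_nth_continuous_on: "continuous_on UNIV (\<lambda>x. partial (0, direction i) v x $ j)"
  by (intro nth_continuous_on schwartz_continuous_on schwartz_partial v direction_in_Basis)

lemma psi_continuous_on: "continuous_on UNIV (\<lambda>x. \<psi> (fst x))"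
  by (intro continuous_on_comp_fst schwartz_continuous_on \<psi>)

lemmas parts_continuous_on = v_nth_continuous_on partial_v_nth_continuous_on psi_continuous_on
  wave_continuous_on phase_deriv_continuous_on continuous_on_comp_snd[OF Zinv_continuous_on]
  continuous_on_comp_snd[OF Zinv_deriv_continuous_on] continuous_on_comp_snd[OF displacement_continuous_on]

lemma div_field_continuous_on: "continuous_on UNIV (div_field i)"
  unfolding div_field_def[abs_def] by (intro continuous_intros parts_continuous_on)

lemma div_field_deriv_continuous_on: "continuous_on UNIV (div_field_deriv i)"
  unfolding div_field_deriv_def[abs_def] amp_deriv_def by (intro continuous_intros parts_continuous_on)

lemma v_nth_integrable: "integrable lborel (\<lambda>x. v x $ j)"
  by (rule integrable_bounded_linear[OF bounded_linear_vec_nth schwartz_integrable[OF v]])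

lemma partial_v_nth_integrable: "integrable lborel (\<lambda>x. partial (0, direction i) v x $ j)"
  by (rule integrable_bounded_linear[OF bounded_linear_vec_nth
        schwartz_integrable[OF schwartz_partial[OF v direction_in_Basis]]])

text \<open>The decay of \<open>v\<close> in all three variables carries the integrability; the
  exponential and \<open>\<psi>\<close> enter as a bounded multiplier.\<close>

lemma wave_psi_bounded:
  obtains B where "B \<ge> 0" and "\<And>x. norm (wave x * \<psi> (fst x)) \<le> B"
proof -
  obtain B where B: "\<And>x. norm (\<psi> x) \<le> B"
    using schwartz_bounded[OF \<psi>] by blast
  have "B \<ge> 0"
    using order_trans[OF norm_ge_zero B] .
  moreover have "norm (wave x * \<psi> (fst x)) \<le> 1 * B" for x
    unfolding norm_mult by (intro mult_mono norm_wave_le B) auto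
  ultimately show ?thesis
    using that[of B] by simp
qed

lemma norm_weight: "norm (weight i) = 1"
  by (simp add: weight_def)

lemma div_field_integrable: "integrable lborel (div_field i)"
proof -
  obtain B where B: "B \<ge> 0" "\<And>x. norm (wave x * \<psi> (fst x)) \<le> B"
    using wave_psi_bounded by blast
  show ?thesis
    unfolding div_field_def[abs_def]
  proof (intro Bochner_Integration.integrable_sum integrable_mult_bounded[OF v_nth_integrable])
    fix j and x :: "(real ^ 'n) \<times> (real ^ 'n) \<times> (real ^ 'n)"
    show "continuous_on UNIV (\<lambda>x. weight i * wave x * \<psi> (fst x) * Zinv t j (fst i) (snd x))"
      by (intro continuous_intros parts_continuous_on)
    have "norm (wave x * \<psi> (fst x)) * norm (Zinv t j (fst i) (snd x)) \<le> B * 1"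
      by (intro mult_mono B norm_Zinv_le) auto
    then show "norm (weight i * wave x * \<psi> (fst x) * Zinv t j (fst i) (snd x)) \<le> B"
      by (simp add: norm_mult norm_weight)
  qed
qed

section \<open>The two integrands and their difference\<close>

definition left_integrand :: "(real ^ 'n) \<times> (real ^ 'n) \<times> (real ^ 'n) \<Rightarrow> complex" where
  "left_integrand x = wave x * (\<Sum>j\<in>UNIV. of_real (displacement (snd x) $ j) * v x $ j) * \<psi> (fst x)"

definition right_integrand :: "(real ^ 'n) \<times> (real ^ 'n) \<times> (real ^ 'n) \<Rightarrow> complex" where
  "right_integrand x = wave x * (\<Sum>j\<in>UNIV. \<Sum>k\<in>UNIV. - \<i> * of_real \<epsilon> *
    (amp_deriv (k, False) j x - \<i> * amp_deriv (k, True) j x)) * \<psi> (fst x)"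

text \<open>The unbounded factor \<open>\<xi> - P\<close> is absorbed by the exponential, which
  leaves a bounded multiplier of \<open>v\<close>.\<close>

lemma left_integrand_integrable: "integrable lborel left_integrand"
proof -
  obtain B where B: "\<And>x. norm (\<psi> x) \<le> B"
    using schwartz_bounded[OF \<psi>] by blast
  have eq: "left_integrand = (\<lambda>x. \<Sum>j\<in>UNIV. (wave x * of_real (displacement (snd x) $ j) * \<psi> (fst x)) * v x $ j)"
    by (simp add: left_integrand_def fun_eq_iff sum_distrib_left sum_distrib_right ac_simps)
  show ?thesis
    unfolding eq
  proof (intro Bochner_Integration.integrable_sum integrable_mult_bounded[OF v_nth_integrable])
    fix j and x :: "(real ^ 'n) \<times> (real ^ 'n) \<times> (real ^ 'n)"
    show "continuous_on UNIV (\<lambda>x. wave x * of_real (displacement (snd x) $ j) * \<psi> (fst x))"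
      by (intro continuous_intros parts_continuous_on)
    have "(norm (wave x) * \<bar>displacement (snd x) $ j\<bar>) * norm (\<psi> (fst x)) \<le> (1 + 2 * \<epsilon>) * B"
      using \<epsilon> by (intro mult_mono norm_wave_displacement_le B) auto
    then show "norm (wave x * of_real (displacement (snd x) $ j) * \<psi> (fst x)) \<le> (1 + 2 * \<epsilon>) * B"
      by (simp add: norm_mult)
  qed
qed

lemma right_integrand_integrable:
  assumes "subquadratic T" "subquadratic V"
  shows "integrable lborel right_integrand"
proof -
  obtain B where B: "B \<ge> 0" "\<And>x. norm (wave x * \<psi> (fst x)) \<le> B"
    using wave_psi_bounded by blast
  have amp: "integrable lborel (\<lambda>x. (wave x * \<psi> (fst x)) * amp_deriv i j x)" for i j
  proof -
    \<comment> \<open>Here, and only here in this proof, the growth conditions enter.\<close>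
    obtain C where C: "\<And>a. norm (Zinv_deriv t (direction i) j (fst i) a) \<le> C"
      using Zinv_deriv_bounded[OF assms] unfolding bounded_iff by (metis rangeI)
    have "integrable lborel (\<lambda>x. (wave x * \<psi> (fst x) * Zinv t j (fst i) (snd x)) * partial (0, direction i) v x $ j)"
    proof (rule integrable_mult_bounded[OF partial_v_nth_integrable])
      show "norm (wave x * \<psi> (fst x) * Zinv t j (fst i) (snd x)) \<le> B * 1" for x
        unfolding norm_mult[of _ "Zinv _ _ _ _"] by (intro mult_mono B norm_Zinv_le) auto
    qed (intro continuous_intros parts_continuous_on)
    moreover have "integrable lborel (\<lambda>x. (wave x * \<psi> (fst x) * Zinv_deriv t (direction i) j (fst i) (snd x)) * v x $ j)"
    proof (rule integrable_mult_bounded[OF v_nth_integrable])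
      show "norm (wave x * \<psi> (fst x) * Zinv_deriv t (direction i) j (fst i) (snd x)) \<le> B * C" for x
        unfolding norm_mult[of _ "Zinv_deriv _ _ _ _ _"] by (intro mult_mono B C) auto
    qed (intro continuous_intros parts_continuous_on)
    ultimately show ?thesis
      unfolding amp_deriv_def using Bochner_Integration.integrable_add by (fastforce simp: algebra_simps)
  qed
  have eq: "right_integrand = (\<lambda>x. \<Sum>j\<in>UNIV. \<Sum>k\<in>UNIV. - \<i> * of_real \<epsilon> * ((wave x * \<psi> (fst x)) * amp_deriv (k, False) j x)
      - of_real \<epsilon> * ((wave x * \<psi> (fst x)) * amp_deriv (k, True) j x))"
    by (simp add: right_integrand_def fun_eq_iff sum_distrib_left sum_distrib_right algebra_simps)
  show ?thesis
    unfolding eq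
    by (intro Bochner_Integration.integrable_sum Bochner_Integration.integrable_diff integrable_mult_right amp)
qed

text \<open>The contributions of \<open>\<zeta> - p\<close> in the directions \<open>q_k\<close> and
  \<open>p_k\<close> are \<open>(\<zeta> - p)_k\<close> and \<open>- \<i> * (\<zeta> - p)_k\<close>;
  they cancel in the combination that forms the derivative in \<open>z_k\<close>. The terms in
  \<open>\<xi> - P\<close> assemble to a row of \<open>Z\<close>.\<close>

lemma phase_dz:
  "phase_deriv (axis k 1, 0) x - \<i> * phase_deriv (0, axis k 1) x
    = - (\<Sum>m\<in>UNIV. Zmat Q P t (fst (snd x)) (snd (snd x)) $ k $ m * of_real (displacement (snd x) $ m))"
proof -
  have re: "of_real (displacement a \<bullet> u) = (\<Sum>m\<in>UNIV. of_real (displacement a $ m) * complex_of_real (u $ m))" for a u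
    by (simp add: inner_vec_def)
  show ?thesis
    by (simp add: phase_deriv_def Zmat_nth complexify_def re inner_axis algebra_simps
        sum.distrib sum_subtractf sum_distrib_left sum_negf)
qed

lemma Zinv_Zmat: "(\<Sum>k\<in>UNIV. Zinv t j k a * Zmat Q P t (fst a) (snd a) $ k $ m) = (if j = m then 1 else 0)"
proof -
  have "(\<Sum>k\<in>UNIV. Zinv t j k a * Zmat Q P t (fst a) (snd a) $ k $ m)
      = (matrix_inv (Zmat Q P t (fst a) (snd a)) ** Zmat Q P t (fst a) (snd a)) $ j $ m"
    by (simp add: Zinv_def matrix_matrix_mult_def)
  then show ?thesis
    by (simp add: matrix_inv_mult[OF invertible_Zmat] mat_def)
qed

text \<open>Exchanging the sums exposes \<open>Z^-1 Z = 1\<close>, which isolates one component of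
  \<open>\<xi> - P\<close>.\<close>

lemma sum_Zinv_phase_dz:
  "(\<Sum>k\<in>UNIV. Zinv t j k (snd x) * (phase_deriv (axis k 1, 0) x - \<i> * phase_deriv (0, axis k 1) x))
    = - of_real (displacement (snd x) $ j)"
proof -
  have "(\<Sum>k\<in>UNIV. Zinv t j k (snd x) * (phase_deriv (axis k 1, 0) x - \<i> * phase_deriv (0, axis k 1) x))
      = - (\<Sum>k\<in>UNIV. \<Sum>m\<in>UNIV. Zinv t j k (snd x) * Zmat Q P t (fst (snd x)) (snd (snd x)) $ k $ m * of_real (displacement (snd x) $ m))"
    by (simp add: phase_dz sum_distrib_left sum_negf mult.assoc)
  also have "\<dots> = - (\<Sum>m\<in>UNIV. \<Sum>k\<in>UNIV. Zinv t j k (snd x) * Zmat Q P t (fst (snd x)) (snd (snd x)) $ k $ m * of_real (displacement (snd x) $ m))"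
    by (subst sum.swap) simp
  also have "\<dots> = - (\<Sum>m\<in>UNIV. (if j = m then 1 else 0) * of_real (displacement (snd x) $ m))"
    by (simp only: Zinv_Zmat flip: sum_distrib_right)
  also have "\<dots> = - of_real (displacement (snd x) $ j)"
    by (simp add: if_distrib[of "\<lambda>c. c * _"] cong: if_cong)
  finally show ?thesis .
qed

text \<open>The derivative falls either on the exponential or on \<open>v_j Z^-1_jk\<close>. The
  first kind sums to the left integrand by \<open>sum_Zinv_phase_dz\<close>, the second gives the
  right one; \<open>\<i> / \<epsilon>\<close> is the inverse of
  \<open>- \<i> * \<epsilon>\<close>.\<close>

lemma divergence_eq:
  "(\<Sum>i\<in>UNIV. div_field_deriv i x) = \<i> / of_real \<epsilon> * (right_integrand x - left_integrand x)"
proof -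
  define E where "E = wave x * \<psi> (fst x)"
  define A where "A k j = amp_deriv (k, False) j x - \<i> * amp_deriv (k, True) j x" for k j
  define D where "D k = phase_deriv (axis k 1, 0) x - \<i> * phase_deriv (0, axis k 1) x" for k
  have "(\<Sum>i\<in>UNIV. div_field_deriv i x) = (\<Sum>(k, s)\<in>UNIV \<times> UNIV. div_field_deriv (k, s) x)"
    by simp
  also have "\<dots> = (\<Sum>k\<in>UNIV. \<Sum>s\<in>UNIV. div_field_deriv (k, s) x)"
    by (rule sum.cartesian_product[symmetric])
  also have "\<dots> = (\<Sum>k\<in>UNIV. div_field_deriv (k, False) x + div_field_deriv (k, True) x)"
    by (simp add: UNIV_bool)
  also have "\<dots> = (\<Sum>k\<in>UNIV. E * (\<Sum>j\<in>UNIV. \<i> / of_real \<epsilon> * D k * (v x $ j * Zinv t j k (snd x)) + A k j))"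
    by (simp add: div_field_deriv_def weight_def direction_def E_def A_def D_def sum_distrib_left
        algebra_simps flip: sum.distrib)
  also have "\<dots> = E * (\<Sum>j\<in>UNIV. \<Sum>k\<in>UNIV. \<i> / of_real \<epsilon> * D k * (v x $ j * Zinv t j k (snd x)) + A k j)"
    by (subst sum.swap) (simp add: sum_distrib_left)
  also have "\<dots> = E * (\<Sum>j\<in>UNIV. \<i> / of_real \<epsilon> * (v x $ j) * (\<Sum>k\<in>UNIV. Zinv t j k (snd x) * D k) + (\<Sum>k\<in>UNIV. A k j))"
    by (simp add: sum.distrib sum_distrib_left ac_simps)
  also have "\<dots> = E * (\<Sum>j\<in>UNIV. \<i> / of_real \<epsilon> * (v x $ j) * (- of_real (displacement (snd x) $ j)) + (\<Sum>k\<in>UNIV. A k j))"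
    by (simp only: D_def sum_Zinv_phase_dz)
  also have "\<dots> = \<i> / of_real \<epsilon> * (right_integrand x - left_integrand x)"
  proof -
    have "right_integrand x = E * (- \<i> * of_real \<epsilon>) * (\<Sum>j\<in>UNIV. \<Sum>k\<in>UNIV. A k j)"
      by (simp add: right_integrand_def A_def E_def sum_distrib_left ac_simps)
    \<comment> \<open>Brings two separated factors \<open>\<i>\<close> together, for use as a
      rewrite rule.\<close>
    moreover have "\<i> * (z * (\<i> * w)) = - (z * w)" for z w
    proof -
      have "\<i> * (z * (\<i> * w)) = (\<i> * \<i>) * (z * w)"
        by (simp only: ac_simps)
      then show ?thesis
        by simp
    qed
    ultimately have "\<i> / of_real \<epsilon> * right_integrand x = E * (\<Sum>j\<in>UNIV. \<Sum>k\<in>UNIV. A k j)"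
      using \<epsilon> by simp
    moreover have "\<i> / of_real \<epsilon> * left_integrand x = E * (\<Sum>j\<in>UNIV. \<i> / of_real \<epsilon> * (v x $ j) * of_real (displacement (snd x) $ j))"
      by (simp add: left_integrand_def E_def sum_distrib_left sum_distrib_right ac_simps)
    ultimately show ?thesis
      by (simp add: sum.distrib sum_negf sum_subtractf algebra_simps)
  qed
  finally show ?thesis .
qed

text \<open>Integrability of both integrands makes the whole divergence integrable, although its
  individual summands need not be; its integral then vanishes.\<close>

lemma integral_left_eq_right:
  assumes "integrable lborel right_integrand"
  shows "integral\<^sup>L lborel left_integrand = integral\<^sup>L lborel right_integrand"
proof -
  have "(\<integral>x. (\<Sum>i\<in>UNIV. div_field_deriv i x) \<partial>lborel) = 0"
  proof (rule integral_divergence_eq_0[where G = div_field and b = "\<lambda>i. (0, direction i)"])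
    show "integrable lborel (\<lambda>x. \<Sum>i\<in>UNIV. div_field_deriv i x)"
      unfolding divergence_eq using assms left_integrand_integrable by simp
  qed (rule finite_class.finite_UNIV div_field_continuous_on div_field_integrable
      div_field_deriv_continuous_on div_field_has_vector_derivative)+
  then show ?thesis
    using assms left_integrand_integrable \<epsilon> by (simp add: divergence_eq)
qed

lemma left_integrand_eq:
  "fio_integrand \<epsilon> (dual_phase S Q P t) (\<lambda>\<xi> \<zeta> q p. \<Sum>j\<in>UNIV. of_real ((\<xi> - P t q p) $ j) * v (\<zeta>, q, p) $ j) \<psi> \<xi>
    = left_integrand"
  using dual_phase_eq
  by (auto simp: fio_integrand_def left_integrand_def fun_eq_iff wave_def displacement_def flow_map_def)

text \<open>\<open>dz\<close> acts with \<open>\<zeta>\<close> frozen, which amounts to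
  differentiating the triple along \<open>(0, direction i)\<close>.\<close>

lemma right_integrand_eq:
  "fio_integrand \<epsilon> (dual_phase S Q P t) (\<lambda>\<xi> \<zeta> q p. \<Sum>j\<in>UNIV. \<Sum>k\<in>UNIV. - \<i> * of_real \<epsilon> *
      dz k (\<lambda>(q', p'). v (\<zeta>, q', p') $ j * matrix_inv (Zmat Q P t q' p') $ j $ k) (q, p)) \<psi> \<xi>
    = right_integrand"
proof -
  have "partial (direction i) (\<lambda>(q', p'). v (\<zeta>, q', p') $ j * matrix_inv (Zmat Q P t q' p') $ j $ fst i) a
      = amp_deriv i j (\<zeta>, a)" for i j \<zeta> a
    by (rule partialI) (use amplitude_has_vector_derivative[of "(\<zeta>, a)" i j] in \<open>simp add: Zinv_def case_prod_beta del: fst_add snd_add\<close>)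
  from this[of "(_, False)"] this[of "(_, True)"]
  have "dz k (\<lambda>(q', p'). v (\<zeta>, q', p') $ j * matrix_inv (Zmat Q P t q' p') $ j $ k) a
      = amp_deriv (k, False) j (\<zeta>, a) - \<i> * amp_deriv (k, True) j (\<zeta>, a)" for k j \<zeta> a
    by (simp add: dz_def direction_def)
  then show ?thesis
    using dual_phase_eq by (auto simp: fio_integrand_def right_integrand_def fun_eq_iff wave_def)
qed

end

text \<open>The Bochner integral of a non-integrable function is 0, so an equality of integrals is
  informative only next to integrability. The growth conditions guard the conjunct that proves
  integrability on the right and with it the equivalence of the symbols.\<close>

theorem lemma2p7:
  fixes T V :: "real ^ 'n \<Rightarrow> real"
    and Q P :: "real \<Rightarrow> real ^ 'n \<Rightarrow> real ^ 'n \<Rightarrow> real ^ 'n"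
    and S :: "real \<Rightarrow> real ^ 'n \<Rightarrow> real ^ 'n \<Rightarrow> real"
    and v :: "(real ^ 'n) \<times> (real ^ 'n) \<times> (real ^ 'n) \<Rightarrow> complex ^ 'n"
    and \<epsilon> t :: real
  assumes "\<epsilon> > 0"
    and "Ck 3 T" and "Ck 3 V"
    and "hamiltonian_flow (separable_hamiltonian T V) Q P"
    and "dual_action (separable_hamiltonian T V) Q P S"
    and "schwartz v"
  shows "let \<Phi> = dual_phase S Q P t;
             f = (\<lambda>\<xi> \<zeta> q p. \<Sum>j\<in>UNIV. of_real ((\<xi> - P t q p) $ j) * v (\<zeta>, q, p) $ j);
             g = (\<lambda>\<xi> \<zeta> q p. \<Sum>j\<in>UNIV. \<Sum>k\<in>UNIV. - \<i> * of_real \<epsilon> *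
                    dz k (\<lambda>(q', p'). v (\<zeta>, q', p') $ j * matrix_inv (Zmat Q P t q' p') $ j $ k) (q, p))
         in (\<forall>\<psi> \<xi>. schwartz \<psi> \<longrightarrow>
               integrable lborel (fio_integrand \<epsilon> \<Phi> f \<psi> \<xi>) \<and>
               (integrable lborel (fio_integrand \<epsilon> \<Phi> g \<psi> \<xi>) \<longrightarrow>
                  integral\<^sup>L lborel (fio_integrand \<epsilon> \<Phi> f \<psi> \<xi>) =
                  integral\<^sup>L lborel (fio_integrand \<epsilon> \<Phi> g \<psi> \<xi>))) \<and>
            (subquadratic T \<and> subquadratic V \<longrightarrow>
               (\<forall>\<psi> \<xi>. schwartz \<psi> \<longrightarrow> integrable lborel (fio_integrand \<epsilon> \<Phi> g \<psi> \<xi>)) \<and>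
               symbols_equivalent \<epsilon> \<Phi> f g)"
proof -
  define \<Phi> where "\<Phi> = dual_phase S Q P t"
  define f where "f = (\<lambda>(\<xi> :: real ^ 'n) \<zeta> q p. \<Sum>j\<in>UNIV. of_real ((\<xi> - P t q p) $ j) * v (\<zeta>, q, p) $ j)"
  define g where "g = (\<lambda>(\<xi> :: real ^ 'n) \<zeta> q p. \<Sum>j\<in>UNIV. \<Sum>k\<in>UNIV. - \<i> * of_real \<epsilon> *
      dz k (\<lambda>(q', p'). v (\<zeta>, q', p') $ j * matrix_inv (Zmat Q P t q' p') $ j $ k) (q, p))"
  \<comment> \<open>The locale predicate does not mention \<open>t\<close> and \<open>\<xi>\<close>,
    as no assumption constrains them; they are instantiated at each use.\<close>
  have loc: "dual_fio T V Q P S \<epsilon> v \<psi>" if "schwartz \<psi>" for \<psi>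
    using assms that by unfold_locales
  have 1: "integrable lborel (fio_integrand \<epsilon> \<Phi> f \<psi> \<xi>)" if "schwartz \<psi>" for \<psi> \<xi>
    using dual_fio.left_integrand_integrable[OF loc[OF that], of t \<xi>]
    unfolding \<Phi>_def f_def dual_fio.left_integrand_eq[OF loc[OF that]] .
  have 2: "integral\<^sup>L lborel (fio_integrand \<epsilon> \<Phi> f \<psi> \<xi>) = integral\<^sup>L lborel (fio_integrand \<epsilon> \<Phi> g \<psi> \<xi>)"
    if "schwartz \<psi>" "integrable lborel (fio_integrand \<epsilon> \<Phi> g \<psi> \<xi>)" for \<psi> \<xi>
    using dual_fio.integral_left_eq_right[OF loc[OF that(1)], of t \<xi>] that(2)
    unfolding \<Phi>_def f_def g_def dual_fio.left_integrand_eq[OF loc[OF that(1)]] dual_fio.right_integrand_eq[OF loc[OF that(1)]] .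
  have 3: "integrable lborel (fio_integrand \<epsilon> \<Phi> g \<psi> \<xi>)" if "subquadratic T" "subquadratic V" "schwartz \<psi>" for \<psi> \<xi>
    using dual_fio.right_integrand_integrable[OF loc[OF that(3)] that(1,2), of t \<xi>]
    unfolding \<Phi>_def g_def dual_fio.right_integrand_eq[OF loc[OF that(3)]] .
  have "symbols_equivalent \<epsilon> \<Phi> f g" if "subquadratic T" "subquadratic V"
    unfolding symbols_equivalent_def fio_def using 2 3[OF that] by (auto simp: fun_eq_iff)
  then show ?thesis
    unfolding Let_def \<Phi>_def[symmetric] f_def[symmetric] g_def[symmetric] using 1 2 3 by blast
qed

end
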